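(* Let $K$ be a Hermitian integral operator on $L^2(E,\lambda)$ of local trace class with $0\le K\le I$ and $\|K\|<1$, and let $\mu$ be the determinantal point process with correlation kernel $K$. For any $\Lambda\subset\Delta$ in $\mathcal B_0$ and any measurable function $f:\mathcal X_\Lambda\to[0,\infty)$, the ratio $$G_{\Lambda,\Delta}(f\,|\,\xi)\big/G_{\Lambda,\Delta}(N_\Lambda=0\,|\,\xi)$$ is decreasing in $\xi\in\mathcal X_{\Delta\setminus\Lambda}$ (with respect to inclusion, for those $\xi$ with $\det J_{[\Delta]}(\xi,\xi)>0$, for which $G_{\Lambda,\Delta}(\cdot\,|\,\xi)$ is defined). In particular, $G_{\Lambda,\Delta}(N_\Lambda=0\,|\,\cdot)$ is increasing, and for $\Lambda\subset\Delta_1\subset\Delta_2$ in $\mathcal B_0$ we have $$\mu(N_\Lambda=0\,|\,N_{\Delta_2\setminus\Lambda}=0)\le\mu(N_\Lambda=0\,|\,N_{\Delta_1\setminus\Lambda}=0)\le\mu(N_\Lambda=0).$$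
   Context: Setting: $E$ is a locally compact metric space, $\mathcal B$ its Borel $\sigma$-algebra, $\mathcal B_0$ the system of relatively compact Borel sets, $\lambda$ a diffuse (no point masses) locally finite measure on $(E,\mathcal B)$. $\mathcal X$ is the set of locally finite subsets (configurations) $\xi\subset E$, partially ordered by inclusion; identifying $\xi$ with $\sum_{x\in\xi}\delta_x$, it carries the vague topology and is taken to be Polish. $N_\Lambda(\xi)=|\xi\cap\Lambda|$; $\mathcal F$ is the $\sigma$-algebra generated by the $N_\Delta$, $\Delta\in\mathcal B_0$ (the Borel $\sigma$-algebra of $\mathcal X$). $\mathcal X_\Lambda=\{\xi\in\mathcal X:\xi\subset\Lambda\}$, $\alpha\xi:=\alpha\cup\xi$. A point process is a probability measure on $(\mathcal X,\mathcal F)$. $\mathcal X_0$ is the set of finite configurations with trace $\sigma$-algebra, and $L$ is the measure on it with $\int f\,dL=\sum_{m\ge0}\frac1{m!}\int_{E^m}f(\{x_1,\dots,x_m\})\lambda(dx_1)\cdots\lambda(dx_m)$ for measurable $f\ge0$; $L_\Lambda$ is the restriction of $L$ to $\{\alpha\subset\Lambda\}$, $\lambda_\Lambda$ the restriction of $\lambda$ to $\Lambda$. Determinantal process: for $k:E^2\to\mathbb C$ and $\alpha\in\mathcal X_0$ write $k(\alpha,\alpha)=(k(x,y))_{x,y\in\alpha}$ (determinant of the empty matrix is $1$). "Positive" for operators and matrices means nonnegative ($0$ may be in the spectrum). $P_\Lambda$ is the projection of $L^2(E,\lambda)$ onto $L^2(\Lambda,\lambda_\Lambda)$, $T_\Lambda=P_\Lambda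 TP_\Lambda$; $T$ is of local trace class if $T_\Lambda$ is trace class for all $\Lambda\in\mathcal B_0$. The integral kernel $K(x,y)$ of $K$ is chosen such that $K(\alpha,\alpha)$ is positive definite for $L$-a.a. $\alpha$ and $\mathrm{Tr}\,K_\Lambda=\int_\Lambda K(x,x)\lambda(dx)$ for all $\Lambda\in\mathcal B_0$. The determinantal point process with correlation kernel $K$ is the unique point process $\mu$ with correlation function $\rho(\alpha)=\det K(\alpha,\alpha)$, i.e. $\int\mu(d\xi)\sum_{\alpha\in\mathcal X_0,\alpha\subset\xi}u(\alpha)=\int u\rho\,dL$ for all measurable $u:\mathcal X_0\to[0,\infty)$. For $\Delta\in\mathcal B_0$, $J_{[\Delta]}:=K_\Delta(I-K_\Delta)^{-1}$, a positive trace class operator; its integral kernel $t(x,y)=J_{[\Delta]}(x,y)$ is chosen positive definite (all matrices $t(\alpha,\alpha)$, $\alpha$ finite, are positive definite) and such that $\mathrm{Tr}(P_\Lambda J_{[\Delta]}^kP_\Lambda)=\int_{E^k}1_\Lambda(x_1)t(x_1,x_2)\cdots t(x_k,x_1)\lambda(dx_1)\cdots\lambda(dx_k)$ for all $k\ge1$, $\Lambda\in\mathcal B$ (such a choice exists). Local conditional probabilities: for $\Delta\in\mathcal B_0$ put $\hat c_\Delta(\alpha,\xi)=\det J_{[\Delta]}(\alpha\xi,\alpha\xi)/\det J_{[\Delta]}(\xi,\xi)$ ($:=0$ if the denominator vanishes). For $\Lambda\subset\Delta$ in $\mathcal B_0$, measurable $f:\mathcal X_\Lambda\to[0,\infty)$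 and $\xi\in\mathcal X_{\Delta\setminus\Lambda}$ with $\det J_{[\Delta]}(\xi,\xi)>0$, $$G_{\Lambda,\Delta}(f\,|\,\xi)=Z_{\Lambda,\Delta}(\xi)^{-1}\int L_\Lambda(d\alpha)\,f(\alpha)\,\hat c_\Delta(\alpha,\xi),\qquad Z_{\Lambda,\Delta}(\xi)=\int L_\Lambda(d\alpha)\,\hat c_\Delta(\alpha,\xi)\in(0,\infty),$$ and $G_{\Lambda,\Delta}(N_\Lambda=0\,|\,\xi)=G_{\Lambda,\Delta}(1_{\{N_\Lambda=0\}}\,|\,\xi)$. *)

theory Defs
  imports "HOL-Probability.Probability"
begin

section \<open>Configurations and point processes\<close>

definition bounded_borel :: "'a::topological_space set set" where
  "bounded_borel = {A \<in> sets borel. compact (closure A)}"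

definition locally_finite_measure :: "'a::topological_space measure \<Rightarrow> bool" where
  "locally_finite_measure M \<longleftrightarrow>
     sets M = sets borel \<and> (\<forall>A\<in>bounded_borel. emeasure M A < \<infinity>)"

definition diffuse :: "'a measure \<Rightarrow> bool" where
  "diffuse M \<longleftrightarrow> (\<forall>x\<in>space M. emeasure M {x} = 0)"

definition configurations :: "'a::topological_space set set" where
  "configurations = {\<xi>. \<forall>\<Delta>\<in>bounded_borel. finite (\<xi> \<inter> \<Delta>)}"

definition configs_in :: "'a::topological_space set \<Rightarrow> 'a set set" where
  "configs_in \<Lambda> = {\<xi>\<in>configurations. \<xi> \<subseteq> \<Lambda>}"

text \<open>The counting variable; only meaningful where \<open>\<xi> \<inter> \<Lambda>\<close> is finite, since \<open>card\<close> vanishes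
  on infinite sets. It is only used for \<open>\<Lambda>\<close> relatively compact and \<open>\<xi>\<close> a configuration.\<close>

definition count_in :: "'a set \<Rightarrow> 'a set \<Rightarrow> nat" where
  "count_in \<Lambda> \<xi> = card (\<xi> \<inter> \<Lambda>)"

definition config_space :: "'a::topological_space set measure" where
  "config_space =
     sigma configurations {{\<xi>\<in>configurations. count_in \<Delta> \<xi> = n} |\<Delta> n. \<Delta> \<in> bounded_borel}"

definition finite_config_space :: "'a::topological_space set measure" where
  "finite_config_space = restrict_space config_space {\<alpha>. finite \<alpha>}"

definition point_process :: "'a::topological_space set measure \<Rightarrow> bool" where
  "point_process \<mu> \<longleftrightarrow> prob_space \<mu> \<and> sets \<mu> = sets config_space"

text \<open>The measure \<open>L\<close> on finite configurations. That the set function below is indeed a measure, with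
  the expected integrals, is lemma \<open>nn_integral_config_measure\<close>. Tuples with repeated entries, which
  have a smaller image, form a null set when \<open>M\<close> is diffuse.\<close>

definition config_measure :: "'a::topological_space measure \<Rightarrow> 'a set measure" where
  "config_measure M =
     measure_of (space finite_config_space) (sets finite_config_space)
       (\<lambda>A. \<Sum>m. ennreal (1 / fact m) *
          (\<integral>\<^sup>+x. indicator A (x ` {..<m}) \<partial>(\<Pi>\<^sub>M i\<in>{..<m}. M)))"

definition config_measure_in :: "'a::topological_space measure \<Rightarrow> 'a set \<Rightarrow> 'a set measure" where
  "config_measure_in M \<Lambda> = restrict_space (config_measure M) {\<alpha>. \<alpha> \<subseteq> \<Lambda>}"

lemma space_config_space: "space config_space = configurations"
  unfolding config_space_def by (rule space_measure_of) auto

lemma finite_in_configurations: "finite \<alpha> \<Longrightarrow> \<alpha> \<in> configurations"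
  by (auto simp: configurations_def)

lemma space_finite_config_space: "space finite_config_space = {\<alpha>. finite \<alpha>}"
  by (auto simp: finite_config_space_def space_restrict_space space_config_space
      finite_in_configurations)

lemma count_in_image:
  "count_in \<Delta> (x ` {..<m::nat}) = (\<Sum>i<m. of_bool (x i \<in> \<Delta> \<and> (\<forall>j\<in>{..<i}. x j \<noteq> x i)))"
proof (induction m)
  case 0
  then show ?case by (simp add: count_in_def)
next
  case (Suc m)
  have img: "x ` {..<Suc m} = insert (x m) (x ` {..<m})"
    by (simp add: lessThan_Suc)
  show ?case
  proof (cases "x m \<in> \<Delta> \<and> (\<forall>j\<in>{..<m}. x j \<noteq> x m)")
    case True
    then have "x m \<notin> x ` {..<m} \<inter> \<Delta>" by force
    then have "count_in \<Delta> (x ` {..<Suc m}) = Suc (count_in \<Delta> (x ` {..<m}))"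
      using True unfolding count_in_def img by simp
    then show ?thesis using True Suc.IH by simp
  next
    case False
    then have "x m \<in> x ` {..<m}" if "x m \<in> \<Delta>"
      using that by (metis imageI)
    then have "x ` {..<Suc m} \<inter> \<Delta> = x ` {..<m} \<inter> \<Delta>"
      unfolding img by blast
    then show ?thesis using False Suc.IH by (simp add: count_in_def)
  qed
qed

lemma measurable_image_config:
  fixes M :: "'a::{metric_space, second_countable_topology} measure" and m :: nat
  assumes M: "sets M = sets borel"
  shows "(\<lambda>x. x ` {..<m}) \<in> measurable (\<Pi>\<^sub>M i\<in>{..<m}. M) finite_config_space"
  unfolding finite_config_space_def
proof (rule measurable_restrict_space2)
  show "(\<lambda>x. x ` {..<m}) \<in> space (\<Pi>\<^sub>M i\<in>{..<m}. M) \<rightarrow> {\<alpha>. finite \<alpha>}"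
    by (intro funcsetI) simp
  show "(\<lambda>x. x ` {..<m}) \<in> measurable (\<Pi>\<^sub>M i\<in>{..<m}. M) config_space"
    unfolding config_space_def
  proof (rule measurable_measure_of)
    fix A :: "'a set set"
    assume "A \<in> {{\<xi> \<in> configurations. count_in \<Delta> \<xi> = n} |\<Delta> n. \<Delta> \<in> bounded_borel}"
    then obtain \<Delta> n where A: "A = {\<xi> \<in> configurations. count_in \<Delta> \<xi> = n}"
      and \<Delta>: "\<Delta> \<in> bounded_borel" by blast
    have [measurable]: "\<Delta> \<in> sets borel" using \<Delta> by (simp add: bounded_borel_def)
    have eq: "(\<lambda>x. x ` {..<m}) -` A \<inter> space (\<Pi>\<^sub>M i\<in>{..<m}. M) =
        {x \<in> space (\<Pi>\<^sub>M i\<in>{..<m}. M).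
          (\<Sum>i<m. if x i \<in> \<Delta> \<and> (\<forall>j\<in>{..<i}. dist (x j) (x i) \<noteq> 0) then 1 else 0) = real n}"
    proof -
      have "(\<Sum>i<m. if x i \<in> \<Delta> \<and> (\<forall>j\<in>{..<i}. dist (x j) (x i) \<noteq> 0) then 1 else 0)
          = real (count_in \<Delta> (x ` {..<m}))" for x :: "nat \<Rightarrow> 'a"
        by (simp add: count_in_image of_bool_def if_distrib cong: if_cong)
      then show ?thesis by (auto simp: A finite_in_configurations)
    qed
    have [measurable]: "(\<lambda>x. x i) \<in> borel_measurable (\<Pi>\<^sub>M i\<in>{..<m}. M)" if "i < m" for i
    proof -
      have "(\<lambda>x. x i) \<in> measurable (\<Pi>\<^sub>M i\<in>{..<m}. M) M"
        using that by (intro measurable_component_singleton) simp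
      then show ?thesis by (simp only: measurable_cong_sets[OF refl M])
    qed
    have "(\<lambda>x. \<Sum>i<m. if x i \<in> \<Delta> \<and> (\<forall>j\<in>{..<i}. dist (x j) (x i) \<noteq> 0) then 1 else 0 :: real)
        \<in> borel_measurable (\<Pi>\<^sub>M i\<in>{..<m}. M)"
    proof (rule borel_measurable_sum)
      fix i assume i: "i \<in> {..<m}"
      have *: "Measurable.pred (\<Pi>\<^sub>M i\<in>{..<m}. M) (\<lambda>x. dist (x j) (x i) \<noteq> 0)"
        if "j \<in> {..<i}" for j
      proof -
        have "i < m" "j < m" using i that by auto
        then have [measurable]: "(\<lambda>x. dist (x j) (x i)) \<in> borel_measurable (\<Pi>\<^sub>M i\<in>{..<m}. M)"
          by (intro borel_measurable_dist) auto
        show ?thesis by measurable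
      qed
      have [measurable]: "Measurable.pred (\<Pi>\<^sub>M i\<in>{..<m}. M)
          (\<lambda>x. \<forall>j\<in>{..<i}. dist (x j) (x i) \<noteq> 0)"
        by (intro pred_intros_finite *) simp_all
      have [measurable]: "(\<lambda>x. x i) \<in> borel_measurable (\<Pi>\<^sub>M i\<in>{..<m}. M)"
        using i by simp
      show "(\<lambda>x. if x i \<in> \<Delta> \<and> (\<forall>j\<in>{..<i}. dist (x j) (x i) \<noteq> 0) then 1 else 0 :: real)
          \<in> borel_measurable (\<Pi>\<^sub>M i\<in>{..<m}. M)"
        by measurable
    qed
    then show "(\<lambda>x. x ` {..<m}) -` A \<inter> space (\<Pi>\<^sub>M i\<in>{..<m}. M) \<in> sets (\<Pi>\<^sub>M i\<in>{..<m}. M)"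
      unfolding eq by measurable
  qed (auto simp: finite_in_configurations)
qed

lemma nn_integral_config_measure:
  fixes M :: "'a::{metric_space, second_countable_topology} measure"
  assumes M: "sets M = sets borel"
    and f: "f \<in> borel_measurable finite_config_space"
  shows "(\<integral>\<^sup>+\<alpha>. f \<alpha> \<partial>config_measure M) =
    (\<Sum>m. ennreal (1 / fact m) * (\<integral>\<^sup>+x. f (x ` {..<m}) \<partial>(\<Pi>\<^sub>M i\<in>{..<m}. M)))"
proof -
  note [measurable] = measurable_image_config[OF M]
  let ?F = "finite_config_space :: 'a set measure"
  define \<nu> where "\<nu> A = (\<Sum>m. ennreal (1 / fact m) *
    (\<integral>\<^sup>+x. indicator A (x ` {..<m}) \<partial>(\<Pi>\<^sub>M i\<in>{..<m}. M)))" for A :: "'a set set"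
  have ca: "countably_additive (sets ?F) \<nu>"
  proof (rule countably_additiveI)
    fix A :: "nat \<Rightarrow> 'a set set"
    assume A: "range A \<subseteq> sets ?F" "disjoint_family A"
    have [measurable]: "A i \<in> sets ?F" for i using A by auto
    have "(\<Sum>i. \<nu> (A i)) = (\<Sum>m. \<Sum>i. ennreal (1 / fact m) *
        (\<integral>\<^sup>+x. indicator (A i) (x ` {..<m}) \<partial>(\<Pi>\<^sub>M i\<in>{..<m}. M)))"
      unfolding \<nu>_def
      by (subst (1 2) nn_integral_count_space_nat[symmetric],
          subst (1 2) nn_integral_count_space_nat[symmetric])
         (rule pair_sigma_finite.Fubini', auto simp: pair_sigma_finite_def
            intro: sigma_finite_measure_count_space)
    also have "\<dots> = (\<Sum>m. ennreal (1 / fact m) *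
        (\<integral>\<^sup>+x. (\<Sum>i. indicator (A i) (x ` {..<m})) \<partial>(\<Pi>\<^sub>M i\<in>{..<m}. M)))"
      by (simp add: nn_integral_suminf)
    also have "\<dots> = \<nu> (\<Union>i. A i)"
      unfolding \<nu>_def using A(2) by (simp add: suminf_indicator)
    finally show "(\<Sum>i. \<nu> (A i)) = \<nu> (\<Union>i. A i)" .
  qed
  have em: "emeasure (config_measure M) A = \<nu> A" if "A \<in> sets ?F" for A
    unfolding config_measure_def \<nu>_def[symmetric]
    by (rule emeasure_measure_of_sigma[OF sets.sigma_algebra_axioms _ ca that])
       (simp add: positive_def \<nu>_def)
  have s: "sets (config_measure M) = sets ?F" and sp: "space (config_measure M) = space ?F"
    by (simp_all add: config_measure_def sets.space_closed)
  have f': "f \<in> borel_measurable (config_measure M)"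
    using f measurable_cong_sets[OF s refl] by auto
  show ?thesis using f'
  proof (induction rule: borel_measurable_induct)
    case (cong g h)
    have "g (x ` {..<m}) = h (x ` {..<m})" for x and m :: nat
      using cong(3)[of "x ` {..<m}"] by (simp add: sp space_finite_config_space)
    then show ?case using cong by (simp cong: nn_integral_cong)
  next
    case (set A)
    then show ?case using em[of A] by (simp add: s \<nu>_def)
  next
    case (mult u c)
    have [measurable]: "u \<in> borel_measurable ?F"
      using mult(2) by (simp only: measurable_cong_sets[OF s refl])
    have "(\<integral>\<^sup>+\<alpha>. c * u \<alpha> \<partial>config_measure M) = (\<Sum>m. c * (ennreal (1 / fact m) *
        (\<integral>\<^sup>+x. u (x ` {..<m}) \<partial>(\<Pi>\<^sub>M i\<in>{..<m}. M))))"
      by (simp add: nn_integral_cmult mult)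
    also have "\<dots> = (\<Sum>m. ennreal (1 / fact m) *
        (\<integral>\<^sup>+x. c * u (x ` {..<m}) \<partial>(\<Pi>\<^sub>M i\<in>{..<m}. M)))"
      by (intro suminf_cong, subst nn_integral_cmult) (auto simp: ac_simps)
    finally show ?case .
  next
    case (add u v)
    have [measurable]: "u \<in> borel_measurable ?F" "v \<in> borel_measurable ?F"
      using add(1,3) by (simp_all only: measurable_cong_sets[OF s refl])
    have "(\<integral>\<^sup>+\<alpha>. v \<alpha> + u \<alpha> \<partial>config_measure M) =
        (\<Sum>m. ennreal (1 / fact m) * (\<integral>\<^sup>+x. v (x ` {..<m}) \<partial>(\<Pi>\<^sub>M i\<in>{..<m}. M)) +
          ennreal (1 / fact m) * (\<integral>\<^sup>+x. u (x ` {..<m}) \<partial>(\<Pi>\<^sub>M i\<in>{..<m}. M)))"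
      by (subst nn_integral_add) (simp_all only: add suminf_add summableI)
    also have "\<dots> = (\<Sum>m. ennreal (1 / fact m) *
        (\<integral>\<^sup>+x. v (x ` {..<m}) + u (x ` {..<m}) \<partial>(\<Pi>\<^sub>M i\<in>{..<m}. M)))"
      by (simp add: nn_integral_add distrib_left)
    finally show ?case .
  next
    case (seq U)
    have [measurable]: "U i \<in> borel_measurable ?F" for i
      using seq(1)[of i] by (simp only: measurable_cong_sets[OF s refl])
    have inc: "incseq (\<lambda>i. U i y)" for y using seq(3) by (auto simp: incseq_def le_fun_def)
    have "(\<integral>\<^sup>+\<alpha>. (SUP i. U i) \<alpha> \<partial>config_measure M) =
        (SUP i. \<integral>\<^sup>+\<alpha>. U i \<alpha> \<partial>config_measure M)"
      unfolding SUP_apply using seq by (intro nn_integral_monotone_convergence_SUP) auto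
    also have "\<dots> = (SUP i. \<Sum>m. ennreal (1 / fact m) *
        (\<integral>\<^sup>+x. U i (x ` {..<m}) \<partial>(\<Pi>\<^sub>M i\<in>{..<m}. M)))"
      using seq by simp
    also have "\<dots> = (\<Sum>m. SUP i. ennreal (1 / fact m) *
        (\<integral>\<^sup>+x. U i (x ` {..<m}) \<partial>(\<Pi>\<^sub>M i\<in>{..<m}. M)))"
      by (intro ennreal_suminf_SUP_eq[symmetric])
         (auto simp: incseq_def intro!: mult_left_mono nn_integral_mono dest: inc[THEN incseqD])
    also have "\<dots> = (\<Sum>m. ennreal (1 / fact m) *
        (\<integral>\<^sup>+x. (SUP i. U i) (x ` {..<m}) \<partial>(\<Pi>\<^sub>M i\<in>{..<m}. M)))"
      unfolding SUP_apply using inc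
      by (subst nn_integral_monotone_convergence_SUP)
         (auto simp: SUP_mult_left_ennreal incseq_def le_fun_def)
    finally show ?case .
  qed
qed


section \<open>Operators on \<open>L\<^sup>2\<close>\<close>

text \<open>Elements of \<open>L\<^sup>2\<close> are represented by square integrable functions; equality of elements is
  equality almost everywhere. Operators act on representatives.\<close>

type_synonym 'a op = "('a \<Rightarrow> complex) \<Rightarrow> ('a \<Rightarrow> complex)"

definition L2 :: "'a measure \<Rightarrow> ('a \<Rightarrow> complex) set" where
  "L2 M = {f \<in> borel_measurable M. integrable M (\<lambda>x. (cmod (f x))\<^sup>2)}"

definition L2_inner :: "'a measure \<Rightarrow> ('a \<Rightarrow> complex) \<Rightarrow> ('a \<Rightarrow> complex) \<Rightarrow> complex" where
  "L2_inner M f g = (LINT x|M. cnj (f x) * g x)"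

definition L2_norm :: "'a measure \<Rightarrow> ('a \<Rightarrow> complex) \<Rightarrow> real" where
  "L2_norm M f = sqrt (LINT x|M. (cmod (f x))\<^sup>2)"

text \<open>Together with linearity, the norm bound forces \<open>T\<close> to respect equality almost everywhere.\<close>

definition bounded_op :: "'a measure \<Rightarrow> 'a op \<Rightarrow> bool" where
  "bounded_op M T \<longleftrightarrow>
     (\<forall>f\<in>L2 M. T f \<in> L2 M) \<and>
     (\<forall>f\<in>L2 M. \<forall>g\<in>L2 M. AE x in M. T (\<lambda>y. f y + g y) x = T f x + T g x) \<and>
     (\<forall>f\<in>L2 M. \<forall>c. AE x in M. T (\<lambda>y. c * f y) x = c * T f x) \<and>
     (\<exists>C. \<forall>f\<in>L2 M. L2_norm M (T f) \<le> C * L2_norm M f)"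

definition op_norm :: "'a measure \<Rightarrow> 'a op \<Rightarrow> real" where
  "op_norm M T = (SUP f\<in>{f\<in>L2 M. L2_norm M f \<le> 1}. L2_norm M (T f))"

definition hermitian_op :: "'a measure \<Rightarrow> 'a op \<Rightarrow> bool" where
  "hermitian_op M T \<longleftrightarrow> bounded_op M T \<and>
     (\<forall>f\<in>L2 M. \<forall>g\<in>L2 M. L2_inner M f (T g) = L2_inner M (T f) g)"

definition positive_op :: "'a measure \<Rightarrow> 'a op \<Rightarrow> bool" where
  "positive_op M T \<longleftrightarrow> bounded_op M T \<and> (\<forall>f\<in>L2 M. L2_inner M f (T f) \<in> \<real>\<^sub>\<ge>\<^sub>0)"

definition id_minus :: "'a op \<Rightarrow> 'a op" where
  "id_minus T = (\<lambda>f x. f x - T f x)"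

definition proj_op :: "'a set \<Rightarrow> 'a op" where
  "proj_op \<Lambda> = (\<lambda>f x. indicator \<Lambda> x * f x)"

definition compress :: "'a set \<Rightarrow> 'a op \<Rightarrow> 'a op" where
  "compress \<Lambda> T = proj_op \<Lambda> \<circ> T \<circ> proj_op \<Lambda>"

text \<open>Unique up to equality almost everywhere, provided \<open>T\<close> has a bounded inverse.\<close>

definition op_inverse :: "'a measure \<Rightarrow> 'a op \<Rightarrow> 'a op" where
  "op_inverse M T = (SOME R. bounded_op M R \<and>
     (\<forall>f\<in>L2 M. (AE x in M. R (T f) x = f x) \<and> (AE x in M. T (R f) x = f x)))"

definition orthonormal_basis :: "'a measure \<Rightarrow> ('a \<Rightarrow> complex) set \<Rightarrow> bool" where
  "orthonormal_basis M B \<longleftrightarrow> B \<subseteq> L2 M \<and>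
     (\<forall>e\<in>B. \<forall>e'\<in>B. L2_inner M e e' = (if e = e' then 1 else 0)) \<and>
     (\<forall>f\<in>L2 M. (\<forall>e\<in>B. L2_inner M e f = 0) \<longrightarrow> (AE x in M. f x = 0))"

text \<open>\<open>S\<close> is the absolute value \<open>(T\<^sup>* T)\<^sup>1\<^sup>/\<^sup>2\<close> of \<open>T\<close>: \<open>S\<close> is positive and \<open>S\<^sup>2 = T\<^sup>* T\<close>,
  the latter expressed through the inner product.\<close>

definition is_abs_op :: "'a measure \<Rightarrow> 'a op \<Rightarrow> 'a op \<Rightarrow> bool" where
  "is_abs_op M T S \<longleftrightarrow> positive_op M S \<and>
     (\<forall>f\<in>L2 M. \<forall>g\<in>L2 M. L2_inner M f (S (S g)) = L2_inner M (T f) (T g))"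

definition trace_class :: "'a measure \<Rightarrow> 'a op \<Rightarrow> bool" where
  "trace_class M T \<longleftrightarrow> bounded_op M T \<and>
     (\<exists>S B. is_abs_op M T S \<and> orthonormal_basis M B \<and>
        (\<lambda>e. L2_inner M e (S e)) summable_on B)"

definition has_trace :: "'a measure \<Rightarrow> 'a op \<Rightarrow> complex \<Rightarrow> bool" where
  "has_trace M T c \<longleftrightarrow> trace_class M T \<and>
     (\<forall>B. orthonormal_basis M B \<longrightarrow> ((\<lambda>e. L2_inner M e (T e)) has_sum c) B)"

definition locally_trace_class :: "'a::topological_space measure \<Rightarrow> 'a op \<Rightarrow> bool" where
  "locally_trace_class M T \<longleftrightarrow> (\<forall>\<Lambda>\<in>bounded_borel. trace_class M (compress \<Lambda> T))"

definition integral_op :: "'a measure \<Rightarrow> 'a op \<Rightarrow> ('a \<Rightarrow> 'a \<Rightarrow> complex) \<Rightarrow> bool" where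
  "integral_op M T k \<longleftrightarrow> (\<lambda>(x, y). k x y) \<in> borel_measurable (M \<Otimes>\<^sub>M M) \<and>
     (\<forall>f\<in>L2 M. AE x in M. integrable M (\<lambda>y. k x y * f y) \<and> T f x = (LINT y|M. k x y * f y))"


section \<open>Determinantal processes\<close>

text \<open>The determinant of the matrix \<open>k(\<alpha>,\<alpha>)\<close> indexed by a finite set \<open>\<alpha>\<close>, by the same formula as
  \<open>det\<close> for type-indexed matrices. It does not depend on an enumeration of \<open>\<alpha>\<close>.\<close>

definition kernel_det :: "('a \<Rightarrow> 'a \<Rightarrow> complex) \<Rightarrow> 'a set \<Rightarrow> complex" where
  "kernel_det k \<alpha> = (\<Sum>p | p permutes \<alpha>. of_int (sign p) * (\<Prod>x\<in>\<alpha>. k x (p x)))"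

definition positive_matrix :: "('a \<Rightarrow> 'a \<Rightarrow> complex) \<Rightarrow> 'a set \<Rightarrow> bool" where
  "positive_matrix k \<alpha> \<longleftrightarrow>
     (\<forall>c. (\<Sum>x\<in>\<alpha>. \<Sum>y\<in>\<alpha>. cnj (c x) * k x y * c y) \<in> \<real>\<^sub>\<ge>\<^sub>0)"

definition correlation_kernel ::
    "'a::topological_space measure \<Rightarrow> 'a op \<Rightarrow> ('a \<Rightarrow> 'a \<Rightarrow> complex) \<Rightarrow> bool" where
  "correlation_kernel M K k \<longleftrightarrow> integral_op M K k \<and>
     (AE \<alpha> in config_measure M. positive_matrix k \<alpha>) \<and>
     (\<forall>\<Lambda>\<in>bounded_borel. set_integrable M \<Lambda> (\<lambda>x. k x x) \<and>
        has_trace M (compress \<Lambda> K) (LINT x:\<Lambda>|M. k x x))"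

definition has_correlation_function ::
    "'a::topological_space measure \<Rightarrow> 'a set measure \<Rightarrow> ('a set \<Rightarrow> real) \<Rightarrow> bool" where
  "has_correlation_function M \<mu> \<rho> \<longleftrightarrow>
     (\<forall>u\<in>borel_measurable finite_config_space. (\<forall>\<alpha>. 0 \<le> u \<alpha>) \<longrightarrow>
        (\<integral>\<^sup>+\<xi>. (\<Sum>\<^sub>\<infinity>\<alpha>\<in>{\<alpha>. finite \<alpha> \<and> \<alpha> \<subseteq> \<xi>}. ennreal (u \<alpha>)) \<partial>\<mu>) =
        (\<integral>\<^sup>+\<alpha>. ennreal (u \<alpha>) * ennreal (\<rho> \<alpha>) \<partial>config_measure M))"

text \<open>\<open>Re\<close> only changes the type here: the determinant is a nonnegative real whenever
  \<open>k(\<alpha>,\<alpha>)\<close> is positive.\<close>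

definition determinantal_process ::
    "'a::topological_space measure \<Rightarrow> ('a \<Rightarrow> 'a \<Rightarrow> complex) \<Rightarrow> 'a set measure \<Rightarrow> bool" where
  "determinantal_process M k \<mu> \<longleftrightarrow> point_process \<mu> \<and>
     has_correlation_function M \<mu> (\<lambda>\<alpha>. Re (kernel_det k \<alpha>))"

definition interaction_op :: "'a measure \<Rightarrow> 'a op \<Rightarrow> 'a set \<Rightarrow> 'a op" where
  "interaction_op M K \<Delta> = compress \<Delta> K \<circ> op_inverse M (id_minus (compress \<Delta> K))"

definition interaction_kernel ::
    "'a measure \<Rightarrow> 'a op \<Rightarrow> 'a set \<Rightarrow> ('a \<Rightarrow> 'a \<Rightarrow> complex) \<Rightarrow> bool" where
  "interaction_kernel M K \<Delta> t \<longleftrightarrow>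
     integral_op M (interaction_op M K \<Delta>) t \<and>
     (\<forall>\<alpha>. finite \<alpha> \<longrightarrow> positive_matrix t \<alpha>) \<and>
     (\<forall>n\<ge>1. \<forall>\<Lambda>\<in>sets M.
        integrable (\<Pi>\<^sub>M i\<in>{..<n}. M)
          (\<lambda>x. indicator \<Lambda> (x 0) * (\<Prod>i<n. t (x i) (x (Suc i mod n)))) \<and>
        has_trace M (compress \<Lambda> ((interaction_op M K \<Delta>) ^^ n))
          (LINT x|(\<Pi>\<^sub>M i\<in>{..<n}. M).
             indicator \<Lambda> (x 0) * (\<Prod>i<n. t (x i) (x (Suc i mod n)))))"


section \<open>Local conditional probabilities\<close>

text \<open>In what follows \<open>t\<close> is the kernel of the interaction operator of \<open>\<Delta>\<close>, and is the only way in
  which \<open>\<Delta>\<close> enters. The convention \<open>a / 0 = 0\<close> of the reals agrees with the one for a vanishing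
  denominator.\<close>

definition cond_intensity :: "('a \<Rightarrow> 'a \<Rightarrow> complex) \<Rightarrow> 'a set \<Rightarrow> 'a set \<Rightarrow> real" where
  "cond_intensity t \<alpha> \<xi> = Re (kernel_det t (\<alpha> \<union> \<xi>)) / Re (kernel_det t \<xi>)"

definition cond_partition ::
    "'a::topological_space measure \<Rightarrow> ('a \<Rightarrow> 'a \<Rightarrow> complex) \<Rightarrow> 'a set \<Rightarrow> 'a set \<Rightarrow> ennreal" where
  "cond_partition M t \<Lambda> \<xi> =
     (\<integral>\<^sup>+\<alpha>. ennreal (cond_intensity t \<alpha> \<xi>) \<partial>config_measure_in M \<Lambda>)"

definition cond_expectation ::
    "'a::topological_space measure \<Rightarrow> ('a \<Rightarrow> 'a \<Rightarrow> complex) \<Rightarrow> 'a set \<Rightarrow>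
       ('a set \<Rightarrow> real) \<Rightarrow> 'a set \<Rightarrow> ennreal" where
  "cond_expectation M t \<Lambda> f \<xi> =
     inverse (cond_partition M t \<Lambda> \<xi>) *
     (\<integral>\<^sup>+\<alpha>. ennreal (f \<alpha>) * ennreal (cond_intensity t \<alpha> \<xi>) \<partial>config_measure_in M \<Lambda>)"

definition cond_void ::
    "'a::topological_space measure \<Rightarrow> ('a \<Rightarrow> 'a \<Rightarrow> complex) \<Rightarrow> 'a set \<Rightarrow> 'a set \<Rightarrow> ennreal" where
  "cond_void M t \<Lambda> = cond_expectation M t \<Lambda> (indicator {\<alpha>. count_in \<Lambda> \<alpha> = 0})"

end

theory Submission
  imports Defs
begin

text \<open>Koteljanskii's inequality \<open>det(A \<union> B) det(A \<inter> B) \<le> det(A) det(B)\<close> for principal minors of positive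
  matrices gives both parts. Applied to the kernel \<open>t\<close> it says that
  \<open>det t(\<alpha>\<xi>) / det t(\<xi>)\<close> decreases in \<open>\<xi>\<close>, which is the monotonicity of the conditional probabilities once the
  partition function is known to be finite (Hadamard's inequality).

  For the void probabilities \<open>V(D) = \<mu>(N\<^sub>D = 0)\<close> one needs \<open>V(A \<union> B) V(A \<inter> B) \<le> V(A) V(B)\<close>. Inclusion-exclusion writes
  \<open>V(D)\<close> as the Fredholm series \<open>\<Sum> (-1)\<^sup>m / m! \<integral> det k\<close> over \<open>D\<^sup>m\<close>. By continuity from above one may assume that
  \<open>k(x,x)\<close> is bounded. Replacing \<open>k\<close> by a step kernel on a fine partition that resolves \<open>A\<close> and \<open>B\<close> turns the series into
  a principal minor of a matrix \<open>I - S\<close>, which is positive because \<open>\<parallel>K\<parallel> < 1\<close>, and Koteljanskii's inequality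
  applies again.\<close>

section \<open>Determinants of positive matrices\<close>

text \<open>One inequality serves two different matrices. The kernel \<open>t\<close> is positive on
  every finite set, so for the conditional probabilities it applies pointwise. A void probability is
  a determinant on an infinite dimensional space, and \<open>k\<close> is positive only almost
  everywhere, so a finite matrix has to be produced first. The obstacle is the diagonal. It is a
  null set of the product measure, so closeness of two kernels in the mean says nothing about it,
  yet every minor contains values \<open>k x x\<close>. The diagonal therefore gets its own error
  bound, and the partition also resolves the levels of \<open>k x x\<close>. Diffuseness is what
  makes arbitrarily small cells possible; with them a raised diagonal stays within the gap between
  the norm of \<open>K\<close> and 1. Of the operator only its quadratic form on step functions is
  used. Bounded diagonals matter because Hadamard's inequality then majorizes the series of
  \<open>k\<close> and of all approximants by one exponential series.\<close>

lemma kernel_det_empty [simp]: "kernel_det k {} = 1"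
  by (simp add: kernel_det_def)

lemma kernel_det_cong:
  assumes "\<And>x y. x \<in> \<alpha> \<Longrightarrow> y \<in> \<alpha> \<Longrightarrow> k x y = k' x y"
  shows "kernel_det k \<alpha> = kernel_det k' \<alpha>"
  unfolding kernel_det_def
proof (intro sum.cong refl arg_cong2[where f="(*)"] prod.cong)
  fix p x assume p: "p \<in> {p. p permutes \<alpha>}" and x: "x \<in> \<alpha>"
  then have "p x \<in> \<alpha>" by (simp add: permutes_in_image)
  then show "k x (p x) = k' x (p x)" using assms x by blast
qed

text \<open>Conjugation by \<open>f\<close> carries the permutations of \<open>S\<close> onto those
  of the image and keeps the sign, so the two expansions agree term by term.\<close>

lemma kernel_det_reindex:
  assumes fin: "finite S" and inj: "inj_on f S"
  shows "kernel_det k (f ` S) = kernel_det (\<lambda>a b. k (f a) (f b)) S"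
proof -
  have bij: "bij_betw f S (f ` S)" using inj by (simp add: inj_on_imp_bij_betw)
  have bij': "bij_betw (inv_into S f) (f ` S) S" using bij by (rule bij_betw_inv_into)
  have bp: "bij_betw (map_permutation S f) {p. p permutes S} {p. p permutes f ` S}"
  proof (rule bij_betwI[where g = "map_permutation (f ` S) (inv_into S f)"])
    show "map_permutation S f \<in> {p. p permutes S} \<rightarrow> {p. p permutes f ` S}"
      using map_permutation_permutes[OF bij] by auto
    show "map_permutation (f ` S) (inv_into S f) \<in> {p. p permutes f ` S} \<rightarrow> {p. p permutes S}"
      using map_permutation_permutes[OF bij'] by auto
    show "map_permutation (f ` S) (inv_into S f) (map_permutation S f p) = p"
      if "p \<in> {p. p permutes S}" for p
      using that map_permutation_compose_inv[OF bij] inj by auto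
    show "map_permutation S f (map_permutation (f ` S) (inv_into S f) p) = p"
      if "p \<in> {p. p permutes f ` S}" for p
      using that map_permutation_compose_inv[OF bij'] by (auto simp: f_inv_into_f)
  qed
  have "kernel_det k (f ` S) = (\<Sum>p | p permutes S. of_int (sign (map_permutation S f p)) *
      (\<Prod>x\<in>f ` S. k x (map_permutation S f p x)))"
    unfolding kernel_det_def by (rule sum.reindex_bij_betw[OF bp, symmetric])
  also have "\<dots> = kernel_det (\<lambda>a b. k (f a) (f b)) S"
    unfolding kernel_det_def using inj fin
    by (auto intro!: sum.cong prod.cong simp: sign_map_permutation prod.reindex map_permutation_apply)
  finally show ?thesis .
qed

text \<open>Composing with the transposition of \<open>x\<close> and \<open>y\<close> reverses the
  sign of a permutation and leaves its product unchanged, so the determinant equals its own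
  negative.\<close>

lemma kernel_det_equal_rows:
  assumes fin: "finite \<alpha>" and x: "x \<in> \<alpha>" "y \<in> \<alpha>" "x \<noteq> y" and eq: "k x = k y"
  shows "kernel_det k \<alpha> = 0"
proof -
  let ?q = "Transposition.transpose x y"
  have q: "?q permutes \<alpha>" using x by (simp add: permutes_swap_id)
  have "kernel_det k \<alpha> = (\<Sum>p | p permutes \<alpha>. of_int (sign (p \<circ> ?q)) * (\<Prod>z\<in>\<alpha>. k z ((p \<circ> ?q) z)))"
    unfolding kernel_det_def by (rule sum_permutations_compose_right[OF q])
  also have "\<dots> = (\<Sum>p | p permutes \<alpha>. - (of_int (sign p) * (\<Prod>z\<in>\<alpha>. k z (p z))))"
  proof (rule sum.cong[OF refl])
    fix p assume "p \<in> {p. p permutes \<alpha>}"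
    then have p: "p permutes \<alpha>" by simp
    then have "permutation p" using fin permutation_permutes by blast
    then have "sign (p \<circ> ?q) = - sign p"
      using x by (simp add: sign_compose permutation_swap_id sign_swap_id)
    moreover have "k z = k (?q z)" for z
      using eq by (simp add: Transposition.transpose_def)
    then have "(\<Prod>z\<in>\<alpha>. k z ((p \<circ> ?q) z)) = (\<Prod>z\<in>\<alpha>. k (?q z) (p (?q z)))"
      by (auto intro!: prod.cong)
    moreover have "\<dots> = (\<Prod>z\<in>\<alpha>. k z (p z))"
      by (rule prod.reindex_bij_betw[OF permutes_imp_bij[OF q]])
    ultimately show "of_int (sign (p \<circ> ?q)) * (\<Prod>z\<in>\<alpha>. k z ((p \<circ> ?q) z)) =
        - (of_int (sign p) * (\<Prod>z\<in>\<alpha>. k z (p z)))"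
      by simp
  qed
  also have "\<dots> = - kernel_det k \<alpha>" by (simp add: kernel_det_def sum_negf)
  finally show ?thesis by simp
qed

text \<open>Multilinear expansion: \<beta> is the set of rows that keep their own entries, while the
  other rows of \<alpha> contribute multiples of row \<open>x\<close>. Every choice except \<beta> =
  \<alpha> repeats row \<open>x\<close> and vanishes. All rows are changed at once because a whole
  column is to be cleared.\<close>

lemma kernel_det_row_operation:
  assumes fin: "finite \<alpha>" and x: "x \<notin> \<alpha>"
  shows "kernel_det (\<lambda>y z. if y = x then k x z else k y z + c y * k x z) (insert x \<alpha>) =
    kernel_det k (insert x \<alpha>)"
proof -
  let ?k = "\<lambda>y z. if y = x then k x z else k y z + c y * k x z"
  let ?r = "\<lambda>\<beta> y z. if y \<in> \<beta> then k y z else k x z"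
  have "kernel_det ?k (insert x \<alpha>) = (\<Sum>p | p permutes insert x \<alpha>. of_int (sign p) *
      (k x (p x) * (\<Prod>y\<in>\<alpha>. k y (p y) + c y * k x (p y))))"
    unfolding kernel_det_def using fin x
    by (intro sum.cong refl arg_cong2[where f="(*)"]) (auto intro!: prod.cong)
  also have "\<dots> = (\<Sum>p | p permutes insert x \<alpha>. \<Sum>\<beta>\<in>Pow \<alpha>.
      (\<Prod>y\<in>\<alpha>-\<beta>. c y) * (of_int (sign p) * (\<Prod>y\<in>insert x \<alpha>. ?r \<beta> y (p y))))"
    unfolding prod_add[OF fin] sum_distrib_left
  proof (intro sum.cong refl)
    fix p \<beta> assume b: "\<beta> \<in> Pow \<alpha>"
    have "(\<Prod>y\<in>insert x \<alpha>. ?r \<beta> y (p y)) = k x (p x) * (\<Prod>y\<in>\<alpha>. ?r \<beta> y (p y))"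
      using fin x b by (subst prod.insert) auto
    also have "(\<Prod>y\<in>\<alpha>. ?r \<beta> y (p y)) = (\<Prod>y\<in>\<beta>. ?r \<beta> y (p y)) * (\<Prod>y\<in>\<alpha>-\<beta>. ?r \<beta> y (p y))"
      using b fin by (subst prod.subset_diff[of \<beta> \<alpha>]) (auto simp: mult.commute)
    finally show "of_int (sign p) * (k x (p x) * ((\<Prod>y\<in>\<beta>. k y (p y)) * (\<Prod>y\<in>\<alpha> - \<beta>. c y * k x (p y)))) =
      (\<Prod>y\<in>\<alpha>-\<beta>. c y) * (of_int (sign p) * (\<Prod>y\<in>insert x \<alpha>. ?r \<beta> y (p y)))"
      by (simp add: prod.distrib)
  qed
  also have "\<dots> = (\<Sum>\<beta>\<in>Pow \<alpha>. (\<Prod>y\<in>\<alpha>-\<beta>. c y) * kernel_det (?r \<beta>) (insert x \<alpha>))"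
    by (subst sum.swap) (simp add: kernel_det_def sum_distrib_left)
  also have "\<dots> = (\<Sum>\<beta>\<in>{\<alpha>}. (\<Prod>y\<in>\<alpha>-\<beta>. c y) * kernel_det (?r \<beta>) (insert x \<alpha>))"
  proof (rule sum.mono_neutral_right)
    show "\<forall>\<beta>\<in>Pow \<alpha> - {\<alpha>}. (\<Prod>y\<in>\<alpha>-\<beta>. c y) * kernel_det (?r \<beta>) (insert x \<alpha>) = 0"
    proof
      fix \<beta> assume b: "\<beta> \<in> Pow \<alpha> - {\<alpha>}"
      then obtain y where "y \<in> \<alpha>" "y \<notin> \<beta>" by blast
      then have "kernel_det (?r \<beta>) (insert x \<alpha>) = 0"
        using fin x b by (intro kernel_det_equal_rows[of _ x y]) auto
      then show "(\<Prod>y\<in>\<alpha>-\<beta>. c y) * kernel_det (?r \<beta>) (insert x \<alpha>) = 0" by simp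
    qed
  qed (use fin in auto)
  also have "\<dots> = kernel_det k (insert x \<alpha>)" by (auto intro!: kernel_det_cong)
  finally show ?thesis .
qed

text \<open>A permutation that moves \<open>x\<close> sends some \<open>y\<close> in \<alpha> to
  \<open>x\<close> and picks up the zero entry \<open>k y x\<close>. The permutations that fix
  \<open>x\<close> are those of \<alpha>.\<close>

lemma kernel_det_insert_zero_column:
  assumes fin: "finite \<alpha>" and x: "x \<notin> \<alpha>" and z: "\<And>y. y \<in> \<alpha> \<Longrightarrow> k y x = 0"
  shows "kernel_det k (insert x \<alpha>) = k x x * kernel_det k \<alpha>"
proof -
  have "kernel_det k (insert x \<alpha>) =
      (\<Sum>p | p permutes \<alpha>. of_int (sign p) * (\<Prod>y\<in>insert x \<alpha>. k y (p y)))"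
    unfolding kernel_det_def
  proof (rule sum.mono_neutral_right)
    show "finite {p. p permutes insert x \<alpha>}" using fin by (simp add: finite_permutations)
    show "{p. p permutes \<alpha>} \<subseteq> {p. p permutes insert x \<alpha>}"
      by (auto intro: permutes_imp_permutes_insert)
    show "\<forall>p\<in>{p. p permutes insert x \<alpha>} - {p. p permutes \<alpha>}.
       of_int (sign p) * (\<Prod>y\<in>insert x \<alpha>. k y (p y)) = 0"
    proof
      fix p assume p: "p \<in> {p. p permutes insert x \<alpha>} - {p. p permutes \<alpha>}"
      have "\<exists>y\<in>\<alpha>. p y = x"
      proof (rule ccontr)
        assume n: "\<not> (\<exists>y\<in>\<alpha>. p y = x)"
        have "p ` insert x \<alpha> = insert x \<alpha>" using p by (intro permutes_image) simp
        then have "x \<in> p ` insert x \<alpha>" by blast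
        then have px: "p x = x" using n by (metis imageE insertE)
        have "p permutes insert x \<alpha>" using p by simp
        moreover have "p y = y" if "y \<in> insert x \<alpha> - \<alpha>" for y using that px by blast
        ultimately have "p permutes \<alpha>" by (rule permutes_superset)
        then show False using p by simp
      qed
      then show "of_int (sign p) * (\<Prod>y\<in>insert x \<alpha>. k y (p y)) = 0"
        using fin z by (auto simp: prod_zero_iff)
    qed
  qed
  also have "\<dots> = (\<Sum>p | p permutes \<alpha>. k x x * (of_int (sign p) * (\<Prod>y\<in>\<alpha>. k y (p y))))"
    using fin x by (intro sum.cong refl) (auto simp: permutes_not_in)
  finally show ?thesis by (simp add: kernel_det_def sum_distrib_left)
qed

section \<open>Schur complements and elementary consequences of positivity\<close>

text \<open>The block that remains once column \<open>x\<close> has been cleared with the pivot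
  \<open>k x x\<close>. The determinant inequalities below rest on inductions that remove one index
  in this way.\<close>

definition schur_complement :: "('a \<Rightarrow> 'a \<Rightarrow> complex) \<Rightarrow> 'a \<Rightarrow> 'a \<Rightarrow> 'a \<Rightarrow> complex" where
  "schur_complement k x = (\<lambda>y z. k y z - k y x * k x z / k x x)"

lemma kernel_det_schur_complement:
  assumes fin: "finite \<alpha>" and x: "x \<notin> \<alpha>" and nz: "k x x \<noteq> 0"
  shows "kernel_det k (insert x \<alpha>) = k x x * kernel_det (schur_complement k x) \<alpha>"
proof -
  let ?k = "\<lambda>y z. if y = x then k x z else k y z + (- (k y x / k x x)) * k x z"
  have "kernel_det k (insert x \<alpha>) = kernel_det ?k (insert x \<alpha>)"
    by (rule kernel_det_row_operation[symmetric, OF fin x])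
  also have "\<dots> = ?k x x * kernel_det ?k \<alpha>"
    using x nz by (intro kernel_det_insert_zero_column[OF fin x]) auto
  also have "kernel_det ?k \<alpha> = kernel_det (schur_complement k x) \<alpha>"
    using x by (intro kernel_det_cong) (auto simp: schur_complement_def)
  finally show ?thesis by simp
qed

text \<open>Coefficients are added up along the fibres of \<open>f\<close>, which turns the form on
  \<open>S\<close> into the form on \<alpha>. Since \<open>f\<close> may identify indices, this
  covers tuples with repeated entries and kernels that are constant on cells.\<close>

lemma positive_matrix_pullback:
  assumes fin: "finite S" and pos: "positive_matrix k \<alpha>" and f: "f ` S \<subseteq> \<alpha>" and fa: "finite \<alpha>"
  shows "positive_matrix (\<lambda>a b. k (f a) (f b)) S"
  unfolding positive_matrix_def
proof
  fix c :: "_ \<Rightarrow> complex"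
  let ?c = "\<lambda>x. \<Sum>a | a \<in> S \<and> f a = x. c a"
  have "(\<Sum>a\<in>S. \<Sum>b\<in>S. cnj (c a) * k (f a) (f b) * c b) =
    (\<Sum>a\<in>S. cnj (c a) * (\<Sum>b\<in>S. k (f a) (f b) * c b))"
    by (simp add: sum_distrib_left mult.assoc)
  also have "\<dots> = (\<Sum>a\<in>S. cnj (c a) * (\<Sum>y\<in>\<alpha>. k (f a) y * ?c y))"
  proof (intro sum.cong refl arg_cong2[where f="(*)"])
    fix a
    have "(\<Sum>b\<in>S. k (f a) (f b) * c b) = (\<Sum>y\<in>\<alpha>. \<Sum>b | b \<in> S \<and> f b = y. k (f a) (f b) * c b)"
      by (rule sum.group[symmetric, OF fin fa f])
    also have "\<dots> = (\<Sum>y\<in>\<alpha>. k (f a) y * ?c y)"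
      by (auto intro!: sum.cong simp: sum_distrib_left)
    finally show "(\<Sum>b\<in>S. k (f a) (f b) * c b) = (\<Sum>y\<in>\<alpha>. k (f a) y * ?c y)" .
  qed
  also have "\<dots> = (\<Sum>x\<in>\<alpha>. \<Sum>a | a \<in> S \<and> f a = x. cnj (c a) * (\<Sum>y\<in>\<alpha>. k (f a) y * ?c y))"
    by (rule sum.group[symmetric, OF fin fa f])
  also have "\<dots> = (\<Sum>x\<in>\<alpha>. cnj (?c x) * (\<Sum>y\<in>\<alpha>. k x y * ?c y))"
    by (auto intro!: sum.cong simp: sum_distrib_right)
  also have "\<dots> = (\<Sum>x\<in>\<alpha>. \<Sum>y\<in>\<alpha>. cnj (?c x) * k x y * ?c y)"
    by (simp add: sum_distrib_left mult.assoc)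
  also have "\<dots> \<in> \<real>\<^sub>\<ge>\<^sub>0" using pos[unfolded positive_matrix_def, rule_format, of ?c] .
  finally show "(\<Sum>a\<in>S. \<Sum>b\<in>S. cnj (c a) * k (f a) (f b) * c b) \<in> \<real>\<^sub>\<ge>\<^sub>0" .
qed

lemma positive_matrix_subset:
  assumes "finite \<alpha>" "positive_matrix k \<alpha>" "\<beta> \<subseteq> \<alpha>"
  shows "positive_matrix k \<beta>"
  using positive_matrix_pullback[of \<beta> k \<alpha> "\<lambda>x. x"] assms finite_subset by auto

lemma positive_matrix_diag:
  assumes "finite \<alpha>" "positive_matrix k \<alpha>" "x \<in> \<alpha>"
  shows "k x x \<in> \<real>\<^sub>\<ge>\<^sub>0"
proof -
  have "positive_matrix k {x}" using assms by - (rule positive_matrix_subset[of \<alpha>], auto)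
  from this[unfolded positive_matrix_def, rule_format, of "\<lambda>_. 1"] show ?thesis by simp
qed

text \<open>The form at the coefficients 1 at \<open>x\<close> and \<open>a\<close> at
  \<open>y\<close>. The index type \<open>bool\<close> keeps the two places apart, so that
  \<open>x = y\<close> is included.\<close>

lemma positive_matrix_pair:
  assumes "finite \<alpha>" "positive_matrix k \<alpha>" "x \<in> \<alpha>" "y \<in> \<alpha>"
  shows "k x x + cnj a * a * k y y + a * k x y + cnj a * k y x \<in> \<real>\<^sub>\<ge>\<^sub>0"
proof -
  have "positive_matrix (\<lambda>i j. k (if i then y else x) (if j then y else x)) {False, True}"
    by (rule positive_matrix_pullback[OF _ assms(2)]) (use assms in auto)
  from this[unfolded positive_matrix_def, rule_format, of "\<lambda>i. if i then a else 1"] show ?thesis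
    by (simp add: algebra_simps)
qed

text \<open>Polarization: a form that is real on all complex vectors is Hermitian. The test
  coefficient 1 compares the imaginary parts, \<i> the real parts.\<close>

lemma positive_matrix_hermitian:
  assumes "finite \<alpha>" "positive_matrix k \<alpha>" "x \<in> \<alpha>" "y \<in> \<alpha>"
  shows "k y x = cnj (k x y)"
proof -
  have r: "Im (k x x) = 0" "Im (k y y) = 0"
    using positive_matrix_diag[OF assms(1,2)] assms(3,4) by (auto simp: complex_nonneg_Reals_iff)
  have "Im (k x y) + Im (k y x) = 0"
    using positive_matrix_pair[OF assms, of 1] r by (auto simp: complex_nonneg_Reals_iff)
  moreover have "Re (k x y) - Re (k y x) = 0"
    using positive_matrix_pair[OF assms, of \<i>] r by (auto simp: complex_nonneg_Reals_iff)
  ultimately show ?thesis by (simp add: complex_eq_iff)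
qed



text \<open>A linear substitute for Cauchy-Schwarz: \<open>a\<close> is the phase that makes
  \<open>a * k x y\<close> equal to minus its modulus. An upper bound for the diagonal thereby
  bounds every entry.\<close>

lemma positive_matrix_norm_le:
  assumes "finite \<alpha>" "positive_matrix k \<alpha>" "x \<in> \<alpha>" "y \<in> \<alpha>"
  shows "2 * cmod (k x y) \<le> Re (k x x) + Re (k y y)"
proof -
  define a where "a = (if k x y = 0 then 0 else - cnj (k x y) / cmod (k x y))"
  have "cmod a = of_bool (k x y \<noteq> 0)" by (simp add: a_def norm_divide)
  then have aa: "cnj a * a = of_bool (k x y \<noteq> 0)"
    using complex_norm_square[of a] by (cases "k x y = 0") (simp_all add: mult.commute)
  have "a * k x y = - of_real (cmod (k x y))"
    using complex_norm_square[of "k x y"]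
    by (cases "k x y = 0") (simp_all add: a_def field_simps power2_eq_square)
  moreover from this have "cnj (a * k x y) = - of_real (cmod (k x y))" by simp
  then have "cnj a * k y x = - of_real (cmod (k x y))"
    using positive_matrix_hermitian[OF assms] by simp
  moreover have "0 \<le> Re (k x x)" "0 \<le> Re (k y y)"
    using positive_matrix_diag[OF assms(1,2)] assms(3,4) by (auto simp: complex_nonneg_Reals_iff)
  ultimately show ?thesis
    using positive_matrix_pair[OF assms, of a]
    by (cases "k x y = 0") (simp_all add: complex_nonneg_Reals_iff aa)
qed

text \<open>Without a diagonal term at \<open>x\<close> nothing can compensate the mixed terms, so a
  nonzero entry would make the form negative at a suitable vector.\<close>

lemma positive_matrix_zero_row:
  assumes "finite \<alpha>" "positive_matrix k \<alpha>" "x \<in> \<alpha>" "y \<in> \<alpha>" "k x x = 0"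
  shows "k x y = 0"
proof (rule ccontr)
  assume nz: "k x y \<noteq> 0"
  let ?r = "Re (k y y) + 1"
  have p: "0 \<le> Re (k y y)"
    using positive_matrix_diag[OF assms(1,2)] assms(4) by (auto simp: complex_nonneg_Reals_iff)
  \<comment> \<open>With this coefficient the form equals
    \<open>?n / ?r^2 * (Re (k y y) - 2 * ?r)\<close>, which is negative. The summand 1 in
    \<open>?r\<close> keeps the denominator away from 0.\<close>
  define a where "a = - cnj (k x y) / ?r"
  have y: "k y y = of_real (Re (k y y))"
    using positive_matrix_diag[OF assms(1,2)] assms(4) by (auto simp: complex_nonneg_Reals_iff complex_eq_iff)
  let ?n = "(cmod (k x y))\<^sup>2"
  have 1: "a * k x y = of_real (- ?n / ?r)"
    unfolding of_real_divide of_real_minus complex_norm_square by (simp add: a_def mult.commute)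
  from this have "cnj (a * k x y) = of_real (- ?n / ?r)" by (metis complex_cnj_complex_of_real)
  then have 2: "cnj a * k y x = of_real (- ?n / ?r)"
    using positive_matrix_hermitian[OF assms(1-4)] by simp
  have 3: "cnj a * a * k y y = of_real (?n / ?r^2 * Re (k y y))"
  proof -
    have "(cmod a)\<^sup>2 = ?n / ?r^2" by (simp add: a_def norm_divide power_divide)
    then have "cnj a * a = of_real (?n / ?r^2)"
      using complex_norm_square[of a] by (simp add: mult.commute)
    then show ?thesis by (subst y) simp
  qed
  have "0 \<le> ?n / ?r^2 * Re (k y y) - ?n / ?r - ?n / ?r"
    using positive_matrix_pair[OF assms(1-4), of a] unfolding 1 2 3 assms(5)
    by (auto simp: complex_nonneg_Reals_iff)
  also have "?n / ?r = ?n / ?r^2 * ?r" using p by (simp add: power2_eq_square)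
  also have "?n / ?r^2 * Re (k y y) - ?n / ?r^2 * ?r - ?n / ?r^2 * ?r = ?n / ?r^2 * (Re (k y y) - 2 * ?r)"
    by (simp only: algebra_simps)
  also have "\<dots> < 0" using p nz by (intro mult_pos_neg) auto
  finally show False by simp
qed

text \<open>Completing the square: for given coefficients on \<alpha> the value \<open>e\<close> at
  \<open>x\<close> minimizes the form of \<open>k\<close>, and the minimum is the form of the Schur
  complement.\<close>

lemma positive_matrix_schur_complement:
  assumes fin: "finite \<alpha>" and x: "x \<notin> \<alpha>" and pos: "positive_matrix k (insert x \<alpha>)" and nz: "k x x \<noteq> 0"
  shows "positive_matrix (schur_complement k x) \<alpha>"
  unfolding positive_matrix_def
proof
  fix c :: "'a \<Rightarrow> complex"
  have fin': "finite (insert x \<alpha>)" using fin by simp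
  define s where "s = (\<Sum>z\<in>\<alpha>. k x z * c z)"
  define e where "e = - s / k x x"
  have kxx: "cnj (k x x) = k x x"
    using positive_matrix_hermitian[OF fin' pos, of x x] by simp
  have s': "(\<Sum>y\<in>\<alpha>. cnj (c y) * k y x) = cnj s"
    unfolding s_def cnj_sum
    by (intro sum.cong) (auto simp: positive_matrix_hermitian[OF fin' pos, of x])
  let ?c = "c(x := e)"
  have c: "y \<in> \<alpha> \<Longrightarrow> ?c y = c y" "?c x = e" for y using x by auto
  have "(\<Sum>y\<in>insert x \<alpha>. \<Sum>z\<in>insert x \<alpha>. cnj (?c y) * k y z * ?c z) =
     cnj e * k x x * e + cnj e * s + (\<Sum>y\<in>\<alpha>. cnj (c y) * k y x) * e +
     (\<Sum>y\<in>\<alpha>. \<Sum>z\<in>\<alpha>. cnj (c y) * k y z * c z)"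
    using fin x by (simp add: c sum.distrib sum_distrib_left sum_distrib_right s_def mult.assoc
        del: fun_upd_apply cong: sum.cong)
  also have "\<dots> = (\<Sum>y\<in>\<alpha>. \<Sum>z\<in>\<alpha>. cnj (c y) * k y z * c z) - cnj s * s / k x x"
    using nz kxx unfolding s' by (simp add: e_def field_simps)
  also have "cnj s * s / k x x = (\<Sum>y\<in>\<alpha>. \<Sum>z\<in>\<alpha>. cnj (c y) * (k y x * k x z / k x x) * c z)"
    unfolding s'[symmetric] unfolding s_def sum_product sum_divide_distrib
    by (intro sum.cong refl) simp
  also have "(\<Sum>y\<in>\<alpha>. \<Sum>z\<in>\<alpha>. cnj (c y) * k y z * c z) - \<dots> =
      (\<Sum>y\<in>\<alpha>. \<Sum>z\<in>\<alpha>. cnj (c y) * schur_complement k x y z * c z)"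
    by (simp add: schur_complement_def sum_subtractf algebra_simps)
  finally show "(\<Sum>y\<in>\<alpha>. \<Sum>z\<in>\<alpha>. cnj (c y) * schur_complement k x y z * c z) \<in> \<real>\<^sub>\<ge>\<^sub>0"
    using pos[unfolded positive_matrix_def, rule_format, of ?c] by (simp only:)
qed

lemma kernel_det_zero_row:
  assumes "finite \<alpha>" "x \<in> \<alpha>" "\<And>y. y \<in> \<alpha> \<Longrightarrow> k x y = 0"
  shows "kernel_det k \<alpha> = 0"
  unfolding kernel_det_def
proof (rule sum.neutral, safe)
  fix p assume "p permutes \<alpha>"
  then have "p x \<in> \<alpha>" using assms(2) by (simp add: permutes_in_image)
  then show "of_int (sign p) * (\<Prod>x\<in>\<alpha>. k x (p x)) = 0"
    using assms by (auto simp: prod_zero_iff)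
qed

lemma positive_matrix_kernel_det_zero:
  assumes "finite \<alpha>" "positive_matrix k \<alpha>" "x \<in> \<alpha>" "k x x = 0"
  shows "kernel_det k \<alpha> = 0"
  using assms positive_matrix_zero_row by (metis kernel_det_zero_row)

text \<open>Elimination again: a zero pivot forces a zero row and determinant 0; otherwise the
  determinant is the pivot times that of a positive Schur complement.\<close>

lemma kernel_det_nonneg:
  assumes "finite \<alpha>" "positive_matrix k \<alpha>"
  shows "kernel_det k \<alpha> \<in> \<real>\<^sub>\<ge>\<^sub>0"
  using assms
proof (induction \<alpha> arbitrary: k rule: finite_induct)
  case (insert x \<alpha>)
  have xx: "k x x \<in> \<real>\<^sub>\<ge>\<^sub>0" using insert.prems insert.hyps by (intro positive_matrix_diag[of "insert x \<alpha>"]) auto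
  show ?case
  proof (cases "k x x = 0")
    case True
    then show ?thesis using positive_matrix_kernel_det_zero[of "insert x \<alpha>" k x] insert by simp
  next
    case False
    then show ?thesis
      using insert xx kernel_det_schur_complement[of \<alpha> x k] positive_matrix_schur_complement[of \<alpha> x k]
      by (auto intro: nonneg_Reals_mult_I)
  qed
qed simp

lemma kernel_det_Re_nonneg:
  assumes "finite \<alpha>" "positive_matrix k \<alpha>"
  shows "0 \<le> Re (kernel_det k \<alpha>)"
  using kernel_det_nonneg[OF assms] by (simp add: complex_nonneg_Reals_iff)

section \<open>The inequalities of Hadamard, Fischer and Koteljanskii\<close>

lemma Re_kernel_det_schur_complement:
  assumes "finite \<alpha>" "x \<notin> \<alpha>" "positive_matrix k (insert x \<alpha>)" "k x x \<noteq> 0"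
  shows "Re (kernel_det k (insert x \<alpha>)) = Re (k x x) * Re (kernel_det (schur_complement k x) \<alpha>)"
  using kernel_det_schur_complement[of \<alpha> x k] positive_matrix_diag[of "insert x \<alpha>" k x] assms
  by (auto simp: complex_nonneg_Reals_iff)

text \<open>Elimination of \<open>x\<close> subtracts \<open>(cmod (k x y))\<^sup>2 / k x x\<close>
  from the diagonal entry at \<open>y\<close>.\<close>

lemma schur_complement_diag_le:
  assumes "finite \<alpha>" "positive_matrix k \<alpha>" "x \<in> \<alpha>" "y \<in> \<alpha>"
  shows "Re (schur_complement k x y y) \<le> Re (k y y)"
proof -
  have "k x x \<in> \<real>\<^sub>\<ge>\<^sub>0" using assms by (intro positive_matrix_diag[of \<alpha>])
  then obtain r where r: "k x x = of_real r" "r \<ge> 0" by (auto elim: nonneg_Reals_cases)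
  have "k y x * k x y / k x x = of_real ((cmod (k x y))\<^sup>2 / r)"
    unfolding of_real_divide complex_norm_square
    using positive_matrix_hermitian[OF assms] by (simp add: r mult.commute)
  then have "Re (k y x * k x y / k x x) = (cmod (k x y))\<^sup>2 / r"
    by (simp only: Re_complex_of_real)
  then have "Re (k y x * k x y / k x x) \<ge> 0" using r by (simp only:) simp
  then show ?thesis by (simp add: schur_complement_def)
qed

text \<open>The index eliminated is a \<open>y\<close> of \<alpha>, not \<open>x\<close>: its pivot
  is common to both sides, and the entry at \<open>x\<close> can only decrease.\<close>

lemma kernel_det_insert_le:
  assumes "finite \<alpha>" "positive_matrix k (insert x \<alpha>)" "x \<notin> \<alpha>"
  shows "Re (kernel_det k (insert x \<alpha>)) \<le> Re (k x x) * Re (kernel_det k \<alpha>)"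
  using assms
proof (induction \<alpha> arbitrary: k rule: finite_induct)
  case empty
  then show ?case using kernel_det_reindex[of "{()}" "\<lambda>_. x" k] by (simp add: kernel_det_def)
next
  case (insert y \<alpha>)
  let ?S = "insert x (insert y \<alpha>)"
  have S: "finite ?S" "?S = insert y (insert x \<alpha>)" using insert by auto
  have pk: "positive_matrix k (insert y \<alpha>)"
    using insert.prems insert.hyps by - (rule positive_matrix_subset[of ?S], auto)
  have nn: "0 \<le> Re (k x x)" "0 \<le> Re (kernel_det k (insert y \<alpha>))" "0 \<le> Re (k y y)"
    using positive_matrix_diag[OF S(1) insert.prems(1)] kernel_det_Re_nonneg[OF _ pk] insert
    by (auto simp: complex_nonneg_Reals_iff)
  show ?case
  proof (cases "k y y = 0")
    case True
    then have "kernel_det k ?S = 0"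
      using insert by (intro positive_matrix_kernel_det_zero[of _ _ y]) auto
    then show ?thesis using nn by simp
  next
    case False
    let ?k = "schur_complement k y"
    have ps: "positive_matrix ?k (insert x \<alpha>)"
      using insert False S by (intro positive_matrix_schur_complement) auto
    have pa: "0 \<le> Re (kernel_det ?k \<alpha>)"
      using insert ps by (intro kernel_det_Re_nonneg positive_matrix_subset[OF _ ps]) auto
    have "Re (kernel_det k ?S) = Re (k y y) * Re (kernel_det ?k (insert x \<alpha>))"
      unfolding S(2) using insert False S by (intro Re_kernel_det_schur_complement) auto
    also have "\<dots> \<le> Re (k y y) * (Re (?k x x) * Re (kernel_det ?k \<alpha>))"
      using insert ps nn by (intro mult_left_mono insert.IH) auto
    also have "\<dots> \<le> Re (k y y) * (Re (k x x) * Re (kernel_det ?k \<alpha>))"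
      using insert.prems S nn pa
      by (intro mult_left_mono mult_right_mono schur_complement_diag_le[of ?S]) auto
    also have "\<dots> = Re (k x x) * Re (kernel_det k (insert y \<alpha>))"
      using insert False pk by (simp add: Re_kernel_det_schur_complement)
    finally show ?thesis .
  qed
qed

text \<open>Hadamard's inequality, obtained by splitting off one point at a time.\<close>

lemma kernel_det_le_prod_diag:
  assumes "finite \<alpha>" "positive_matrix k \<alpha>"
  shows "Re (kernel_det k \<alpha>) \<le> (\<Prod>x\<in>\<alpha>. Re (k x x))"
  using assms
proof (induction \<alpha> rule: finite_induct)
  case (insert x \<alpha>)
  have "Re (kernel_det k (insert x \<alpha>)) \<le> Re (k x x) * Re (kernel_det k \<alpha>)"
    using insert by (intro kernel_det_insert_le) auto
  also have "\<dots> \<le> Re (k x x) * (\<Prod>x\<in>\<alpha>. Re (k x x))"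
    using insert positive_matrix_diag[of "insert x \<alpha>" k x]
    by (intro mult_left_mono insert.IH) (auto simp: complex_nonneg_Reals_iff intro: positive_matrix_subset[of "insert x \<alpha>"])
  finally show ?case using insert by simp
qed simp

text \<open>Fischer's inequality, with elimination inside \<open>A\<close> only. It remains to
  compare the Schur complement on \<open>B\<close> with \<open>k\<close> on \<open>B\<close>, and
  this is the one-point case divided by the pivot.\<close>

lemma kernel_det_Un_disjoint_le:
  assumes "finite A" "finite B" "positive_matrix k (A \<union> B)" "A \<inter> B = {}"
  shows "Re (kernel_det k (A \<union> B)) \<le> Re (kernel_det k A) * Re (kernel_det k B)"
  using assms
proof (induction A arbitrary: k rule: finite_induct)
  case (insert x A)
  let ?S = "insert x A \<union> B"
  have S: "finite ?S" "?S = insert x (A \<union> B)" "x \<notin> A \<union> B" using insert by auto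
  have p: "positive_matrix k T" if "T \<subseteq> ?S" for T
    using insert.prems S that by - (rule positive_matrix_subset[of ?S], auto)
  have nn: "0 \<le> Re (kernel_det k (insert x A))" "0 \<le> Re (kernel_det k B)"
    using insert by (auto intro!: kernel_det_Re_nonneg p)
  show ?case
  proof (cases "k x x = 0")
    case True
    then have "kernel_det k ?S = 0"
      using insert S by (intro positive_matrix_kernel_det_zero[of _ _ x]) auto
    then show ?thesis using nn by simp
  next
    case False
    let ?k = "schur_complement k x"
    have ps: "positive_matrix ?k (A \<union> B)"
      using insert False S by (intro positive_matrix_schur_complement) auto
    have pa: "0 \<le> Re (kernel_det ?k A)"
      using insert ps by (intro kernel_det_Re_nonneg positive_matrix_subset[OF _ ps]) auto
    have xx: "Re (k x x) > 0"
      using False positive_matrix_diag[OF S(1), of k x] insert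
      by (auto simp: complex_nonneg_Reals_iff complex_eq_iff)
    have B: "Re (kernel_det ?k B) \<le> Re (kernel_det k B)"
    proof -
      have "Re (k x x) * Re (kernel_det ?k B) = Re (kernel_det k (insert x B))"
        using insert False S by (intro Re_kernel_det_schur_complement[symmetric] p) auto
      also have "\<dots> \<le> Re (k x x) * Re (kernel_det k B)"
        using insert S by (intro kernel_det_insert_le p) auto
      finally show ?thesis using xx by simp
    qed
    have "Re (kernel_det k ?S) = Re (k x x) * Re (kernel_det ?k (A \<union> B))"
      unfolding S(2) using insert False S by (intro Re_kernel_det_schur_complement) auto
    also have "\<dots> \<le> Re (k x x) * (Re (kernel_det ?k A) * Re (kernel_det ?k B))"
      using insert ps xx by (intro mult_left_mono insert.IH) auto
    also have "\<dots> \<le> Re (k x x) * (Re (kernel_det ?k A) * Re (kernel_det k B))"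
      using xx pa B by (intro mult_left_mono) auto
    also have "\<dots> = Re (kernel_det k (insert x A)) * Re (kernel_det k B)"
      using insert False p[of "insert x A"]
      by (subst Re_kernel_det_schur_complement[of A]) (auto simp: mult.assoc)
    finally show ?thesis .
  qed
qed simp

text \<open>Koteljanskii's inequality; the Schur complement with respect to a common index
  removes it from both sets.\<close>

lemma kernel_det_Un_Int_le:
  assumes "finite A" "finite B" "positive_matrix k (A \<union> B)"
  shows "Re (kernel_det k (A \<union> B)) * Re (kernel_det k (A \<inter> B)) \<le>
    Re (kernel_det k A) * Re (kernel_det k B)"
  using assms
proof (induction "card (A \<inter> B)" arbitrary: A B k)
  case 0
  then have "A \<inter> B = {}" by simp
  then show ?case using 0 kernel_det_Un_disjoint_le[of A B k] by simp
next
  case (Suc n)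
  then obtain x where x: "x \<in> A \<inter> B" by (metis card.empty ex_in_conv nat.distinct(1))
  let ?A = "A - {x}" and ?B = "B - {x}"
  have eqs: "A = insert x ?A" "B = insert x ?B" "A \<union> B = insert x (?A \<union> ?B)"
    "A \<inter> B = insert x (?A \<inter> ?B)" using x by auto
  have fin: "finite (A \<union> B)" "finite ?A" "finite ?B" using Suc by auto
  have p: "positive_matrix k T" if "T \<subseteq> A \<union> B" for T
    using Suc fin that by - (rule positive_matrix_subset[of "A \<union> B"], auto)
  show ?case
  proof (cases "k x x = 0")
    case True
    then have "kernel_det k (A \<union> B) = 0"
      using Suc x by (intro positive_matrix_kernel_det_zero[of _ _ x]) auto
    moreover have "0 \<le> Re (kernel_det k A)" "0 \<le> Re (kernel_det k B)"
      using Suc by (auto intro!: kernel_det_Re_nonneg p)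
    ultimately show ?thesis by simp
  next
    case False
    let ?k = "schur_complement k x"
    have ps: "positive_matrix ?k (?A \<union> ?B)"
      using fin eqs False Suc by (intro positive_matrix_schur_complement) auto
    have step: "Re (kernel_det k (insert x T)) = Re (k x x) * Re (kernel_det ?k T)"
      if "T \<subseteq> ?A \<union> ?B" for T
    proof (rule Re_kernel_det_schur_complement)
      show "finite T" using that fin finite_subset by blast
      show "positive_matrix k (insert x T)" using that x by (intro p) auto
    qed (use that False in auto)
    have "n = card (?A \<inter> ?B)" using Suc(2) eqs(4) fin by (metis Diff_iff IntD1 card_insert_disjoint finite_Int insertI1 nat.inject)
    then have IH: "Re (kernel_det ?k (?A \<union> ?B)) * Re (kernel_det ?k (?A \<inter> ?B)) \<le>
        Re (kernel_det ?k ?A) * Re (kernel_det ?k ?B)"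
      using fin ps by (intro Suc.hyps(1)) auto
    \<comment> \<open>The index \<open>x\<close> lies in all four sets, so the square of the pivot
      splits off on both sides.\<close>
    have "Re (kernel_det k (A \<union> B)) * Re (kernel_det k (A \<inter> B)) =
        (Re (k x x))\<^sup>2 * (Re (kernel_det ?k (?A \<union> ?B)) * Re (kernel_det ?k (?A \<inter> ?B)))"
      unfolding eqs(3,4) by (subst (1 2) step) (auto simp: power2_eq_square)
    also have "\<dots> \<le> (Re (k x x))\<^sup>2 * (Re (kernel_det ?k ?A) * Re (kernel_det ?k ?B))"
      using IH by (intro mult_left_mono) auto
    also have "\<dots> = Re (kernel_det k (insert x ?A)) * Re (kernel_det k (insert x ?B))"
      by (subst (1 2) step) (auto simp: power2_eq_square)
    finally show ?thesis using eqs(1,2) by simp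
  qed
qed

text \<open>In each row either \<open>- k\<close> is chosen, which defines \<beta>, or the identity,
  which forces the permutation to fix that index. The permutations that survive are those of
  \<beta>.\<close>

lemma kernel_det_id_minus:
  assumes fin: "finite \<alpha>"
  shows "kernel_det (\<lambda>x y. of_bool (x = y) - k x y) \<alpha> =
    (\<Sum>\<beta>\<in>Pow \<alpha>. (-1) ^ card \<beta> * kernel_det k \<beta>)"
proof -
  have "kernel_det (\<lambda>x y. of_bool (x = y) - k x y) \<alpha> =
    (\<Sum>p | p permutes \<alpha>. of_int (sign p) *
      (\<Sum>\<beta>\<in>Pow \<alpha>. (\<Prod>x\<in>\<beta>. - k x (p x)) * (\<Prod>x\<in>\<alpha> - \<beta>. of_bool (x = p x))))"
    unfolding kernel_det_def prod_add[OF fin, symmetric] by simp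
  also have "\<dots> = (\<Sum>\<beta>\<in>Pow \<alpha>. \<Sum>p | p permutes \<alpha>. of_int (sign p) *
      ((\<Prod>x\<in>\<beta>. - k x (p x)) * (\<Prod>x\<in>\<alpha> - \<beta>. of_bool (x = p x))))"
    unfolding sum_distrib_left by (rule sum.swap)
  also have "\<dots> = (\<Sum>\<beta>\<in>Pow \<alpha>. (-1) ^ card \<beta> * kernel_det k \<beta>)"
  proof (rule sum.cong[OF refl])
    fix \<beta> assume b: "\<beta> \<in> Pow \<alpha>"
    have fb: "finite (\<alpha> - \<beta>)" using fin by simp
    have "(\<Sum>p | p permutes \<alpha>. of_int (sign p) *
      ((\<Prod>x\<in>\<beta>. - k x (p x)) * (\<Prod>x\<in>\<alpha> - \<beta>. of_bool (x = p x)))) =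
      (\<Sum>p | p permutes \<beta>. of_int (sign p) *
      ((\<Prod>x\<in>\<beta>. - k x (p x)) * (\<Prod>x\<in>\<alpha> - \<beta>. of_bool (x = p x))))"
    proof (rule sum.mono_neutral_right)
      show "finite {p. p permutes \<alpha>}" using fin by (simp add: finite_permutations)
      show "{p. p permutes \<beta>} \<subseteq> {p. p permutes \<alpha>}" using b by (auto intro: permutes_subset)
      show "\<forall>p\<in>{p. p permutes \<alpha>} - {p. p permutes \<beta>}. of_int (sign p) *
        ((\<Prod>x\<in>\<beta>. - k x (p x)) * (\<Prod>x\<in>\<alpha> - \<beta>. of_bool (x = p x))) = 0"
      proof
        fix p assume p: "p \<in> {p. p permutes \<alpha>} - {p. p permutes \<beta>}"
        then have "\<exists>x\<in>\<alpha>-\<beta>. p x \<noteq> x"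
          using permutes_superset[of p \<alpha> \<beta>] by auto
        then have "(\<Prod>x\<in>\<alpha> - \<beta>. of_bool (x = p x)) = (0::complex)"
          using fb by (simp add: prod_zero_iff) metis
        then show "of_int (sign p) *
          ((\<Prod>x\<in>\<beta>. - k x (p x)) * (\<Prod>x\<in>\<alpha> - \<beta>. of_bool (x = p x))) = 0" by simp
      qed
    qed
    also have "\<dots> = (\<Sum>p | p permutes \<beta>. (-1) ^ card \<beta> * (of_int (sign p) * (\<Prod>x\<in>\<beta>. k x (p x))))"
      by (intro sum.cong refl) (auto simp: prod_uminus permutes_not_in)
    finally show "(\<Sum>p | p permutes \<alpha>. of_int (sign p) *
      ((\<Prod>x\<in>\<beta>. - k x (p x)) * (\<Prod>x\<in>\<alpha> - \<beta>. of_bool (x = p x)))) = (-1) ^ card \<beta> * kernel_det k \<beta>"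
      by (simp add: kernel_det_def sum_distrib_left)
  qed
  finally show ?thesis .
qed

section \<open>Tuples and configurations\<close>

text \<open>Fix one enumeration \<open>h\<close> of \<beta>; every injective tuple with image
  \<beta> is \<open>h\<close> composed with a unique permutation of the positions. The two kinds of
  restriction reconcile tuples, which are undefined outside \<open>{..<m}\<close>, with
  permutations, which are the identity there.\<close>

lemma card_inj_tuples:
  assumes fin: "finite \<beta>" and card: "card \<beta> = m"
  shows "card {x \<in> {..<m} \<rightarrow>\<^sub>E S. inj_on x {..<m} \<and> x ` {..<m} = \<beta>} = (if \<beta> \<subseteq> S then fact m else 0)"
proof (cases "\<beta> \<subseteq> S")
  case True
  obtain h where h: "bij_betw h {..<m} \<beta>"
    using ex_bij_betw_nat_finite[OF fin] card by (auto simp: atLeast0LessThan)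
  have "bij_betw (\<lambda>p. restrict (h \<circ> p) {..<m}) {p. p permutes {..<m}}
     {x \<in> {..<m} \<rightarrow>\<^sub>E S. inj_on x {..<m} \<and> x ` {..<m} = \<beta>}"
  proof (rule bij_betwI[where g = "\<lambda>x. restrict_id (inv_into {..<m} h \<circ> x) {..<m}"])
    have "restrict (h \<circ> p) {..<m} \<in> {..<m} \<rightarrow>\<^sub>E S" "inj_on (restrict (h \<circ> p) {..<m}) {..<m}"
      "restrict (h \<circ> p) {..<m} ` {..<m} = \<beta>" if p: "p permutes {..<m}" for p
    proof -
      have b: "bij_betw (h \<circ> p) {..<m} \<beta>"
        using permutes_imp_bij[OF p] h by (rule bij_betw_trans)
      then show "inj_on (restrict (h \<circ> p) {..<m}) {..<m}" by (simp add: bij_betw_def)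
      show "restrict (h \<circ> p) {..<m} ` {..<m} = \<beta>" using b by (simp add: bij_betw_def)
      then show "restrict (h \<circ> p) {..<m} \<in> {..<m} \<rightarrow>\<^sub>E S" using True by auto
    qed
    then show "(\<lambda>p. restrict (h \<circ> p) {..<m}) \<in> {p. p permutes {..<m}} \<rightarrow>
      {x \<in> {..<m} \<rightarrow>\<^sub>E S. inj_on x {..<m} \<and> x ` {..<m} = \<beta>}" by blast
    show "(\<lambda>x. restrict_id (inv_into {..<m} h \<circ> x) {..<m}) \<in>
      {x \<in> {..<m} \<rightarrow>\<^sub>E S. inj_on x {..<m} \<and> x ` {..<m} = \<beta>} \<rightarrow> {p. p permutes {..<m}}"
    proof safe
      fix x assume x: "inj_on x {..<m}" "\<beta> = x ` {..<m}"
      have "bij_betw (inv_into {..<m} h \<circ> x) {..<m} {..<m}"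
        using x bij_betw_inv_into[OF h] by (intro bij_betw_trans[of x _ \<beta>]) (auto simp: bij_betw_def)
      then show "restrict_id (inv_into {..<m} h \<circ> x) {..<m} permutes {..<m}"
        by (rule permutes_restrict_id)
    qed
    show "restrict_id (inv_into {..<m} h \<circ> restrict (h \<circ> p) {..<m}) {..<m} = p"
      if "p \<in> {p. p permutes {..<m}}" for p
    proof
      fix i show "restrict_id (inv_into {..<m} h \<circ> restrict (h \<circ> p) {..<m}) {..<m} i = p i"
      proof (cases "i < m")
        case True
        then have "p i < m" using that permutes_in_image[of p "{..<m}" i] by simp
        then show ?thesis using True h by (simp add: restrict_id_def bij_betw_def inv_into_f_f)
      next
        case False
        then show ?thesis using that by (simp add: restrict_id_def permutes_not_in)
      qed
    qed
    show "restrict (h \<circ> restrict_id (inv_into {..<m} h \<circ> x) {..<m}) {..<m} = x"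
      if x: "x \<in> {x \<in> {..<m} \<rightarrow>\<^sub>E S. inj_on x {..<m} \<and> x ` {..<m} = \<beta>}" for x
    proof
      fix i show "restrict (h \<circ> restrict_id (inv_into {..<m} h \<circ> x) {..<m}) {..<m} i = x i"
      proof (cases "i < m")
        case True
        then have "x i \<in> \<beta>" using x by blast
        then have "x i \<in> h ` {..<m}" using h by (simp add: bij_betw_def)
        then show ?thesis using True by (simp add: restrict_id_def f_inv_into_f)
      next
        case False
        moreover have "x \<in> {..<m} \<rightarrow>\<^sub>E S" using x by simp
        ultimately show ?thesis by (simp add: PiE_arb[of x "{..<m}"])
      qed
    qed
  qed
  then have "card {x \<in> {..<m} \<rightarrow>\<^sub>E S. inj_on x {..<m} \<and> x ` {..<m} = \<beta>} = card {p. p permutes {..<m}}"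
    by (rule bij_betw_same_card[symmetric])
  then show ?thesis using True by (simp add: card_permutations)
next
  case False
  then have "x ` {..<m} \<noteq> \<beta>" if "x \<in> {..<m} \<rightarrow>\<^sub>E S" for x
    using that by blast
  then have "{x \<in> {..<m} \<rightarrow>\<^sub>E S. inj_on x {..<m} \<and> x ` {..<m} = \<beta>} = {}" by blast
  then show ?thesis using False by (simp only: card.empty if_False)
qed

text \<open>Tuples are grouped by their image. The semiring is general because the identity is
  applied to complex determinants and to extended nonnegative reals.\<close>

lemma sum_inj_tuples:
  fixes F :: "'a set \<Rightarrow> 'b::{comm_semiring_1, semiring_char_0}"
  assumes fin: "finite S"
  shows "(\<Sum>x\<in>{x \<in> {..<m} \<rightarrow>\<^sub>E S. inj_on x {..<m}}. F (x ` {..<m})) =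
    fact m * (\<Sum>\<beta> | \<beta> \<subseteq> S \<and> card \<beta> = m. F \<beta>)"
proof -
  let ?X = "{x \<in> {..<m} \<rightarrow>\<^sub>E S. inj_on x {..<m}}" and ?T = "{\<beta>. \<beta> \<subseteq> S \<and> card \<beta> = m}"
  have fX: "finite ?X" by (rule finite_subset[of _ "{..<m} \<rightarrow>\<^sub>E S"]) (use fin in \<open>auto intro: finite_PiE\<close>)
  have fT: "finite ?T" using fin by simp
  have sub: "(\<lambda>x. x ` {..<m}) ` ?X \<subseteq> ?T"
  proof (rule image_subsetI)
    fix x assume "x \<in> ?X"
    moreover from this have "x ` {..<m} \<subseteq> S" by blast
    ultimately show "x ` {..<m} \<in> ?T" using card_image[of x "{..<m}"] by simp
  qed
  have "(\<Sum>x\<in>?X. F (x ` {..<m})) = (\<Sum>\<beta>\<in>?T. \<Sum>x\<in>{x\<in>?X. x ` {..<m} = \<beta>}. F (x ` {..<m}))"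
    by (rule sum.group[OF fX fT sub, symmetric])
  also have "\<dots> = (\<Sum>\<beta>\<in>?T. fact m * F \<beta>)"
  proof (rule sum.cong[OF refl])
    fix \<beta> assume b: "\<beta> \<in> ?T"
    then have "finite \<beta>" using fin finite_subset by blast
    moreover have "{x\<in>?X. x ` {..<m} = \<beta>} = {x \<in> {..<m} \<rightarrow>\<^sub>E S. inj_on x {..<m} \<and> x ` {..<m} = \<beta>}" by blast
    ultimately have "card {x\<in>?X. x ` {..<m} = \<beta>} = fact m"
      using b card_inj_tuples[of \<beta> m S] by simp
    then show "(\<Sum>x\<in>{x\<in>?X. x ` {..<m} = \<beta>}. F (x ` {..<m})) = fact m * F \<beta>"
      by simp
  qed
  finally show ?thesis by (simp add: sum_distrib_left)
qed

lemma kernel_det_not_inj: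
  assumes "\<not> inj_on x {..<m}"
  shows "kernel_det (\<lambda>a b. k (x a) (x b)) {..<m::nat} = 0"
proof -
  obtain a b where "a < m" "b < m" "a \<noteq> b" "x a = x b" using assms by (auto simp: inj_on_def)
  then show ?thesis by (intro kernel_det_equal_rows[of _ a b]) auto
qed

text \<open>A repeated entry produces two equal rows, so such tuples drop out and only injective
  ones are grouped into subsets.\<close>

lemma sum_kernel_det_tuples:
  assumes fin: "finite S"
  shows "(\<Sum>x\<in>{..<m} \<rightarrow>\<^sub>E S. kernel_det (\<lambda>a b. k (x a) (x b)) {..<m}) =
    fact m * (\<Sum>\<beta> | \<beta> \<subseteq> S \<and> card \<beta> = m. kernel_det k \<beta>)"
proof -
  have "(\<Sum>x\<in>{..<m} \<rightarrow>\<^sub>E S. kernel_det (\<lambda>a b. k (x a) (x b)) {..<m}) =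
    (\<Sum>x\<in>{x \<in> {..<m} \<rightarrow>\<^sub>E S. inj_on x {..<m}}. kernel_det (\<lambda>a b. k (x a) (x b)) {..<m})"
    using fin by (intro sum.mono_neutral_right) (auto simp: finite_PiE kernel_det_not_inj)
  also have "\<dots> = (\<Sum>x\<in>{x \<in> {..<m} \<rightarrow>\<^sub>E S. inj_on x {..<m}}. kernel_det k (x ` {..<m}))"
    by (intro sum.cong refl) (auto simp: kernel_det_reindex)
  also have "\<dots> = fact m * (\<Sum>\<beta> | \<beta> \<subseteq> S \<and> card \<beta> = m. kernel_det k \<beta>)"
    by (rule sum_inj_tuples[OF fin])
  finally show ?thesis .
qed

section \<open>Relatively compact sets and integrals over finite products\<close>

lemma bounded_borelD: "D \<in> bounded_borel \<Longrightarrow> D \<in> sets borel"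
  by (simp add: bounded_borel_def)

lemma bounded_borel_subset:
  assumes "D \<in> bounded_borel" "A \<in> sets borel" "A \<subseteq> D"
  shows "A \<in> bounded_borel"
proof -
  have "compact (closure D \<inter> closure A)"
    using assms(1) by (intro compact_Int_closed) (simp_all add: bounded_borel_def)
  moreover have "closure D \<inter> closure A = closure A" using closure_mono[OF assms(3)] by blast
  ultimately show ?thesis using assms(2) by (simp add: bounded_borel_def)
qed

lemma bounded_borel_Un: "A \<in> bounded_borel \<Longrightarrow> B \<in> bounded_borel \<Longrightarrow> A \<union> B \<in> bounded_borel"
  by (auto simp: bounded_borel_def)

locale locally_finite_space =
  fixes M :: "'a::{metric_space, second_countable_topology} measure"
  assumes lc: "locally_compact_space (euclidean :: 'a topology)"
    and lf: "locally_finite_measure M"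
begin

lemma sets_M [measurable_cong]: "sets M = sets borel"
  using lf by (simp add: locally_finite_measure_def)

lemma space_M [simp]: "space M = UNIV"
  using sets_eq_imp_space_eq[OF sets_M] by simp

lemma emeasure_bounded: "D \<in> bounded_borel \<Longrightarrow> emeasure M D < \<infinity>"
  using lf by (simp add: locally_finite_measure_def)

text \<open>Local compactness gives every point a relatively compact open neighbourhood, the
  Lindelof property makes the cover countable, and successive differences make it disjoint. It
  yields sigma-finiteness and lets points be counted piecewise in unbounded sets.\<close>

lemma bounded_partition:
  obtains B :: "nat \<Rightarrow> 'a set"
  where "\<And>n. B n \<in> bounded_borel" "disjoint_family B" "(\<Union>n. B n) = UNIV"
proof -
  let ?\<F> = "{U::'a set. open U \<and> U \<in> bounded_borel}"
  have "\<exists>U\<in>?\<F>. x \<in> U" for x :: 'a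
  proof -
    obtain U K where U: "open U" "compact K" "x \<in> U" "U \<subseteq> K"
      using lc by (simp add: locally_compact_space_def) blast
    then have "closure U \<subseteq> K" by (simp add: closure_minimal compact_imp_closed)
    then have "compact (closure U)" using U(2) by (metis closed_closure compact_Int_closed inf.absorb2)
    then show ?thesis using U by (auto simp: bounded_borel_def)
  qed
  then have un: "\<Union>?\<F> = UNIV" by blast
  obtain \<F>' where F: "\<F>' \<subseteq> ?\<F>" "countable \<F>'" "\<Union>\<F>' = \<Union>?\<F>"
    by (rule Lindelof[of ?\<F>]) auto
  have ne: "\<F>' \<noteq> {}" using F un by auto
  let ?A = "from_nat_into \<F>'"
  have A: "?A n \<in> bounded_borel" for n using from_nat_into[OF ne, of n] F by auto
  show thesis
  proof
    show "disjointed ?A n \<in> bounded_borel" for n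
    proof (rule bounded_borel_subset[OF A])
      show "disjointed ?A n \<in> sets borel"
        using A bounded_borelD by (intro sets.range_disjointed_sets[THEN range_subsetD]) auto
      show "disjointed ?A n \<subseteq> ?A n" by (rule disjointed_subset)
    qed
    show "disjoint_family (disjointed ?A)" by (rule disjoint_family_disjointed)
    show "(\<Union>n. disjointed ?A n) = UNIV"
      using F un ne by (simp add: UN_disjointed_eq range_from_nat_into)
  qed
qed

lemma sigma_finite_M: "sigma_finite_measure M"
proof -
  obtain B :: "nat \<Rightarrow> 'a set"
    where B: "\<And>n. B n \<in> bounded_borel" "disjoint_family B" "(\<Union>n. B n) = UNIV"
    using bounded_partition by blast
  show ?thesis
  proof
    show "\<exists>A. countable A \<and> A \<subseteq> sets M \<and> \<Union>A = space M \<and> (\<forall>a\<in>A. emeasure M a \<noteq> \<infinity>)"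
      using B emeasure_bounded by (intro exI[of _ "range B"]) (auto simp: sets_M bounded_borelD less_top)
  qed
qed

sublocale sigma_finite_measure M by (rule sigma_finite_M)
sublocale product_sigma_finite "\<lambda>_. M" by unfold_locales
sublocale pair: pair_sigma_finite M M by unfold_locales

text \<open>Fubini for the coordinates \<open>a\<close> and \<open>b\<close>, while the others
  factor. In the later comparison of two kernels \<open>f\<close> is the error of one matrix entry,
  restricted to the domain, and \<open>h\<close> is the indicator of the domain.\<close>

lemma nn_integral_two_coordinates:
  assumes fin: "finite I" and ab: "a \<in> I" "b \<in> I" "a \<noteq> b"
    and f [measurable]: "(\<lambda>(y, z). f y z) \<in> borel_measurable (M \<Otimes>\<^sub>M M)"
    and h [measurable]: "h \<in> borel_measurable M"
  shows "(\<integral>\<^sup>+x. (\<Prod>c\<in>I - {a, b}. h (x c)) * f (x a) (x b) \<partial>(\<Pi>\<^sub>M i\<in>I. M)) =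
    (\<integral>\<^sup>+y. h y \<partial>M) ^ (card I - 2) * (\<integral>\<^sup>+y. \<integral>\<^sup>+z. f y z \<partial>M \<partial>M)"
proof -
  let ?J = "I - {a, b}"
  have I: "I = insert a (insert b ?J)" and J: "finite ?J" "b \<notin> ?J" "a \<notin> insert b ?J"
    using ab fin by auto
  have [measurable]: "(\<lambda>x. f (x a) (x b)) \<in> borel_measurable (\<Pi>\<^sub>M i\<in>I. M)"
  proof -
    have "(\<lambda>x. (x a, x b)) \<in> measurable (\<Pi>\<^sub>M i\<in>I. M) (M \<Otimes>\<^sub>M M)" using ab by measurable
    then show ?thesis using measurable_compose[OF _ f] by simp
  qed
  have m: "(\<lambda>x. (\<Prod>c\<in>?J. h (x c)) * f (x a) (x b)) \<in> borel_measurable (\<Pi>\<^sub>M i\<in>insert a (insert b ?J). M)"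
    unfolding I[symmetric] by measurable
  have "(\<integral>\<^sup>+x. (\<Prod>c\<in>?J. h (x c)) * f (x a) (x b) \<partial>(\<Pi>\<^sub>M i\<in>I. M)) =
    (\<integral>\<^sup>+y. \<integral>\<^sup>+x. (\<Prod>c\<in>?J. h ((x(a := y)) c)) * f ((x(a := y)) a) ((x(a := y)) b)
       \<partial>(\<Pi>\<^sub>M i\<in>insert b ?J. M) \<partial>M)"
    by (subst I) (rule product_nn_integral_insert_rev[OF _ J(3) m], use J in simp)
  also have "\<dots> = (\<integral>\<^sup>+y. \<integral>\<^sup>+x. (\<Prod>c\<in>?J. h (x c)) * f y (x b) \<partial>(\<Pi>\<^sub>M i\<in>insert b ?J. M) \<partial>M)"
    using ab J by (intro nn_integral_cong arg_cong2[where f="(*)"] prod.cong) auto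
  also have "\<dots> = (\<integral>\<^sup>+y. \<integral>\<^sup>+z. \<integral>\<^sup>+x. (\<Prod>c\<in>?J. h ((x(b := z)) c)) * f y ((x(b := z)) b)
       \<partial>(\<Pi>\<^sub>M i\<in>?J. M) \<partial>M \<partial>M)"
  proof (rule nn_integral_cong)
    fix y
    have "(\<lambda>x. f y (x b)) \<in> borel_measurable (\<Pi>\<^sub>M i\<in>insert b ?J. M)"
    proof -
      have "(\<lambda>x. (y, x b)) \<in> measurable (\<Pi>\<^sub>M i\<in>insert b ?J. M) (M \<Otimes>\<^sub>M M)" by measurable
      then show ?thesis using measurable_compose[OF _ f] by simp
    qed
    then have "(\<lambda>x. (\<Prod>c\<in>?J. h (x c)) * f y (x b)) \<in> borel_measurable (\<Pi>\<^sub>M i\<in>insert b ?J. M)"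
      by measurable
    then show "(\<integral>\<^sup>+x. (\<Prod>c\<in>?J. h (x c)) * f y (x b) \<partial>(\<Pi>\<^sub>M i\<in>insert b ?J. M)) =
      (\<integral>\<^sup>+z. \<integral>\<^sup>+x. (\<Prod>c\<in>?J. h ((x(b := z)) c)) * f y ((x(b := z)) b) \<partial>(\<Pi>\<^sub>M i\<in>?J. M) \<partial>M)"
      by (rule product_nn_integral_insert_rev[OF J(1,2)])
  qed
  also have "\<dots> = (\<integral>\<^sup>+y. \<integral>\<^sup>+z. \<integral>\<^sup>+x. (\<Prod>c\<in>?J. h (x c)) * f y z \<partial>(\<Pi>\<^sub>M i\<in>?J. M) \<partial>M \<partial>M)"
    using J by (intro nn_integral_cong arg_cong2[where f="(*)"] prod.cong) auto
  also have "\<dots> = (\<integral>\<^sup>+y. \<integral>\<^sup>+z. (\<integral>\<^sup>+y. h y \<partial>M) ^ card ?J * f y z \<partial>M \<partial>M)"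
  proof -
    have "(\<integral>\<^sup>+x. (\<Prod>c\<in>?J. h (x c)) \<partial>(\<Pi>\<^sub>M i\<in>?J. M)) = (\<integral>\<^sup>+y. h y \<partial>M) ^ card ?J"
      using product_nn_integral_prod[OF J(1), of "\<lambda>_. h"] by simp
    moreover have "(\<integral>\<^sup>+x. (\<Prod>c\<in>?J. h (x c)) * f y z \<partial>(\<Pi>\<^sub>M i\<in>?J. M)) =
        (\<integral>\<^sup>+x. (\<Prod>c\<in>?J. h (x c)) \<partial>(\<Pi>\<^sub>M i\<in>?J. M)) * f y z" for y z
      by (rule nn_integral_multc) measurable
    ultimately show ?thesis by (simp only:)
  qed
  also have "\<dots> = (\<integral>\<^sup>+y. h y \<partial>M) ^ card ?J * (\<integral>\<^sup>+y. \<integral>\<^sup>+z. f y z \<partial>M \<partial>M)"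
  proof -
    have [measurable]: "f y \<in> borel_measurable M" for y
    proof -
      have "(\<lambda>z. (y, z)) \<in> measurable M (M \<Otimes>\<^sub>M M)" by measurable
      from measurable_compose[OF this f] show ?thesis by simp
    qed
    have "(\<lambda>y. \<integral>\<^sup>+z. f y z \<partial>M) \<in> borel_measurable M"
      by (rule sigma_finite_measure.borel_measurable_nn_integral[OF sigma_finite_M f])
    then show ?thesis by (simp add: nn_integral_cmult)
  qed
  also have "card ?J = card I - 2" using ab fin by (simp add: card_Diff_subset)
  finally show ?thesis .
qed

lemma nn_integral_one_coordinate:
  assumes fin: "finite I" and a: "a \<in> I"
    and f [measurable]: "f \<in> borel_measurable M" and h [measurable]: "h \<in> borel_measurable M"
  shows "(\<integral>\<^sup>+x. (\<Prod>c\<in>I - {a}. h (x c)) * f (x a) \<partial>(\<Pi>\<^sub>M i\<in>I. M)) =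
    (\<integral>\<^sup>+y. h y \<partial>M) ^ (card I - 1) * (\<integral>\<^sup>+y. f y \<partial>M)"
proof -
  have "(\<integral>\<^sup>+x. (\<Prod>c\<in>I - {a}. h (x c)) * f (x a) \<partial>(\<Pi>\<^sub>M i\<in>I. M)) =
    (\<integral>\<^sup>+x. (\<Prod>c\<in>I. (if c = a then f else h) (x c)) \<partial>(\<Pi>\<^sub>M i\<in>I. M))"
    using fin a by (intro nn_integral_cong) (auto simp: prod.remove[of I a] mult.commute intro!: prod.cong)
  also have "\<dots> = (\<Prod>c\<in>I. \<integral>\<^sup>+y. (if c = a then f else h) y \<partial>M)"
    by (rule product_nn_integral_prod[OF fin]) auto
  also have "\<dots> = (\<integral>\<^sup>+y. f y \<partial>M) * (\<Prod>c\<in>I - {a}. \<integral>\<^sup>+y. h y \<partial>M)"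
    using fin a by (auto simp: prod.remove[of I a] intro!: prod.cong)
  finally show ?thesis using fin a by (simp add: mult.commute)
qed

text \<open>The exceptional set is integrated over the product and as an iterated integral. One
  direction spreads a statement on pairs to long tuples; the other brings facts about tuples of
  length 2 back to pairs of points.\<close>

lemma AE_two_coordinates:
  assumes fin: "finite I" and ab: "a \<in> I" "b \<in> I" "a \<noteq> b"
    and P [measurable]: "Measurable.pred (M \<Otimes>\<^sub>M M) (\<lambda>(y, z). P y z)"
  shows "(AE y in M. AE z in M. P y z) \<Longrightarrow> AE x in (\<Pi>\<^sub>M i\<in>I. M). P (x a) (x b)"
    and "I = {a, b} \<Longrightarrow> (AE x in (\<Pi>\<^sub>M i\<in>I. M). P (x a) (x b)) \<Longrightarrow> AE y in M. AE z in M. P y z"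
proof -
  let ?f = "\<lambda>y z. indicator {p. \<not> P (fst p) (snd p)} (y, z) :: ennreal"
  have [measurable]: "Measurable.pred (M \<Otimes>\<^sub>M M) (\<lambda>p. P (fst p) (snd p))"
    using P by (simp add: case_prod_beta')
  have Pm [measurable]: "Measurable.pred M (\<lambda>z. P y z)" for y
  proof -
    have "(\<lambda>z. (y, z)) \<in> measurable M (M \<Otimes>\<^sub>M M)" by measurable
    from measurable_compose[OF this P] show ?thesis by simp
  qed
  have f [measurable]: "(\<lambda>(y, z). ?f y z) \<in> borel_measurable (M \<Otimes>\<^sub>M M)"
    by (simp add: case_prod_beta') measurable
  have Pi [measurable]: "Measurable.pred (\<Pi>\<^sub>M i\<in>J. M) (\<lambda>x. P (x i) (x j))" if "i \<in> J" "j \<in> J" for i j J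
  proof -
    have "(\<lambda>x. (x i, x j)) \<in> measurable (\<Pi>\<^sub>M i\<in>J. M) (M \<Otimes>\<^sub>M M)" using that by measurable
    from measurable_compose[OF this P] show ?thesis by simp
  qed
  have D: "(\<integral>\<^sup>+y. \<integral>\<^sup>+z. ?f y z \<partial>M \<partial>M) = 0 \<longleftrightarrow> (AE y in M. AE z in M. P y z)"
  proof -
    have "(\<integral>\<^sup>+y. \<integral>\<^sup>+z. ?f y z \<partial>M \<partial>M) = 0 \<longleftrightarrow> (AE y in M. (\<integral>\<^sup>+z. ?f y z \<partial>M) = 0)"
      by (rule nn_integral_0_iff_AE) (use f in measurable)
    also have "\<dots> \<longleftrightarrow> (AE y in M. AE z in M. P y z)"
    proof -
      have "(\<integral>\<^sup>+z. ?f y z \<partial>M) = 0 \<longleftrightarrow> (AE z in M. P y z)" for y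
        by (subst nn_integral_0_iff_AE) (auto simp: indicator_def)
      then show ?thesis by (simp only:)
    qed
    finally show ?thesis .
  qed
  have C: "(\<integral>\<^sup>+x. (\<Prod>c\<in>J - {i, j}. 1) * ?f (x i) (x j) \<partial>(\<Pi>\<^sub>M i\<in>J. M)) = 0 \<longleftrightarrow>
    (AE x in (\<Pi>\<^sub>M i\<in>J. M). P (x i) (x j))" if "i \<in> J" "j \<in> J" for i j J
    by (subst nn_integral_0_iff_AE) (use that in \<open>auto simp: indicator_def\<close>)
  show "AE x in (\<Pi>\<^sub>M i\<in>I. M). P (x a) (x b)" if "AE y in M. AE z in M. P y z"
    using that nn_integral_two_coordinates[OF fin ab f, of "\<lambda>_. 1"] C[OF ab(1,2)] D by simp
  show "AE y in M. AE z in M. P y z" if "I = {a, b}" "AE x in (\<Pi>\<^sub>M i\<in>I. M). P (x a) (x b)"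
  proof -
    have "(\<integral>\<^sup>+x. (\<Prod>c\<in>I - {a, b}. 1) * ?f (x a) (x b) \<partial>(\<Pi>\<^sub>M i\<in>I. M)) = 0"
      using that(2) C[OF ab(1,2)] by blast
    then have "(\<integral>\<^sup>+y. 1 \<partial>M) ^ (card I - 2) * (\<integral>\<^sup>+y. \<integral>\<^sup>+z. ?f y z \<partial>M \<partial>M) = 0"
      by (simp only: nn_integral_two_coordinates[OF fin ab f borel_measurable_const])
    \<comment> \<open>Here \<open>card I - 2\<close> is 0, so the power of the total mass is 1 and
      the iterated integral itself must vanish.\<close>
    then have "(\<integral>\<^sup>+y. \<integral>\<^sup>+z. ?f y z \<partial>M \<partial>M) = 0" using ab(3) by (simp add: that(1))
    then show ?thesis using D by blast
  qed
qed

end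

section \<open>Measurability on the space of finite configurations\<close>

lemma measurable_count_in:
  assumes D: "D \<in> bounded_borel"
  shows "count_in D \<in> measurable config_space (count_space UNIV)"
proof (subst measurable_count_space_eq2_countable, safe)
  fix n :: nat
  have "{\<xi>\<in>configurations. count_in D \<xi> = n} \<in> sets config_space"
    unfolding config_space_def using D by (subst sets_measure_of) (auto intro!: sigma_sets.Basic)
  moreover have "count_in D -` {n} \<inter> space config_space = {\<xi>\<in>configurations. count_in D \<xi> = n}"
    by (auto simp: space_config_space)
  ultimately show "count_in D -` {n} \<inter> space config_space \<in> sets config_space" by simp
qed auto

context locally_finite_space
begin

text \<open>The sigma-algebra provides counts in relatively compact sets only. A general Borel set
  is cut along the partition of the space and the counts are added.\<close>

lemma measurable_card_Int:
  assumes A: "A \<in> sets borel"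
  shows "(\<lambda>\<alpha>. ennreal (card (\<alpha> \<inter> A))) \<in> borel_measurable (finite_config_space :: 'a set measure)"
proof -
  let ?F = "finite_config_space :: 'a set measure"
  have b: "(\<lambda>\<alpha>. ennreal (card (\<alpha> \<inter> D))) \<in> borel_measurable ?F" if D: "D \<in> bounded_borel" for D
  proof -
    from measurable_count_in[OF D] have "count_in D \<in> measurable ?F (count_space UNIV)"
      unfolding finite_config_space_def by (rule measurable_restrict_space1)
    from measurable_compose[OF this, of "\<lambda>n. ennreal (real n)" borel] show ?thesis
      by (simp add: count_in_def)
  qed
  obtain B :: "nat \<Rightarrow> 'a set"
    where B: "\<And>n. B n \<in> bounded_borel" "disjoint_family B" "(\<Union>n. B n) = UNIV"
    using bounded_partition by blast
  have "(\<lambda>\<alpha>. \<Sum>n. ennreal (card (\<alpha> \<inter> (A \<inter> B n)))) \<in> borel_measurable ?F"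
    using A B by (intro borel_measurable_suminf_order b bounded_borel_subset[OF B(1)])
      (auto dest: bounded_borelD)
  then show ?thesis
  proof (subst measurable_cong)
    fix \<alpha> :: "'a set" assume "\<alpha> \<in> space ?F"
    then have fin: "finite \<alpha>" by (simp add: space_finite_config_space)
    have c: "ennreal (card (\<alpha> \<inter> C)) = emeasure (count_space UNIV) (\<alpha> \<inter> C)" for C
      using fin by (simp add: emeasure_count_space ennreal_of_nat_eq_real_of_nat)
    have "(\<Sum>n. ennreal (card (\<alpha> \<inter> (A \<inter> B n)))) =
        (\<Sum>n. emeasure (count_space UNIV) (\<alpha> \<inter> (A \<inter> B n)))" by (simp only: c)
    also have "\<dots> = emeasure (count_space UNIV) (\<Union>n. \<alpha> \<inter> (A \<inter> B n))"
      using B(2) by (intro suminf_emeasure) (auto simp: disjoint_family_on_def)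
    also have "(\<Union>n. \<alpha> \<inter> (A \<inter> B n)) = \<alpha> \<inter> A" using B(3) by blast
    finally show "ennreal (card (\<alpha> \<inter> A)) = (\<Sum>n. ennreal (card (\<alpha> \<inter> (A \<inter> B n))))"
      by (simp only: c)
  qed
qed

lemma measurable_card:
  "card \<in> measurable (finite_config_space :: 'a set measure) (count_space UNIV)"
proof -
  let ?F = "finite_config_space :: 'a set measure"
  have [measurable]: "(\<lambda>\<alpha>. ennreal (card \<alpha>)) \<in> borel_measurable ?F"
    using measurable_card_Int[of UNIV] by simp
  show ?thesis
  proof (subst measurable_count_space_eq2_countable, safe)
    fix n :: nat
    have "{\<alpha>\<in>space ?F. ennreal (card \<alpha>) = ennreal n} \<in> sets ?F" by measurable
    moreover have "{\<alpha>\<in>space ?F. ennreal (card \<alpha>) = ennreal n} = card -` {n} \<inter> space ?F"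
      by auto
    ultimately show "card -` {n} \<inter> space ?F \<in> sets ?F" by (simp only:)
  qed auto
qed

text \<open>Containment in \<open>A\<close> means count 0 in the complement, a set that need not be
  relatively compact.\<close>

lemma sets_subset_config:
  assumes A: "A \<in> sets borel"
  shows "{\<alpha>. finite \<alpha> \<and> \<alpha> \<subseteq> A} \<in> sets (finite_config_space :: 'a set measure)"
proof -
  let ?F = "finite_config_space :: 'a set measure"
  have [measurable]: "(\<lambda>\<alpha>. ennreal (card (\<alpha> \<inter> - A))) \<in> borel_measurable ?F"
    using A by (intro measurable_card_Int) auto
  have "{\<alpha>\<in>space ?F. ennreal (card (\<alpha> \<inter> - A)) = 0} \<in> sets ?F" by measurable
  also have "{\<alpha>\<in>space ?F. ennreal (card (\<alpha> \<inter> - A)) = 0} = {\<alpha>. finite \<alpha> \<and> \<alpha> \<subseteq> A}"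
    by (auto simp: space_finite_config_space)
  finally show ?thesis .
qed

text \<open>Dynkin argument in \<open>H\<close>: for a box the number of tuples is a product of
  counts, complements are differences of finite numbers, and disjoint unions are series. This links
  sets of tuples to the sigma-algebra on configurations.\<close>

lemma measurable_count_tuples:
  fixes m :: nat
  assumes H: "H \<in> sets (\<Pi>\<^sub>M i\<in>{..<m}. borel :: 'a measure)"
  shows "(\<lambda>\<alpha>. emeasure (count_space UNIV) (({..<m} \<rightarrow>\<^sub>E \<alpha>) \<inter> H)) \<in>
    borel_measurable (finite_config_space :: 'a set measure)"
proof -
  let ?F = "finite_config_space :: 'a set measure"
  let ?\<Omega> = "\<Pi>\<^sub>E i\<in>{..<m}. space (borel :: 'a measure)"
  let ?G = "{(\<Pi>\<^sub>E i\<in>{..<m}. X i) |X. (\<forall>i. X i \<in> sets (borel :: 'a measure)) \<and> finite {i. X i \<noteq> space borel}}"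
  let ?T = "\<lambda>H \<alpha>. emeasure (count_space UNIV) (({..<m} \<rightarrow>\<^sub>E \<alpha>) \<inter> H)"
  have fin: "finite ({..<m} \<rightarrow>\<^sub>E \<alpha>)" if "\<alpha> \<in> space ?F" for \<alpha>
    using that by (intro finite_PiE) (auto simp: space_finite_config_space)
  have box: "?T (\<Pi>\<^sub>E i\<in>{..<m}. X i) \<in> borel_measurable ?F" if X: "\<And>i. X i \<in> sets borel" for X
  proof -
    have [measurable]: "(\<lambda>\<alpha>. ennreal (card (\<alpha> \<inter> X i))) \<in> borel_measurable ?F" for i
      using X by (rule measurable_card_Int)
    have "(\<lambda>\<alpha>. \<Prod>i<m. ennreal (card (\<alpha> \<inter> X i))) \<in> borel_measurable ?F" by measurable
    then show ?thesis
    proof (subst measurable_cong)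
      fix \<alpha> assume a: "\<alpha> \<in> space ?F"
      have e: "({..<m} \<rightarrow>\<^sub>E \<alpha>) \<inter> (\<Pi>\<^sub>E i\<in>{..<m}. X i) = (\<Pi>\<^sub>E i\<in>{..<m}. \<alpha> \<inter> X i)"
        by (simp add: PiE_Int)
      have "finite (({..<m} \<rightarrow>\<^sub>E \<alpha>) \<inter> (\<Pi>\<^sub>E i\<in>{..<m}. X i))" using fin[OF a] by simp
      then show "?T (\<Pi>\<^sub>E i\<in>{..<m}. X i) \<alpha> = (\<Prod>i<m. ennreal (card (\<alpha> \<inter> X i)))"
        by (simp add: emeasure_count_space e card_PiE ennreal_of_nat_eq_real_of_nat prod_ennreal)
    qed
  qed
  have "Int_stable ?G"
  proof (rule Int_stableI, safe)
    fix X Y :: "nat \<Rightarrow> 'a set"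
    assume X: "\<forall>i. X i \<in> sets borel" "finite {i. X i \<noteq> space borel}"
      and Y: "\<forall>i. Y i \<in> sets borel" "finite {i. Y i \<noteq> space borel}"
    have "finite {i. X i \<inter> Y i \<noteq> space borel}"
      by (rule finite_subset[OF _ finite_UnI[OF X(2) Y(2)]]) auto
    then show "\<exists>Z. Pi\<^sub>E {..<m} X \<inter> Pi\<^sub>E {..<m} Y = Pi\<^sub>E {..<m} Z \<and>
        (\<forall>i. Z i \<in> sets borel) \<and> finite {i. Z i \<noteq> space borel}"
      using X Y by (intro exI[of _ "\<lambda>i. X i \<inter> Y i"]) (auto simp: PiE_Int)
  qed
  moreover have "?G \<subseteq> Pow ?\<Omega>" by auto
  moreover have "H \<in> sigma_sets ?\<Omega> ?G" using H by (simp only: sets_PiM_finite)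
  ultimately show ?thesis
  proof (induction rule: sigma_sets_induct_disjoint)
    case (basic A)
    then show ?case using box by auto
  next
    case empty
    then show ?case by simp
  next
    case (compl A)
    have [measurable]: "?T A \<in> borel_measurable ?F" by fact
    have [measurable]: "?T ?\<Omega> \<in> borel_measurable ?F" by (rule box) simp
    have "(\<lambda>\<alpha>. ?T ?\<Omega> \<alpha> - ?T A \<alpha>) \<in> borel_measurable ?F" by measurable
    then show ?case
    proof (subst measurable_cong)
      fix \<alpha> assume a: "\<alpha> \<in> space ?F"
      have f: "finite (({..<m} \<rightarrow>\<^sub>E \<alpha>) \<inter> A)" using fin[OF a] by simp
      have "A \<subseteq> ?\<Omega>" using compl(1) by (rule sigma_sets_into_sp[rotated]) auto
      then have "({..<m} \<rightarrow>\<^sub>E \<alpha>) \<inter> (?\<Omega> - A) = (({..<m} \<rightarrow>\<^sub>E \<alpha>) \<inter> ?\<Omega>) - (({..<m} \<rightarrow>\<^sub>E \<alpha>) \<inter> A)"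
        "({..<m} \<rightarrow>\<^sub>E \<alpha>) \<inter> A \<subseteq> ({..<m} \<rightarrow>\<^sub>E \<alpha>) \<inter> ?\<Omega>" by blast+
      then show "?T (?\<Omega> - A) \<alpha> = ?T ?\<Omega> \<alpha> - ?T A \<alpha>"
        using f by (simp only:) (rule emeasure_Diff, auto simp: emeasure_count_space)
    qed
  next
    case (union A)
    have "(\<lambda>\<alpha>. \<Sum>i. ?T (A i) \<alpha>) \<in> borel_measurable ?F"
      using union by (intro borel_measurable_suminf_order) auto
    also have "(\<lambda>\<alpha>. \<Sum>i. ?T (A i) \<alpha>) = ?T (\<Union>i. A i)"
    proof
      fix \<alpha>
      have "(\<Sum>i. ?T (A i) \<alpha>) = emeasure (count_space UNIV) (\<Union>i. ({..<m} \<rightarrow>\<^sub>E \<alpha>) \<inter> A i)"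
        using union(1) by (intro suminf_emeasure) (auto simp: disjoint_family_on_def)
      then show "(\<Sum>i. ?T (A i) \<alpha>) = ?T (\<Union>i. A i) \<alpha>" by simp
    qed
    finally show ?case .
  qed
qed

text \<open>Extension from indicators by monotone approximation. Writing the sum as an integral over
  a counting measure makes additivity and monotone convergence available.\<close>

lemma measurable_sum_tuples:
  fixes m :: nat and g :: "(nat \<Rightarrow> 'a) \<Rightarrow> ennreal"
  assumes g: "g \<in> borel_measurable (\<Pi>\<^sub>M i\<in>{..<m}. borel :: 'a measure)"
  shows "(\<lambda>\<alpha>. \<Sum>x\<in>{..<m} \<rightarrow>\<^sub>E \<alpha>. g x) \<in> borel_measurable (finite_config_space :: 'a set measure)"
proof -
  let ?F = "finite_config_space :: 'a set measure" and ?P = "\<Pi>\<^sub>M i\<in>{..<m}. borel :: 'a measure"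
  let ?C = "\<lambda>\<alpha>. count_space ({..<m} \<rightarrow>\<^sub>E \<alpha>)"
  have P: "x \<in> space ?P" if "x \<in> {..<m} \<rightarrow>\<^sub>E \<alpha>" for x \<alpha>
    using that by (auto simp: space_PiM PiE_iff)
  have "(\<lambda>\<alpha>. \<integral>\<^sup>+x. g x \<partial>?C \<alpha>) \<in> borel_measurable ?F"
    using g
  proof (induction rule: borel_measurable_induct)
    case (cong f g)
    have "(\<integral>\<^sup>+x. f x \<partial>?C \<alpha>) = (\<integral>\<^sup>+x. g x \<partial>?C \<alpha>)" for \<alpha>
      using cong(3) P by (intro nn_integral_cong) (auto simp: space_count_space)
    then show ?case using cong by simp
  next
    case (set A)
    have "(\<integral>\<^sup>+x. indicator A x \<partial>?C \<alpha>) = emeasure (count_space UNIV) (({..<m} \<rightarrow>\<^sub>E \<alpha>) \<inter> A)" for \<alpha>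
      by (subst nn_integral_count_space_indicator)
        (auto simp: nn_integral_indicator[symmetric] indicator_def intro!: nn_integral_cong
          simp del: nn_integral_indicator)
    then show ?case using measurable_count_tuples[OF set] by simp
  next
    case (mult u c)
    then show ?case by (simp add: nn_integral_cmult)
  next
    case (add u v)
    then show ?case by (simp add: nn_integral_add)
  next
    case (seq U)
    have "(\<integral>\<^sup>+x. (SUP i. U i) x \<partial>?C \<alpha>) = (SUP i. \<integral>\<^sup>+x. U i x \<partial>?C \<alpha>)" for \<alpha>
      unfolding SUP_apply using seq by (intro nn_integral_monotone_convergence_SUP) auto
    then show ?case using seq by simp
  qed
  then show ?thesis
  proof (subst measurable_cong)
    fix \<alpha> assume "\<alpha> \<in> space ?F"
    then have "finite ({..<m} \<rightarrow>\<^sub>E \<alpha>)" by (intro finite_PiE) (auto simp: space_finite_config_space)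
    then show "(\<Sum>x\<in>{..<m} \<rightarrow>\<^sub>E \<alpha>. g x) = (\<integral>\<^sup>+x. g x \<partial>?C \<alpha>)"
      by (simp add: nn_integral_count_space_finite)
  qed
qed

lemma measurable_kernel_det_tuple:
  fixes m :: nat
  assumes k: "(\<lambda>(x, y). k x y) \<in> borel_measurable (M \<Otimes>\<^sub>M M)"
  shows "(\<lambda>x. kernel_det (\<lambda>a b. k (x a) (x b)) {..<m}) \<in> borel_measurable (\<Pi>\<^sub>M i\<in>{..<m}. M)"
proof -
  have m: "(\<lambda>x. k (x a) (x b)) \<in> borel_measurable (\<Pi>\<^sub>M i\<in>{..<m}. M)" if "a < m" "b < m" for a b
  proof -
    have "(\<lambda>x. (x a, x b)) \<in> measurable (\<Pi>\<^sub>M i\<in>{..<m}. M) (M \<Otimes>\<^sub>M M)"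
      using that by (intro measurable_Pair measurable_component_singleton) auto
    from measurable_compose[OF this k] show ?thesis by simp
  qed
  show ?thesis unfolding kernel_det_def
  proof (intro borel_measurable_sum borel_measurable_times borel_measurable_prod borel_measurable_const m)
    fix p i assume "p \<in> {p. p permutes {..<m}}" "i \<in> {..<m}"
    then show "i < m" "p i < m" using permutes_in_image[of p "{..<m}" i] by auto
  qed
qed

text \<open>A configuration comes without an enumeration of its points, so the determinant is
  averaged over all tuples with entries in \<alpha> of length \<open>card \<alpha>\<close>: repeated
  entries contribute 0, and all enumerations contribute the same value.\<close>

lemma measurable_kernel_det:
  assumes k: "(\<lambda>(x, y). k x y) \<in> borel_measurable (M \<Otimes>\<^sub>M M)"
  shows "(\<lambda>\<alpha>. ennreal (Re (kernel_det k \<alpha>))) \<in> borel_measurable (finite_config_space :: 'a set measure)"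
proof -
  let ?F = "finite_config_space :: 'a set measure"
  let ?g = "\<lambda>m x. ennreal (Re (kernel_det (\<lambda>a b. k (x a) (x b)) {..<m::nat}))"
  define f where "f m \<alpha> = ennreal (1 / fact m) * (\<Sum>x\<in>{..<m} \<rightarrow>\<^sub>E \<alpha>. ?g m x)" for m \<alpha>
  have "f m \<in> borel_measurable ?F" for m
  proof -
    have [measurable]: "(\<lambda>x. kernel_det (\<lambda>a b. k (x a) (x b)) {..<m}) \<in> borel_measurable (\<Pi>\<^sub>M i\<in>{..<m}. M)"
      by (rule measurable_kernel_det_tuple[OF k])
    have "?g m \<in> borel_measurable (\<Pi>\<^sub>M i\<in>{..<m}. M)" by measurable
    also have "borel_measurable (\<Pi>\<^sub>M i\<in>{..<m}. M) = borel_measurable (\<Pi>\<^sub>M i\<in>{..<m}. borel)"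
      by (intro measurable_cong_sets sets_PiM_cong refl sets_M)
    finally have [measurable]: "(\<lambda>\<alpha>. \<Sum>x\<in>{..<m} \<rightarrow>\<^sub>E \<alpha>. ?g m x) \<in> borel_measurable ?F"
      by (rule measurable_sum_tuples)
    show ?thesis unfolding f_def by measurable
  qed
  \<comment> \<open>The tuple length varies with the configuration. It takes countably many values,
    so measurability for each fixed length suffices.\<close>
  then have "(\<lambda>\<alpha>. f (card \<alpha>) \<alpha>) \<in> borel_measurable ?F"
    using measurable_card by (rule measurable_compose_countable)
  then show ?thesis
  proof (subst measurable_cong)
    fix \<alpha> :: "'a set" assume "\<alpha> \<in> space ?F"
    then have fin: "finite \<alpha>" by (simp add: space_finite_config_space)
    let ?m = "card \<alpha>"
    have "(\<Sum>x\<in>{..<?m} \<rightarrow>\<^sub>E \<alpha>. ?g ?m x) = (\<Sum>x\<in>{x \<in> {..<?m} \<rightarrow>\<^sub>E \<alpha>. inj_on x {..<?m}}. ?g ?m x)"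
      using fin by (intro sum.mono_neutral_right) (auto simp: finite_PiE kernel_det_not_inj)
    also have "\<dots> = (\<Sum>x\<in>{x \<in> {..<?m} \<rightarrow>\<^sub>E \<alpha>. inj_on x {..<?m}}. ennreal (Re (kernel_det k (x ` {..<?m}))))"
      by (intro sum.cong refl) (auto simp: kernel_det_reindex)
    also have "\<dots> = fact ?m * (\<Sum>\<beta> | \<beta> \<subseteq> \<alpha> \<and> card \<beta> = ?m. ennreal (Re (kernel_det k \<beta>)))"
      by (rule sum_inj_tuples[OF fin])
    also have "{\<beta>. \<beta> \<subseteq> \<alpha> \<and> card \<beta> = ?m} = {\<alpha>}"
      using fin card_subset_eq by blast
    finally have "f ?m \<alpha> = ennreal (1 / fact ?m) * fact ?m * ennreal (Re (kernel_det k \<alpha>))"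
      by (simp add: f_def mult.assoc)
    also have "ennreal (1 / fact ?m) * fact ?m = 1"
    proof -
      have "(fact ?m :: ennreal) = ennreal (fact ?m)"
        by (metis ennreal_of_nat_eq_real_of_nat of_nat_fact)
      then show ?thesis by (simp add: ennreal_mult[symmetric])
    qed
    finally show "ennreal (Re (kernel_det k \<alpha>)) = f ?m \<alpha>" by simp
  qed
qed

end

section \<open>Local conditional probabilities\<close>

text \<open>Koteljanskii for the sets \<open>\<alpha> \<union> \<xi>\<close> and
  \<open>\<xi>'\<close>: disjointness from \<alpha> makes their intersection \<xi>, and division by
  the two positive denominators gives the claim.\<close>

lemma cond_intensity_antimono:
  assumes pos: "\<And>\<alpha>. finite \<alpha> \<Longrightarrow> positive_matrix t \<alpha>"
    and fin: "finite \<alpha>" "finite \<xi>'" and sub: "\<xi> \<subseteq> \<xi>'" and disj: "\<alpha> \<inter> \<xi>' = {}"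
    and d: "Re (kernel_det t \<xi>) > 0" "Re (kernel_det t \<xi>') > 0"
  shows "cond_intensity t \<alpha> \<xi>' \<le> cond_intensity t \<alpha> \<xi>"
proof -
  have f: "finite \<xi>" using fin sub finite_subset by blast
  have e: "(\<alpha> \<union> \<xi>) \<union> \<xi>' = \<alpha> \<union> \<xi>'" "(\<alpha> \<union> \<xi>) \<inter> \<xi>' = \<xi>" using sub disj by auto
  have "Re (kernel_det t ((\<alpha> \<union> \<xi>) \<union> \<xi>')) * Re (kernel_det t ((\<alpha> \<union> \<xi>) \<inter> \<xi>')) \<le>
      Re (kernel_det t (\<alpha> \<union> \<xi>)) * Re (kernel_det t \<xi>')"
    using fin f by (intro kernel_det_Un_Int_le pos) auto
  then show ?thesis using d unfolding e cond_intensity_def by (simp add: field_simps)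
qed

lemma sets_config_measure [simp]:
    "sets (config_measure (M :: 'a::{metric_space, second_countable_topology} measure)) = sets finite_config_space"
  and space_config_measure [simp]: "space (config_measure M) = {\<alpha>. finite \<alpha>}"
proof -
  have "sets (finite_config_space :: 'a set measure) \<subseteq> Pow {\<alpha>. finite \<alpha>}"
    using sets.space_closed[of finite_config_space] by (simp add: space_finite_config_space)
  then show "sets (config_measure M) = sets finite_config_space"
    "space (config_measure M) = {\<alpha>. finite \<alpha>}"
    using sets.sigma_sets_eq[of "finite_config_space :: 'a set measure"]
    by (simp_all add: config_measure_def space_finite_config_space sets_measure_of space_measure_of)
qed

lemma ennreal_summable_exp: "(\<Sum>m. ennreal (1 / fact m) * ennreal r ^ m) < \<infinity>" if "0 \<le> r"
proof -
  have "(\<Sum>m. ennreal (1 / fact m) * ennreal r ^ m) = (\<Sum>m. ennreal (inverse (fact m) * r ^ m))"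
    using that by (simp add: ennreal_power ennreal_mult[symmetric] divide_inverse)
  also have "\<dots> \<noteq> \<top>"
    using that by (intro ennreal_suminf_neq_top summable_exp) auto
  finally show ?thesis by (simp add: less_top)
qed

locale diffuse_space = locally_finite_space M
  for M :: "'a::{metric_space, second_countable_topology} measure" +
  assumes diffuse_M: "diffuse M"
begin

text \<open>Each coincidence of two coordinates is null because single points are null. So almost
  every \<open>m\<close>-tuple has an image of exactly \<open>m\<close> points, which identifies the
  terms of the configuration measure by cardinality.\<close>

lemma AE_inj_tuple: "AE x in (\<Pi>\<^sub>M i\<in>{..<m::nat}. M). inj_on x {..<m}"
proof -
  have d: "Measurable.pred (M \<Otimes>\<^sub>M M) (\<lambda>(y, z). y \<noteq> z)"
  proof -
    have [measurable]: "(\<lambda>p. dist (fst p) (snd p)) \<in> borel_measurable (M \<Otimes>\<^sub>M M)"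
      using sets_M by (intro borel_measurable_dist) measurable
    have "Measurable.pred (M \<Otimes>\<^sub>M M) (\<lambda>p. dist (fst p) (snd p) \<noteq> 0)" by measurable
    then show ?thesis by (simp add: case_prod_beta')
  qed
  have n: "AE y in M. AE z in M. y \<noteq> z"
  proof (rule AE_I2)
    fix y assume "y \<in> space M"
    then have "{y} \<in> null_sets M" using diffuse_M by (auto simp: diffuse_def null_sets_def sets_M)
    then show "AE z in M. y \<noteq> z" by (rule AE_I') auto
  qed
  have "AE x in (\<Pi>\<^sub>M i\<in>{..<m}. M). \<forall>a\<in>{..<m}. \<forall>b\<in>{..<m}. a \<noteq> b \<longrightarrow> x a \<noteq> x b"
  proof (intro AE_finite_allI finite_lessThan)
    fix a b assume ab: "a \<in> {..<m}" "b \<in> {..<m}"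
    show "AE x in (\<Pi>\<^sub>M i\<in>{..<m}. M). a \<noteq> b \<longrightarrow> x a \<noteq> x b"
    proof (cases "a = b")
      case False
      then show ?thesis using AE_two_coordinates(1)[OF finite_lessThan ab False d n] by simp
    qed simp
  qed
  then show ?thesis by eventually_elim (auto simp: inj_on_def)
qed

lemma nn_integral_config_measure_in:
  assumes \<Lambda>: "\<Lambda> \<in> sets borel"
  shows "(\<integral>\<^sup>+\<alpha>. f \<alpha> \<partial>config_measure_in M \<Lambda>) =
    (\<integral>\<^sup>+\<alpha>. f \<alpha> * indicator {\<alpha>. finite \<alpha> \<and> \<alpha> \<subseteq> \<Lambda>} \<alpha> \<partial>config_measure M)"
proof -
  have e: "{\<alpha>. \<alpha> \<subseteq> \<Lambda>} \<inter> space (config_measure M) = {\<alpha>. finite \<alpha> \<and> \<alpha> \<subseteq> \<Lambda>}" by auto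
  have "(\<integral>\<^sup>+\<alpha>. f \<alpha> \<partial>config_measure_in M \<Lambda>) =
    (\<integral>\<^sup>+\<alpha>. f \<alpha> * indicator {\<alpha>. \<alpha> \<subseteq> \<Lambda>} \<alpha> \<partial>config_measure M)"
    unfolding config_measure_in_def
    by (rule nn_integral_restrict_space) (use sets_subset_config[OF \<Lambda>] e in simp)
  also have "\<dots> = (\<integral>\<^sup>+\<alpha>. f \<alpha> * indicator {\<alpha>. finite \<alpha> \<and> \<alpha> \<subseteq> \<Lambda>} \<alpha> \<partial>config_measure M)"
    by (intro nn_integral_cong) (auto simp: indicator_def)
  finally show ?thesis .
qed

text \<open>Hadamard bounds the determinant by the product of the diagonal, so the
  \<open>m\<close>-fold integral is at most the \<open>m\<close>-th power of the trace integral, and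
  the factors \<open>1 / fact m\<close> leave an exponential series.\<close>

lemma nn_integral_kernel_det_finite:
  assumes \<Lambda>: "\<Lambda> \<in> sets borel"
    and t: "(\<lambda>(x, y). t x y) \<in> borel_measurable (M \<Otimes>\<^sub>M M)"
    and pos: "\<And>\<alpha>. finite \<alpha> \<Longrightarrow> positive_matrix t \<alpha>"
    and tr: "(\<integral>\<^sup>+x. ennreal (Re (t x x)) * indicator \<Lambda> x \<partial>M) < \<infinity>"
  shows "(\<integral>\<^sup>+\<alpha>. ennreal (Re (kernel_det t \<alpha>)) \<partial>config_measure_in M \<Lambda>) < \<infinity>"
proof -
  let ?h = "\<lambda>x. ennreal (Re (t x x)) * indicator \<Lambda> x"
  have \<Lambda>M: "\<Lambda> \<in> sets M" using \<Lambda> sets_M by simp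
  have diag: "0 \<le> Re (t x x)" for x
    using positive_matrix_diag[of "{x}" t x] pos by (auto simp: complex_nonneg_Reals_iff)
  have hm: "?h \<in> borel_measurable M"
  proof -
    have "(\<lambda>x. (x, x)) \<in> measurable M (M \<Otimes>\<^sub>M M)" by measurable
    from measurable_compose[OF this t] have [measurable]: "(\<lambda>x. t x x) \<in> borel_measurable M" by simp
    show ?thesis using \<Lambda>M by measurable
  qed
  have [measurable]: "{\<alpha>. finite \<alpha> \<and> \<alpha> \<subseteq> \<Lambda>} \<in> sets finite_config_space"
    by (rule sets_subset_config[OF \<Lambda>])
  have [measurable]: "(\<lambda>\<alpha>. ennreal (Re (kernel_det t \<alpha>))) \<in> borel_measurable finite_config_space"
    by (rule measurable_kernel_det[OF t])
  let ?F = "\<lambda>\<alpha>. ennreal (Re (kernel_det t \<alpha>)) * indicator {\<alpha>. finite \<alpha> \<and> \<alpha> \<subseteq> \<Lambda>} \<alpha>"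
  have "(\<integral>\<^sup>+\<alpha>. ennreal (Re (kernel_det t \<alpha>)) \<partial>config_measure_in M \<Lambda>) =
     (\<integral>\<^sup>+\<alpha>. ?F \<alpha> \<partial>config_measure M)"
    by (rule nn_integral_config_measure_in[OF \<Lambda>])
  also have "\<dots> = (\<Sum>m. ennreal (1 / fact m) * (\<integral>\<^sup>+x. ?F (x ` {..<m}) \<partial>(\<Pi>\<^sub>M i\<in>{..<m}. M)))"
    by (rule nn_integral_config_measure[OF sets_M]) measurable
  also have "\<dots> \<le> (\<Sum>m. ennreal (1 / fact m) * (\<integral>\<^sup>+x. ?h x \<partial>M) ^ m)"
  proof (intro suminf_le mult_left_mono summableI)
    fix m :: nat
    have "(\<integral>\<^sup>+x. ?F (x ` {..<m}) \<partial>(\<Pi>\<^sub>M i\<in>{..<m}. M)) \<le>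
        (\<integral>\<^sup>+x. (\<Prod>i<m. ?h (x i)) \<partial>(\<Pi>\<^sub>M i\<in>{..<m}. M))"
    proof (rule nn_integral_mono_AE, use AE_inj_tuple[of m] in eventually_elim)
      fix x :: "nat \<Rightarrow> 'a" assume x: "inj_on x {..<m}"
      show "?F (x ` {..<m}) \<le> (\<Prod>i<m. ?h (x i))"
      proof (cases "x ` {..<m} \<subseteq> \<Lambda>")
        case True
        have "Re (kernel_det t (x ` {..<m})) \<le> (\<Prod>y\<in>x ` {..<m}. Re (t y y))"
          by (intro kernel_det_le_prod_diag pos) auto
        also have "\<dots> = (\<Prod>i<m. Re (t (x i) (x i)))" using x by (simp add: prod.reindex)
        finally have "ennreal (Re (kernel_det t (x ` {..<m}))) \<le> (\<Prod>i<m. ennreal (Re (t (x i) (x i))))"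
          using diag by (subst prod_ennreal) (auto intro: ennreal_leI)
        also have "\<dots> = (\<Prod>i<m. ?h (x i))" using True by (intro prod.cong) auto
        finally show ?thesis using True by simp
      qed (simp add: indicator_def)
    qed
    also have "\<dots> = (\<integral>\<^sup>+x. ?h x \<partial>M) ^ m"
      using product_nn_integral_prod[OF finite_lessThan, where f = "\<lambda>_. ?h"] hm by simp
    finally show "(\<integral>\<^sup>+x. ?F (x ` {..<m}) \<partial>(\<Pi>\<^sub>M i\<in>{..<m}. M)) \<le> (\<integral>\<^sup>+x. ?h x \<partial>M) ^ m" .
  qed simp
  also have "\<dots> < \<infinity>"
  proof -
    obtain r where "0 \<le> r" "(\<integral>\<^sup>+x. ?h x \<partial>M) = ennreal r"
      using tr by (cases "\<integral>\<^sup>+x. ?h x \<partial>M") (auto simp: less_top)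
    then show ?thesis using ennreal_summable_exp[of r] by simp
  qed
  finally show ?thesis .
qed

text \<open>Only the empty configuration is counted. Its weight 1 comes from the term
  \<open>m = 0\<close>, where the product space is a single point, and its conditional intensity is
  1.\<close>

lemma nn_integral_cond_intensity_void:
  assumes \<Lambda>: "\<Lambda> \<in> sets borel" and d: "Re (kernel_det t \<xi>) > 0"
  shows "(\<integral>\<^sup>+\<alpha>. ennreal (indicator {\<alpha>. count_in \<Lambda> \<alpha> = 0} \<alpha>) * ennreal (cond_intensity t \<alpha> \<xi>)
    \<partial>config_measure_in M \<Lambda>) = 1"
proof -
  have e: "{\<alpha>. finite \<alpha> \<and> \<alpha> \<subseteq> {}} = {{} :: 'a set}" by auto
  have [measurable]: "{{}} \<in> sets (finite_config_space :: 'a set measure)"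
    using sets_subset_config[of "{}"] e by simp
  have "(\<integral>\<^sup>+\<alpha>. ennreal (indicator {\<alpha>. count_in \<Lambda> \<alpha> = 0} \<alpha>) * ennreal (cond_intensity t \<alpha> \<xi>)
      \<partial>config_measure_in M \<Lambda>) = (\<integral>\<^sup>+\<alpha>. indicator {{}} \<alpha> \<partial>config_measure M)"
    unfolding nn_integral_config_measure_in[OF \<Lambda>]
    using d by (intro nn_integral_cong)
      (auto simp: indicator_def count_in_def cond_intensity_def Int_absorb2)
  also have "\<dots> = (\<Sum>m. ennreal (1 / fact m) * (\<integral>\<^sup>+x. indicator {{}} (x ` {..<m}) \<partial>(\<Pi>\<^sub>M i\<in>{..<m}. M)))"
    by (rule nn_integral_config_measure[OF sets_M]) measurable
  also have "\<dots> = (\<Sum>m. if m = 0 then 1 else 0)"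
  proof (intro suminf_cong)
    fix m :: nat
    show "ennreal (1 / fact m) * (\<integral>\<^sup>+x. indicator {{}} (x ` {..<m}) \<partial>(\<Pi>\<^sub>M i\<in>{..<m}. M)) =
      (if m = 0 then 1 else 0)"
      by (cases m) (simp_all add: indicator_def PiM_empty lessThan_Suc)
  qed
  also have "\<dots> = 1" by (subst suminf_finite[of "{0}"]) auto
  finally show ?thesis .
qed

text \<open>The normalization cancels: the ratio is the unnormalized integral \<open>?I f\<close>,
  whose integrand decreases pointwise in \<xi>. The void probability is the reciprocal of the
  partition function, which is the same integral for \<open>f = 1\<close>.\<close>

lemma conditional_monotonicity:
  assumes \<Lambda>: "\<Lambda> \<in> sets borel" and \<Delta>: "\<Delta> \<in> bounded_borel"
    and t: "(\<lambda>(x, y). t x y) \<in> borel_measurable (M \<Otimes>\<^sub>M M)"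
    and pos: "\<And>\<alpha>. finite \<alpha> \<Longrightarrow> positive_matrix t \<alpha>"
    and tr: "(\<integral>\<^sup>+x. ennreal (Re (t x x)) * indicator \<Lambda> x \<partial>M) < \<infinity>"
  shows "antimono_on {\<xi>\<in>configs_in (\<Delta> - \<Lambda>). Re (kernel_det t \<xi>) > 0}
      (\<lambda>\<xi>. cond_expectation M t \<Lambda> f \<xi> / cond_void M t \<Lambda> \<xi>)"
    and "mono_on {\<xi>\<in>configs_in (\<Delta> - \<Lambda>). Re (kernel_det t \<xi>) > 0} (cond_void M t \<Lambda>)"
proof -
  let ?S = "{\<xi>\<in>configs_in (\<Delta> - \<Lambda>). Re (kernel_det t \<xi>) > 0}"
  let ?I = "\<lambda>f \<xi>. \<integral>\<^sup>+\<alpha>. ennreal (f \<alpha>) * ennreal (cond_intensity t \<alpha> \<xi>) \<partial>config_measure_in M \<Lambda>"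
  let ?Z = "cond_partition M t \<Lambda>"
  have fin: "finite \<xi>" if "\<xi> \<in> ?S" for \<xi>
  proof -
    have "finite (\<xi> \<inter> \<Delta>)" using that \<Delta> by (auto simp: configs_in_def configurations_def)
    moreover have "\<xi> \<inter> \<Delta> = \<xi>" using that by (auto simp: configs_in_def)
    ultimately show ?thesis by simp
  qed
  have space: "\<alpha> \<in> space (config_measure_in M \<Lambda>) \<longleftrightarrow> finite \<alpha> \<and> \<alpha> \<subseteq> \<Lambda>" for \<alpha>
    by (simp add: config_measure_in_def space_restrict_space) auto
  have anti: "cond_intensity t \<alpha> \<xi>' \<le> cond_intensity t \<alpha> \<xi>"
    if "\<xi> \<subseteq> \<xi>'" "\<xi>' \<in> ?S" "Re (kernel_det t \<xi>) > 0" "\<alpha> \<in> space (config_measure_in M \<Lambda>)" for \<xi> \<xi>' \<alpha>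
    using that fin[OF that(2)] by (intro cond_intensity_antimono pos) (auto simp: space configs_in_def)
  have I: "?I f \<xi>' \<le> ?I f \<xi>" if "\<xi> \<in> ?S" "\<xi>' \<in> ?S" "\<xi> \<subseteq> \<xi>'" for f \<xi> \<xi>'
    using that by (intro nn_integral_mono mult_left_mono ennreal_leI anti) auto
  have Z_eq: "?Z \<xi> = ?I (\<lambda>_. 1) \<xi>" for \<xi> by (simp add: cond_partition_def)
  have Z_fin: "?Z \<xi> < \<infinity>" if "\<xi> \<in> ?S" for \<xi>
  proof -
    \<comment> \<open>The bound compares \<xi> with the empty configuration, at which the intensity
      is the determinant of \<open>t\<close> itself.\<close>
    have "?Z \<xi> \<le> (\<integral>\<^sup>+\<alpha>. ennreal (Re (kernel_det t \<alpha>)) \<partial>config_measure_in M \<Lambda>)"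
      unfolding cond_partition_def
    proof (intro nn_integral_mono ennreal_leI)
      fix \<alpha> assume "\<alpha> \<in> space (config_measure_in M \<Lambda>)"
      then show "cond_intensity t \<alpha> \<xi> \<le> Re (kernel_det t \<alpha>)"
        using anti[of "{}" \<xi> \<alpha>] that by (simp add: cond_intensity_def)
    qed
    also have "\<dots> < \<infinity>" by (rule nn_integral_kernel_det_finite[OF \<Lambda> t pos tr])
    finally show ?thesis .
  qed
  have void: "?I (indicator {\<alpha>. count_in \<Lambda> \<alpha> = 0}) \<xi> = 1" if "\<xi> \<in> ?S" for \<xi>
    using that by (intro nn_integral_cond_intensity_void[OF \<Lambda>]) auto
  have Z_ge: "1 \<le> ?Z \<xi>" if "\<xi> \<in> ?S" for \<xi>
    unfolding void[OF that, symmetric] Z_eq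
    by (intro nn_integral_mono mult_right_mono ennreal_leI) (auto simp: indicator_def)
  have cv: "cond_void M t \<Lambda> \<xi> = inverse (?Z \<xi>)" if "\<xi> \<in> ?S" for \<xi>
    using void[OF that] by (simp add: cond_void_def cond_expectation_def)
  have ratio: "cond_expectation M t \<Lambda> f \<xi> / cond_void M t \<Lambda> \<xi> = ?I f \<xi>" if "\<xi> \<in> ?S" for f \<xi>
  proof -
    \<comment> \<open>Cancellation in the extended reals excludes the values 0 and infinity; the
      empty configuration alone already gives the lower bound 1.\<close>
    have z: "?Z \<xi> \<noteq> 0" "?Z \<xi> \<noteq> \<top>" using Z_ge[OF that] Z_fin[OF that] by auto
    have "inverse (inverse (?Z \<xi>)) = ?Z \<xi>"
      using z by (cases "?Z \<xi>") (auto simp: inverse_ennreal)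
    then have "cond_expectation M t \<Lambda> f \<xi> / cond_void M t \<Lambda> \<xi> = ?I f \<xi> * (inverse (?Z \<xi>) * ?Z \<xi>)"
      unfolding cv[OF that] cond_expectation_def
      by (simp add: divide_ennreal_def mult_ac)
    also have "inverse (?Z \<xi>) * ?Z \<xi> = 1"
      using z by (simp add: divide_ennreal_def[symmetric] mult.commute[of "inverse _"])
        (simp add: ennreal_divide_self less_top)
    finally show ?thesis by simp
  qed
  show "antimono_on ?S (\<lambda>\<xi>. cond_expectation M t \<Lambda> f \<xi> / cond_void M t \<Lambda> \<xi>)"
    using I ratio by (intro monotone_onI) simp
  show "mono_on ?S (cond_void M t \<Lambda>)"
  proof (rule monotone_onI)
    fix \<xi> \<xi>' assume x: "\<xi> \<in> ?S" "\<xi>' \<in> ?S" "\<xi> \<le> \<xi>'"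
    then have "?Z \<xi>' \<le> ?Z \<xi>" unfolding Z_eq by (intro I) auto
    then show "cond_void M t \<Lambda> \<xi> \<le> cond_void M t \<Lambda> \<xi>'"
      unfolding cv[OF x(1)] cv[OF x(2)] using Z_ge[OF x(2)] Z_fin[OF x(1)] Z_fin[OF x(2)]
      by (cases "?Z \<xi>"; cases "?Z \<xi>'") (auto simp: inverse_ennreal intro!: ennreal_leI)
  qed
qed

text \<open>The case \<open>n = 1\<close> of the trace condition: the cyclic product has the single
  factor \<open>t (x 0) (x 0)\<close>, because \<open>Suc 0 mod 1 = 0\<close>. The diagonal is
  nonnegative, so its integral is that of its norm.\<close>

lemma interaction_kernel_trace_finite:
  assumes t: "interaction_kernel M K \<Delta> t" and \<Lambda>: "\<Lambda> \<in> sets borel"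
  shows "(\<integral>\<^sup>+x. ennreal (Re (t x x)) * indicator \<Lambda> x \<partial>M) < \<infinity>"
proof -
  let ?f = "\<lambda>y. indicator \<Lambda> y * t y y :: complex"
  have [measurable]: "\<Lambda> \<in> sets M" using \<Lambda> sets_M by simp
  have m: "(\<lambda>(x, y). t x y) \<in> borel_measurable (M \<Otimes>\<^sub>M M)"
    using t by (simp add: interaction_kernel_def integral_op_def)
  have "(\<lambda>x. (x, x)) \<in> measurable M (M \<Otimes>\<^sub>M M)" by measurable
  from measurable_compose[OF this m] have [measurable]: "(\<lambda>x. t x x) \<in> borel_measurable M" by simp
  have diag: "0 \<le> Re (t x x)" "Im (t x x) = 0" for x
    using positive_matrix_diag[of "{x}" t x] t
    by (auto simp: complex_nonneg_Reals_iff interaction_kernel_def)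
  have "integrable (\<Pi>\<^sub>M i\<in>{..<1::nat}. M) (\<lambda>x. ?f (x 0))"
    using t \<open>\<Lambda> \<in> sets M\<close> unfolding interaction_kernel_def by (auto dest!: spec[of _ "1::nat"])
  moreover have "{..<1::nat} = {0}" by auto
  ultimately have "integrable (\<Pi>\<^sub>M i\<in>{0::nat}. M) (\<lambda>x. ?f (x 0))" by simp
  then have "(\<integral>\<^sup>+x. ennreal (norm (?f (x 0))) \<partial>(\<Pi>\<^sub>M i\<in>{0::nat}. M)) < \<infinity>"
    by (simp add: integrable_iff_bounded)
  also have "(\<integral>\<^sup>+x. ennreal (norm (?f (x 0))) \<partial>(\<Pi>\<^sub>M i\<in>{0::nat}. M)) = (\<integral>\<^sup>+y. ennreal (norm (?f y)) \<partial>M)"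
    by (rule product_nn_integral_singleton) measurable
  also have "\<dots> = (\<integral>\<^sup>+x. ennreal (Re (t x x)) * indicator \<Lambda> x \<partial>M)"
    using diag by (intro nn_integral_cong) (auto simp: indicator_def cmod_def)
  finally show ?thesis .
qed

end

section \<open>Void probabilities\<close>

text \<open>Up to the factor \<open>(-1) ^ m / fact m\<close> this is the \<open>m\<close>-th term
  of the Fredholm determinant over \<open>D\<close>. For a determinantal process it is the factorial
  moment of order \<open>m\<close> of the number of points in \<open>D\<close>.\<close>

definition minor_integral :: "'a measure \<Rightarrow> ('a \<Rightarrow> 'a \<Rightarrow> complex) \<Rightarrow> 'a set \<Rightarrow> nat \<Rightarrow> real" where
  "minor_integral M k D m = (\<integral>x. (\<Prod>i<m. indicator D (x i)) *
     Re (kernel_det (\<lambda>a b. k (x a) (x b)) {..<m}) \<partial>(\<Pi>\<^sub>M i\<in>{..<m}. M))"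

context diffuse_space
begin

lemma measurable_minor:
  fixes m :: nat
  assumes k: "(\<lambda>(x, y). k x y) \<in> borel_measurable (M \<Otimes>\<^sub>M M)" and D: "D \<in> sets borel"
  shows "(\<lambda>x. (\<Prod>i<m. indicator D (x i)) * Re (kernel_det (\<lambda>a b. k (x a) (x b)) {..<m}))
    \<in> borel_measurable (\<Pi>\<^sub>M i\<in>{..<m}. M)"
proof -
  note [measurable] = measurable_kernel_det_tuple[OF k, of m]
  have [measurable]: "D \<in> sets M" using D sets_M by simp
  show ?thesis by measurable
qed

text \<open>Hadamard's inequality dominates the integrand by \<open>c ^ m\<close> on tuples in
  \<open>D\<close>. Positivity is stated for almost all tuples in \<open>D\<close>, a form shared by
  the correlation kernel and its step approximations.\<close>

lemma minor_integral_bounds: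
  fixes m :: nat
  assumes k: "(\<lambda>(x, y). k x y) \<in> borel_measurable (M \<Otimes>\<^sub>M M)" and D: "D \<in> bounded_borel"
    and pos: "AE x in (\<Pi>\<^sub>M i\<in>{..<m}. M). (\<forall>i<m. x i \<in> D) \<longrightarrow>
      positive_matrix (\<lambda>a b. k (x a) (x b)) {..<m}"
    and c: "\<forall>x\<in>D. Re (k x x) \<le> c" "0 \<le> c"
  shows "integrable (\<Pi>\<^sub>M i\<in>{..<m}. M) (\<lambda>x. (\<Prod>i<m. indicator D (x i)) *
      Re (kernel_det (\<lambda>a b. k (x a) (x b)) {..<m}))"
    and "0 \<le> minor_integral M k D m" and "minor_integral M k D m \<le> (c * measure M D) ^ m"
    and "AE x in (\<Pi>\<^sub>M i\<in>{..<m}. M). 0 \<le> (\<Prod>i<m. indicator D (x i)) *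
      Re (kernel_det (\<lambda>a b. k (x a) (x b)) {..<m})"
proof -
  let ?P = "\<Pi>\<^sub>M i\<in>{..<m}. M"
  let ?f = "\<lambda>x. (\<Prod>i<m. indicator D (x i)) * Re (kernel_det (\<lambda>a b. k (x a) (x b)) {..<m})"
  let ?g = "\<lambda>x. \<Prod>i<m. c * indicator D (x i)"
  have DM: "D \<in> sets M" using D bounded_borelD sets_M by simp
  have Dfin: "emeasure M D < \<infinity>" by (rule emeasure_bounded[OF D])
  have g: "integrable ?P ?g" "(\<integral>x. ?g x \<partial>?P) = (c * measure M D) ^ m"
  proof -
    have i: "integrable M (\<lambda>x. c * indicator D x)"
      using DM Dfin by (intro integrable_mult_right integrable_real_indicator) auto
    then show "integrable ?P ?g" by (intro product_integrable_prod) auto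
    have "(\<integral>x. ?g x \<partial>?P) = (\<Prod>i<m. \<integral>y. c * indicator D y \<partial>M)"
      using i by (intro product_integral_prod) auto
    then show "(\<integral>x. ?g x \<partial>?P) = (c * measure M D) ^ m" by simp
  qed
  have fg: "AE x in ?P. 0 \<le> ?f x \<and> ?f x \<le> ?g x"
    using pos
  proof eventually_elim
    fix x :: "nat \<Rightarrow> 'a" assume x: "(\<forall>i<m. x i \<in> D) \<longrightarrow> positive_matrix (\<lambda>a b. k (x a) (x b)) {..<m}"
    show "0 \<le> ?f x \<and> ?f x \<le> ?g x"
    proof (cases "\<forall>i<m. x i \<in> D")
      case True
      then have p: "positive_matrix (\<lambda>a b. k (x a) (x b)) {..<m}" using x by simp
      have "Re (kernel_det (\<lambda>a b. k (x a) (x b)) {..<m}) \<le> (\<Prod>i<m. Re (k (x i) (x i)))"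
        using kernel_det_le_prod_diag[OF finite_lessThan p] .
      also have "\<dots> \<le> (\<Prod>i<m. c)"
        using positive_matrix_diag[OF finite_lessThan p] True c
        by (intro prod_mono) (auto simp: complex_nonneg_Reals_iff)
      finally show ?thesis using True kernel_det_Re_nonneg[OF finite_lessThan p] by simp
    next
      case False
      then obtain i where "i < m" "x i \<notin> D" by auto
      then have z: "(\<Prod>i<m. indicator D (x i)) = (0::real)" "?g x = 0"
        by (auto intro!: prod_zero bexI[of _ i])
      then show ?thesis by (simp only: z) simp
    qed
  qed
  show f: "integrable ?P ?f"
    by (rule Bochner_Integration.integrable_bound[OF g(1)])
      (use fg measurable_minor[OF k bounded_borelD[OF D]] in auto)
  show "AE x in ?P. 0 \<le> ?f x" using fg by eventually_elim simp
  then show "0 \<le> minor_integral M k D m"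
    unfolding minor_integral_def by (rule integral_nonneg_AE)
  show "minor_integral M k D m \<le> (c * measure M D) ^ m"
    unfolding minor_integral_def g(2)[symmetric] using fg
    by (intro integral_mono_AE f g(1)) auto
qed

text \<open>A null set of the configuration measure is null for every term of the series that
  defines it, hence for tuples of each length. Tuples with repeated entries inherit positivity from
  their image.\<close>

lemma positive_matrix_tuple:
  assumes "AE \<alpha> in config_measure M. positive_matrix k \<alpha>"
  shows "AE x in (\<Pi>\<^sub>M i\<in>{..<m::nat}. M). positive_matrix (\<lambda>a b. k (x a) (x b)) {..<m}"
proof -
  let ?P = "\<Pi>\<^sub>M i\<in>{..<m}. M"
  obtain N where N: "{\<alpha>\<in>space (config_measure M). \<not> positive_matrix k \<alpha>} \<subseteq> N"
    "emeasure (config_measure M) N = 0" "N \<in> sets (config_measure M)"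
    using assms by (rule AE_E)
  have [measurable]: "N \<in> sets finite_config_space" using N(3) by simp
  note [measurable] = measurable_image_config[OF sets_M]
  let ?t = "\<lambda>m. ennreal (1 / fact m) * (\<integral>\<^sup>+x. indicator N (x ` {..<m}) \<partial>(\<Pi>\<^sub>M i\<in>{..<m}. M))"
  have "(\<Sum>m. ?t m) = (\<integral>\<^sup>+\<alpha>. indicator N \<alpha> \<partial>config_measure M)"
    by (rule nn_integral_config_measure[OF sets_M, symmetric]) measurable
  then have "(\<Sum>m. ?t m) = 0" using N by simp
  moreover have "(\<Sum>i\<in>{m}. ?t i) \<le> (\<Sum>m. ?t m)" by (intro sum_le_suminf summableI) auto
  ultimately have "?t m = 0" by simp
  then have "(\<integral>\<^sup>+x. indicator N (x ` {..<m}) \<partial>?P) = 0" by simp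
  then have "AE x in ?P. indicator N (x ` {..<m}) = (0::ennreal)"
    by (subst (asm) nn_integral_0_iff_AE) measurable
  then show ?thesis
  proof eventually_elim
    fix x :: "nat \<Rightarrow> 'a" assume "indicator N (x ` {..<m}) = (0::ennreal)"
    then have "x ` {..<m} \<notin> N" by (simp add: indicator_eq_0_iff)
    then have "positive_matrix k (x ` {..<m})" using N(1) by auto
    then show "positive_matrix (\<lambda>a b. k (x a) (x b)) {..<m}"
      by (intro positive_matrix_pullback[of _ k "x ` {..<m}" x]) auto
  qed
qed

text \<open>The test function \<open>u\<close> singles out the \<open>m\<close>-point subsets of
  \<open>D\<close>; summed over the finite subsets of \<xi> it counts them, which gives the binomial
  coefficient.\<close>

lemma factorial_moment:
  assumes k: "(\<lambda>(x, y). k x y) \<in> borel_measurable (M \<Otimes>\<^sub>M M)" and D: "D \<in> bounded_borel"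
    and \<mu>: "determinantal_process M k \<mu>"
  shows "(\<integral>\<^sup>+\<xi>. ennreal (count_in D \<xi> choose m) \<partial>\<mu>) = ennreal (1 / fact m) *
    (\<integral>\<^sup>+x. ennreal ((\<Prod>i<m. indicator D (x i)) * Re (kernel_det (\<lambda>a b. k (x a) (x b)) {..<m}))
      \<partial>(\<Pi>\<^sub>M i\<in>{..<m}. M))"
proof -
  let ?F = "finite_config_space :: 'a set measure"
  let ?A = "{\<alpha>. finite \<alpha> \<and> \<alpha> \<subseteq> D}"
  let ?\<rho> = "\<lambda>\<alpha>. ennreal (Re (kernel_det k \<alpha>))"
  define u where "u \<alpha> = (indicator ?A \<alpha> * (if card \<alpha> = m then 1 else 0) :: real)" for \<alpha> :: "'a set"
  have [measurable]: "?A \<in> sets ?F" by (rule sets_subset_config[OF bounded_borelD[OF D]])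
  note [measurable] = measurable_card measurable_kernel_det[OF k]
  have um [measurable]: "u \<in> borel_measurable ?F" unfolding u_def by measurable
  have sp: "space \<mu> = configurations"
    using \<mu> sets_eq_imp_space_eq[of \<mu> config_space]
    by (simp add: determinantal_process_def point_process_def space_config_space)
  have "(\<integral>\<^sup>+\<xi>. ennreal (count_in D \<xi> choose m) \<partial>\<mu>) =
      (\<integral>\<^sup>+\<xi>. (\<Sum>\<^sub>\<infinity>\<alpha>\<in>{\<alpha>. finite \<alpha> \<and> \<alpha> \<subseteq> \<xi>}. ennreal (u \<alpha>)) \<partial>\<mu>)"
  proof (rule nn_integral_cong)
    fix \<xi> assume "\<xi> \<in> space \<mu>"
    then have fin: "finite (\<xi> \<inter> D)" using D sp by (simp add: configurations_def)
    let ?B = "{\<alpha>. \<alpha> \<subseteq> \<xi> \<inter> D \<and> card \<alpha> = m}"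
    have fB: "finite ?B" by (rule finite_subset[of _ "Pow (\<xi> \<inter> D)"]) (use fin in blast, simp only: finite_Pow_iff fin)
    have "(\<Sum>\<^sub>\<infinity>\<alpha>\<in>{\<alpha>. finite \<alpha> \<and> \<alpha> \<subseteq> \<xi>}. ennreal (u \<alpha>)) = (\<Sum>\<^sub>\<infinity>\<alpha>\<in>?B. 1)"
    proof (rule infsum_cong_neutral)
      show "(1::ennreal) = 0" if "\<alpha> \<in> ?B - {\<alpha>. finite \<alpha> \<and> \<alpha> \<subseteq> \<xi>}" for \<alpha>
        using that fin finite_subset by blast
      show "ennreal (u \<alpha>) = 0" if "\<alpha> \<in> {\<alpha>. finite \<alpha> \<and> \<alpha> \<subseteq> \<xi>} - ?B" for \<alpha>
        using that by (auto simp: u_def indicator_def)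
      show "ennreal (u \<alpha>) = 1" if "\<alpha> \<in> {\<alpha>. finite \<alpha> \<and> \<alpha> \<subseteq> \<xi>} \<inter> ?B" for \<alpha>
        using that by (auto simp: u_def indicator_def)
    qed
    also have "\<dots> = of_nat (card ?B)" using fB by simp
    also have "card ?B = count_in D \<xi> choose m" using n_subsets[OF fin] by (simp add: count_in_def)
    finally show "ennreal (count_in D \<xi> choose m) =
        (\<Sum>\<^sub>\<infinity>\<alpha>\<in>{\<alpha>. finite \<alpha> \<and> \<alpha> \<subseteq> \<xi>}. ennreal (u \<alpha>))"
      by (simp add: ennreal_of_nat_eq_real_of_nat)
  qed
  also have "\<dots> = (\<integral>\<^sup>+\<alpha>. ennreal (u \<alpha>) * ?\<rho> \<alpha> \<partial>config_measure M)"
    using \<mu> um by (simp add: determinantal_process_def has_correlation_function_def u_def)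
  also have "\<dots> = (\<Sum>n. ennreal (1 / fact n) *
      (\<integral>\<^sup>+x. ennreal (u (x ` {..<n})) * ?\<rho> (x ` {..<n}) \<partial>(\<Pi>\<^sub>M i\<in>{..<n}. M)))"
    by (rule nn_integral_config_measure[OF sets_M]) measurable
  also have "\<dots> = (\<Sum>n\<in>{m}. ennreal (1 / fact n) *
      (\<integral>\<^sup>+x. ennreal (u (x ` {..<n})) * ?\<rho> (x ` {..<n}) \<partial>(\<Pi>\<^sub>M i\<in>{..<n}. M)))"
  proof (rule suminf_finite)
    fix n assume n: "n \<notin> {m}"
    \<comment> \<open>Off a null set an \<open>n\<close>-tuple has \<open>n\<close> different
      entries, so for \<open>n \<noteq> m\<close> its image is not seen by \<open>u\<close>.\<close>
    have "(\<integral>\<^sup>+x. ennreal (u (x ` {..<n})) * ?\<rho> (x ` {..<n}) \<partial>(\<Pi>\<^sub>M i\<in>{..<n}. M)) =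
       (\<integral>\<^sup>+x. 0 \<partial>(\<Pi>\<^sub>M i\<in>{..<n}. M))"
    proof (rule nn_integral_cong_AE, use AE_inj_tuple[of n] in eventually_elim)
      fix x :: "nat \<Rightarrow> 'a" assume "inj_on x {..<n}"
      then have "card (x ` {..<n}) \<noteq> m" using n by (simp add: card_image)
      then show "ennreal (u (x ` {..<n})) * ?\<rho> (x ` {..<n}) = 0" by (simp add: u_def)
    qed
    then show "ennreal (1 / fact n) *
        (\<integral>\<^sup>+x. ennreal (u (x ` {..<n})) * ?\<rho> (x ` {..<n}) \<partial>(\<Pi>\<^sub>M i\<in>{..<n}. M)) = 0" by simp
  qed simp
  also have "\<dots> = ennreal (1 / fact m) *
    (\<integral>\<^sup>+x. ennreal ((\<Prod>i<m. indicator D (x i)) * Re (kernel_det (\<lambda>a b. k (x a) (x b)) {..<m}))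
      \<partial>(\<Pi>\<^sub>M i\<in>{..<m}. M))"
  proof -
    have "(\<integral>\<^sup>+x. ennreal (u (x ` {..<m})) * ?\<rho> (x ` {..<m}) \<partial>(\<Pi>\<^sub>M i\<in>{..<m}. M)) =
      (\<integral>\<^sup>+x. ennreal ((\<Prod>i<m. indicator D (x i)) * Re (kernel_det (\<lambda>a b. k (x a) (x b)) {..<m}))
        \<partial>(\<Pi>\<^sub>M i\<in>{..<m}. M))"
    proof (rule nn_integral_cong_AE, use AE_inj_tuple[of m] in eventually_elim)
      fix x :: "nat \<Rightarrow> 'a" assume x: "inj_on x {..<m}"
      have "(\<Prod>i<m. indicator D (x i)) = (indicator ?A (x ` {..<m}) :: real)"
      proof (cases "x ` {..<m} \<subseteq> D")
        case True
        then have "(\<Prod>i<m. indicator D (x i)) = (\<Prod>i<m. 1 :: real)" by (intro prod.cong) auto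
        then show ?thesis using True by simp
      next
        case False
        then show ?thesis by (auto simp: indicator_def intro!: prod_zero)
      qed
      then have "u (x ` {..<m}) = (\<Prod>i<m. indicator D (x i))"
        using x by (simp add: u_def card_image)
      then show "ennreal (u (x ` {..<m})) * ?\<rho> (x ` {..<m}) =
        ennreal ((\<Prod>i<m. indicator D (x i)) * Re (kernel_det (\<lambda>a b. k (x a) (x b)) {..<m}))"
        using kernel_det_reindex[OF finite_lessThan x, of k]
        by (simp add: ennreal_mult' prod_nonneg)
    qed
    then show ?thesis by simp
  qed
  finally show ?thesis .
qed

text \<open>The alternating sum of \<open>N choose m\<close> over \<open>m\<close> is 1 for
  \<open>N = 0\<close> and 0 otherwise. The bound \<open>c\<close> lets the factorial moments grow
  at most geometrically, so summation and expectation may be exchanged.\<close>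

lemma void_probability:
  assumes k: "(\<lambda>(x, y). k x y) \<in> borel_measurable (M \<Otimes>\<^sub>M M)" and D: "D \<in> bounded_borel"
    and \<mu>: "determinantal_process M k \<mu>"
    and pos: "AE \<alpha> in config_measure M. positive_matrix k \<alpha>"
    and c: "\<forall>x\<in>D. Re (k x x) \<le> c" "0 \<le> c"
  shows "measure \<mu> {\<xi>\<in>space \<mu>. count_in D \<xi> = 0} =
    (\<Sum>m. (-1) ^ m / fact m * minor_integral M k D m)"
proof -
  interpret \<mu>: prob_space \<mu> using \<mu> by (simp add: determinantal_process_def point_process_def)
  have s: "sets \<mu> = sets config_space" using \<mu> by (simp add: determinantal_process_def point_process_def)
  have [measurable]: "count_in D \<in> measurable \<mu> (count_space UNIV)"
    using measurable_count_in[OF D] by (simp only: measurable_cong_sets[OF s refl])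
  have pos': "AE x in (\<Pi>\<^sub>M i\<in>{..<m}. M). (\<forall>i<m. x i \<in> D) \<longrightarrow>
      positive_matrix (\<lambda>a b. k (x a) (x b)) {..<m}" for m :: nat
    using positive_matrix_tuple[OF pos, of m] by eventually_elim simp
  note b = minor_integral_bounds[OF k D pos' c]
  have E: "(\<integral>\<^sup>+\<xi>. ennreal (count_in D \<xi> choose m) \<partial>\<mu>) = ennreal (minor_integral M k D m / fact m)" for m
    unfolding factorial_moment[OF k D \<mu>] minor_integral_def
    by (subst nn_integral_eq_integral[OF b(1,4)]) (simp_all add: ennreal_mult'[symmetric] c)
  let ?f = "\<lambda>m \<xi>. real (count_in D \<xi> choose m)"
  have i: "integrable \<mu> (?f m)" for m
    by (rule integrableI_nonneg) (simp_all add: E)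
  have I: "(\<integral>\<xi>. ?f m \<xi> \<partial>\<mu>) = minor_integral M k D m / fact m" for m
    using b(2)[of m] by (subst integral_eq_nn_integral) (simp_all add: E b)
  have "measure \<mu> {\<xi>\<in>space \<mu>. count_in D \<xi> = 0} =
     (\<integral>\<xi>. indicator {\<xi>\<in>space \<mu>. count_in D \<xi> = 0} \<xi> \<partial>\<mu>)" by simp
  also have "\<dots> = (\<integral>\<xi>. (\<Sum>m. (-1) ^ m * ?f m \<xi>) \<partial>\<mu>)"
  proof (rule Bochner_Integration.integral_cong[OF refl])
    fix \<xi> assume x: "\<xi> \<in> space \<mu>"
    have "(\<Sum>m. (-1) ^ m * ?f m \<xi>) = (\<Sum>m\<le>count_in D \<xi>. (-1) ^ m * real (count_in D \<xi> choose m))"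
      by (rule suminf_finite) (auto simp: binomial_eq_0)
    also have "\<dots> = (if count_in D \<xi> = 0 then 1 else 0)"
      using choose_alternating_sum[of "count_in D \<xi>", where 'a = real] by simp
    finally show "indicator {\<xi>\<in>space \<mu>. count_in D \<xi> = 0} \<xi> = (\<Sum>m. (-1) ^ m * ?f m \<xi>)"
      using x by (simp add: indicator_def)
  qed
  also have "\<dots> = (\<Sum>m. \<integral>\<xi>. (-1) ^ m * ?f m \<xi> \<partial>\<mu>)"
  proof (rule integral_suminf)
    show "integrable \<mu> (\<lambda>\<xi>. (-1) ^ m * ?f m \<xi>)" for m using i by simp
    show "AE \<xi> in \<mu>. summable (\<lambda>m. norm ((-1) ^ m * ?f m \<xi>))"
    proof (rule AE_I2)
      fix \<xi>
      show "summable (\<lambda>m. norm ((-1) ^ m * ?f m \<xi>))"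
        by (rule summable_finite[of "{..count_in D \<xi>}"]) (auto simp: binomial_eq_0)
    qed
    have "summable (\<lambda>m. inverse (fact m) * (c * measure M D) ^ m)" by (rule summable_exp)
    then have "summable (\<lambda>m. minor_integral M k D m / fact m)"
      by (rule summable_comparison_test'[where N = 0])
        (use b(2,3) in \<open>auto simp: divide_inverse mult.commute intro!: mult_left_mono\<close>)
    then show "summable (\<lambda>m. \<integral>\<xi>. norm ((-1) ^ m * ?f m \<xi>) \<partial>\<mu>)" by (simp add: abs_mult I)
  qed
  also have "\<dots> = (\<Sum>m. (-1) ^ m / fact m * minor_integral M k D m)"
    by (simp add: I)
  finally show ?thesis .
qed

end

section \<open>Perturbation of Fredholm series and step kernels\<close>

text \<open>Division by \<open>c\<close> moves every factor into the unit disc, where the difference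
  of two products is at most the sum of the differences of the factors.\<close>

lemma norm_prod_diff_le:
  fixes z w :: "'i \<Rightarrow> complex"
  assumes "\<And>i. i \<in> I \<Longrightarrow> norm (z i) \<le> c" "\<And>i. i \<in> I \<Longrightarrow> norm (w i) \<le> c" "0 < c"
  shows "norm ((\<Prod>i\<in>I. z i) - (\<Prod>i\<in>I. w i)) \<le> c ^ (card I - 1) * (\<Sum>i\<in>I. norm (z i - w i))"
proof (cases "finite I \<and> I \<noteq> {}")
  case True
  then have card: "c ^ card I = c * c ^ (card I - 1)" by (cases "card I") auto
  let ?c = "of_real c :: complex"
  have "norm ((\<Prod>i\<in>I. z i / ?c) - (\<Prod>i\<in>I. w i / ?c)) \<le> (\<Sum>i\<in>I. norm (z i / ?c - w i / ?c))"
    using assms by (intro norm_prod_diff) (auto simp: norm_divide divide_le_eq)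
  also have "\<dots> = (\<Sum>i\<in>I. norm (z i - w i)) / c"
    using assms(3) by (simp add: diff_divide_distrib[symmetric] norm_divide sum_divide_distrib)
  also have "(\<Prod>i\<in>I. z i / ?c) - (\<Prod>i\<in>I. w i / ?c) = ((\<Prod>i\<in>I. z i) - (\<Prod>i\<in>I. w i)) / ?c ^ card I"
    by (simp add: prod_dividef diff_divide_distrib)
  finally have "norm ((\<Prod>i\<in>I. z i) - (\<Prod>i\<in>I. w i)) / c ^ card I \<le> (\<Sum>i\<in>I. norm (z i - w i)) / c"
    using assms(3) by (simp add: norm_divide norm_power)
  then show ?thesis using assms(3) by (simp add: card field_simps)
qed (auto simp: infinite_imp_nonempty)

lemma kernel_det_diff_le:
  assumes "finite \<alpha>" "0 < c"
    and "\<And>x y. x \<in> \<alpha> \<Longrightarrow> y \<in> \<alpha> \<Longrightarrow> norm (k x y) \<le> c"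
    and "\<And>x y. x \<in> \<alpha> \<Longrightarrow> y \<in> \<alpha> \<Longrightarrow> norm (s x y) \<le> c"
  shows "norm (kernel_det k \<alpha> - kernel_det s \<alpha>) \<le>
    (\<Sum>p | p permutes \<alpha>. \<Sum>x\<in>\<alpha>. c ^ (card \<alpha> - 1) * norm (k x (p x) - s x (p x)))"
proof -
  have "kernel_det k \<alpha> - kernel_det s \<alpha> =
    (\<Sum>p | p permutes \<alpha>. of_int (sign p) * ((\<Prod>x\<in>\<alpha>. k x (p x)) - (\<Prod>x\<in>\<alpha>. s x (p x))))"
    by (simp add: kernel_det_def sum_subtractf right_diff_distrib)
  also have "norm \<dots> \<le> (\<Sum>p | p permutes \<alpha>. \<Sum>x\<in>\<alpha>. c ^ (card \<alpha> - 1) * norm (k x (p x) - s x (p x)))"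
  proof (rule sum_norm_le)
    fix p assume "p \<in> {p. p permutes \<alpha>}"
    then have p: "p x \<in> \<alpha>" if "x \<in> \<alpha>" for x using that by (simp add: permutes_in_image)
    have "norm (of_int (sign p) * ((\<Prod>x\<in>\<alpha>. k x (p x)) - (\<Prod>x\<in>\<alpha>. s x (p x)))) =
        norm ((\<Prod>x\<in>\<alpha>. k x (p x)) - (\<Prod>x\<in>\<alpha>. s x (p x)))"
      by (simp add: norm_mult sign_def)
    also have "\<dots> \<le> c ^ (card \<alpha> - 1) * (\<Sum>x\<in>\<alpha>. norm (k x (p x) - s x (p x)))"
      using assms p by (intro norm_prod_diff_le) auto
    finally show "norm (of_int (sign p) * ((\<Prod>x\<in>\<alpha>. k x (p x)) - (\<Prod>x\<in>\<alpha>. s x (p x)))) \<le>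
        (\<Sum>x\<in>\<alpha>. c ^ (card \<alpha> - 1) * norm (k x (p x) - s x (p x)))"
      by (simp add: sum_distrib_left)
  qed
  finally show ?thesis .
qed

text \<open>A permutation only reorders the factors \<open>r (p x)\<close>. With square roots of
  cell measures for \<open>r\<close>, the volumes of the cells move into the matrix symmetrically,
  so that it stays Hermitian.\<close>

lemma kernel_det_scale:
  assumes "finite \<alpha>"
  shows "kernel_det (\<lambda>x y. k x y * (r x * r y)) \<alpha> = (\<Prod>x\<in>\<alpha>. r x)\<^sup>2 * kernel_det k \<alpha>"
  unfolding kernel_det_def sum_distrib_left
proof (rule sum.cong[OF refl])
  fix p assume "p \<in> {p. p permutes \<alpha>}"
  then have "(\<Prod>x\<in>\<alpha>. r (p x)) = (\<Prod>x\<in>\<alpha>. r x)"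
    by (intro prod.reindex_bij_betw permutes_imp_bij) simp
  then show "of_int (sign p) * (\<Prod>x\<in>\<alpha>. k x (p x) * (r x * r (p x))) =
      (\<Prod>x\<in>\<alpha>. r x)\<^sup>2 * (of_int (sign p) * (\<Prod>x\<in>\<alpha>. k x (p x)))"
    by (simp add: prod.distrib power2_eq_square)
qed

context diffuse_space
begin

text \<open>A permutation \<open>p\<close> couples the coordinates \<open>a\<close> and
  \<open>p a\<close>. If they differ, the error of that entry is controlled by \<open>e2\<close> and
  \<open>m - 2\<close> coordinates are free; if they coincide, it is controlled by \<open>e1\<close>
  and \<open>m - 1\<close> are free. The sum of the two powers covers both cases.\<close>

lemma minor_integral_diff:
  fixes m :: nat
  assumes k: "(\<lambda>(x, y). k x y) \<in> borel_measurable (M \<Otimes>\<^sub>M M)"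
    and s: "(\<lambda>(x, y). s x y) \<in> borel_measurable (M \<Otimes>\<^sub>M M)"
    and D: "D \<in> bounded_borel"
    and kpos: "AE x in (\<Pi>\<^sub>M i\<in>{..<m}. M). (\<forall>i<m. x i \<in> D) \<longrightarrow>
      positive_matrix (\<lambda>a b. k (x a) (x b)) {..<m}"
    and spos: "AE x in (\<Pi>\<^sub>M i\<in>{..<m}. M). (\<forall>i<m. x i \<in> D) \<longrightarrow>
      positive_matrix (\<lambda>a b. s (x a) (x b)) {..<m}"
    and kc: "\<forall>x\<in>D. Re (k x x) \<le> c" and sc: "\<forall>x\<in>D. Re (s x x) \<le> c" and c: "0 < c"
    and e2: "(\<integral>\<^sup>+y. \<integral>\<^sup>+z. ennreal (norm (k y z - s y z)) * (indicator D y * indicator D z) \<partial>M \<partial>M) \<le> ennreal \<epsilon>"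
    and e1: "(\<integral>\<^sup>+y. ennreal (norm (k y y - s y y)) * indicator D y \<partial>M) \<le> ennreal \<epsilon>"
    and \<epsilon>: "0 \<le> \<epsilon>"
  shows "\<bar>minor_integral M k D m - minor_integral M s D m\<bar> \<le>
    fact m * (m * (c ^ (m - 1) * ((measure M D ^ (m - 1) + measure M D ^ (m - 2)) * \<epsilon>)))"
proof -
  let ?P = "\<Pi>\<^sub>M i\<in>{..<m}. M"
  let ?d = "\<lambda>k x. Re (kernel_det (\<lambda>a b. k (x a) (x b)) {..<m})"
  let ?D = "\<lambda>x. \<Prod>i<m. indicator D (x i)"
  let ?e = "\<lambda>y z. ennreal (norm (k y z - s y z))"
  let ?b = "measure M D ^ (m - 1) + measure M D ^ (m - 2)"
  have DM [measurable]: "D \<in> sets M" using D bounded_borelD sets_M by simp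
  have eD: "emeasure M D = ennreal (measure M D)"
    using emeasure_bounded[OF D] by (simp add: emeasure_eq_ennreal_measure less_top)
  have em [measurable]: "(\<lambda>(y, z). ?e y z) \<in> borel_measurable (M \<Otimes>\<^sub>M M)"
    using k s by (simp add: case_prod_beta')
  have em1 [measurable]: "(\<lambda>y. ?e y y) \<in> borel_measurable M"
  proof -
    have "(\<lambda>x. (x, x)) \<in> measurable M (M \<Otimes>\<^sub>M M)" by measurable
    from measurable_compose[OF this em] show ?thesis by simp
  qed
  note ik = minor_integral_bounds(1)[OF k D kpos kc less_imp_le[OF c]]
  note i_s = minor_integral_bounds(1)[OF s D spos sc less_imp_le[OF c]]
  have i: "integrable ?P (\<lambda>x. ?D x * ?d k x - ?D x * ?d s x)" using ik i_s by (rule Bochner_Integration.integrable_diff)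
  have entry: "(\<integral>\<^sup>+x. ?D x * ?e (x a) (x b) \<partial>?P) \<le> ennreal (?b * \<epsilon>)" if ab: "a < m" "b < m" for a b
  proof (cases "a = b")
    case True
    have "(\<integral>\<^sup>+x. ?D x * ?e (x a) (x b) \<partial>?P) =
      (\<integral>\<^sup>+x. (\<Prod>c\<in>{..<m} - {a}. indicator D (x c)) * (?e (x a) (x a) * indicator D (x a)) \<partial>?P)"
      using ab True by (intro nn_integral_cong) (simp add: prod.remove[of "{..<m}" a] mult_ac)
    also have "\<dots> = (\<integral>\<^sup>+y. indicator D y \<partial>M) ^ (card {..<m} - 1) * (\<integral>\<^sup>+y. ?e y y * indicator D y \<partial>M)"
      using ab by (intro nn_integral_one_coordinate) auto
    also have "\<dots> \<le> (\<integral>\<^sup>+y. indicator D y \<partial>M) ^ (card {..<m} - 1) * ennreal \<epsilon>"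
      using e1 by (rule mult_left_mono) simp
    also have "\<dots> = ennreal (measure M D ^ (m - 1) * \<epsilon>)"
      using \<epsilon> by (simp add: eD ennreal_power ennreal_mult)
    also have "\<dots> \<le> ennreal (?b * \<epsilon>)"
      using \<epsilon> by (intro ennreal_leI mult_right_mono) auto
    finally show ?thesis .
  next
    case False
    have Dab: "?D x = (\<Prod>c\<in>{..<m} - {a, b}. indicator D (x c)) * (indicator D (x a) * indicator D (x b))"
      for x :: "nat \<Rightarrow> 'a"
    proof -
      have "{..<m} = insert a (insert b ({..<m} - {a, b}))" using ab by auto
      then have "?D x = (\<Prod>c\<in>insert a (insert b ({..<m} - {a, b})). indicator D (x c))" by simp
      then show ?thesis using False by (simp add: mult_ac)
    qed
    have "(\<integral>\<^sup>+x. ?D x * ?e (x a) (x b) \<partial>?P) =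
      (\<integral>\<^sup>+x. (\<Prod>c\<in>{..<m} - {a, b}. indicator D (x c)) *
        (?e (x a) (x b) * (indicator D (x a) * indicator D (x b))) \<partial>?P)"
      unfolding Dab by (simp add: mult_ac)
    also have "\<dots> = (\<integral>\<^sup>+y. indicator D y \<partial>M) ^ (card {..<m} - 2) *
        (\<integral>\<^sup>+y. \<integral>\<^sup>+z. ?e y z * (indicator D y * indicator D z) \<partial>M \<partial>M)"
      using ab False em by (intro nn_integral_two_coordinates) (auto simp: case_prod_beta')
    also have "\<dots> \<le> (\<integral>\<^sup>+y. indicator D y \<partial>M) ^ (card {..<m} - 2) * ennreal \<epsilon>"
      using e2 by (rule mult_left_mono) simp
    also have "\<dots> = ennreal (measure M D ^ (m - 2) * \<epsilon>)"
      using \<epsilon> by (simp add: eD ennreal_power ennreal_mult)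
    also have "\<dots> \<le> ennreal (?b * \<epsilon>)"
      using \<epsilon> by (intro ennreal_leI mult_right_mono) auto
    finally show ?thesis .
  qed
  have "\<bar>minor_integral M k D m - minor_integral M s D m\<bar> = \<bar>\<integral>x. ?D x * ?d k x - ?D x * ?d s x \<partial>?P\<bar>"
    unfolding minor_integral_def by (subst Bochner_Integration.integral_diff[OF ik i_s]) simp
  also have "\<dots> \<le> (\<integral>x. \<bar>?D x * ?d k x - ?D x * ?d s x\<bar> \<partial>?P)" by (rule integral_abs_bound)
  finally have "ennreal \<bar>minor_integral M k D m - minor_integral M s D m\<bar> \<le>
      ennreal (\<integral>x. \<bar>?D x * ?d k x - ?D x * ?d s x\<bar> \<partial>?P)" by (rule ennreal_leI)
  also have "\<dots> = (\<integral>\<^sup>+x. ennreal \<bar>?D x * ?d k x - ?D x * ?d s x\<bar> \<partial>?P)"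
    using i by (intro nn_integral_eq_integral[symmetric]) auto
  also have "\<dots> \<le> (\<integral>\<^sup>+x. (\<Sum>p | p permutes {..<m}. \<Sum>a<m.
      ennreal (c ^ (m - 1)) * (?D x * ?e (x a) (x (p a)))) \<partial>?P)"
  proof (rule nn_integral_mono_AE, use kpos spos in eventually_elim)
    fix x :: "nat \<Rightarrow> 'a"
    assume x: "(\<forall>i<m. x i \<in> D) \<longrightarrow> positive_matrix (\<lambda>a b. k (x a) (x b)) {..<m}"
      "(\<forall>i<m. x i \<in> D) \<longrightarrow> positive_matrix (\<lambda>a b. s (x a) (x b)) {..<m}"
    show "ennreal \<bar>?D x * ?d k x - ?D x * ?d s x\<bar> \<le>
      (\<Sum>p | p permutes {..<m}. \<Sum>a<m. ennreal (c ^ (m - 1)) * (?D x * ?e (x a) (x (p a))))"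
    proof (cases "\<forall>i<m. x i \<in> D")
      case True
      \<comment> \<open>Positivity turns the bound on the diagonal into one for all entries.\<close>
      have b: "norm (k (x a) (x b)) \<le> c" "norm (s (x a) (x b)) \<le> c" if "a < m" "b < m" for a b
        using positive_matrix_norm_le[OF finite_lessThan[of m], where k = "\<lambda>a b. k (x a) (x b)" and x = a and y = b]
          positive_matrix_norm_le[OF finite_lessThan[of m], where k = "\<lambda>a b. s (x a) (x b)" and x = a and y = b] x True that
          bspec[OF kc, of "x a"] bspec[OF kc, of "x b"] bspec[OF sc, of "x a"] bspec[OF sc, of "x b"]
        by auto
      have "\<bar>?d k x - ?d s x\<bar> \<le> norm (kernel_det (\<lambda>a b. k (x a) (x b)) {..<m} - kernel_det (\<lambda>a b. s (x a) (x b)) {..<m})"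
        using abs_Re_le_cmod[of "kernel_det (\<lambda>a b. k (x a) (x b)) {..<m} - kernel_det (\<lambda>a b. s (x a) (x b)) {..<m}"]
        by simp
      also have "\<dots> \<le> (\<Sum>p | p permutes {..<m}. \<Sum>a<m. c ^ (card {..<m} - 1) * norm (k (x a) (x (p a)) - s (x a) (x (p a))))"
        by (rule kernel_det_diff_le) (use b c in auto)
      finally have "ennreal \<bar>?d k x - ?d s x\<bar> \<le> (\<Sum>p | p permutes {..<m}. \<Sum>a<m.
          ennreal (c ^ (m - 1)) * ?e (x a) (x (p a)))"
        using c by (simp add: ennreal_mult[symmetric] sum_ennreal sum_nonneg ennreal_leI)
      moreover have "?D x = (1::real)" "?D x = (1::ennreal)" using True by auto
      ultimately show ?thesis by simp
    next
      case False
      then obtain i where "i < m" "x i \<notin> D" by auto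
      then have "?D x = (0::real)" by (auto intro!: prod_zero bexI[of _ i])
      then show ?thesis by (simp only: mult_zero_left) simp
    qed
  qed
  also have "\<dots> = (\<Sum>p | p permutes {..<m}. \<Sum>a<m.
      ennreal (c ^ (m - 1)) * (\<integral>\<^sup>+x. ?D x * ?e (x a) (x (p a)) \<partial>?P))"
  proof -
    have [measurable]: "(\<lambda>x. ?D x * ?e (x a) (x (p a))) \<in> borel_measurable ?P"
      if "p permutes {..<m}" "a < m" for p a
    proof -
      have "p a < m" using that permutes_in_image[of p "{..<m}" a] by simp
      then have "(\<lambda>x. (x a, x (p a))) \<in> measurable ?P (M \<Otimes>\<^sub>M M)"
        using that by (intro measurable_Pair measurable_component_singleton) auto
      from measurable_compose[OF this em] show ?thesis by simp
    qed
    then have m: "(\<lambda>x. ennreal (c ^ (m - 1)) * (?D x * ?e (x a) (x (p a)))) \<in> borel_measurable ?P"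
      if "p permutes {..<m}" "a < m" for p a
      using that by measurable
    have "(\<integral>\<^sup>+x. (\<Sum>p | p permutes {..<m}. \<Sum>a<m.
        ennreal (c ^ (m - 1)) * (?D x * ?e (x a) (x (p a)))) \<partial>?P) =
      (\<Sum>p | p permutes {..<m}. \<integral>\<^sup>+x. (\<Sum>a<m.
        ennreal (c ^ (m - 1)) * (?D x * ?e (x a) (x (p a)))) \<partial>?P)"
      by (rule nn_integral_sum) (use m in \<open>auto intro!: borel_measurable_sum\<close>)
    also have "\<dots> = (\<Sum>p | p permutes {..<m}. \<Sum>a<m. \<integral>\<^sup>+x.
        ennreal (c ^ (m - 1)) * (?D x * ?e (x a) (x (p a))) \<partial>?P)"
      by (intro sum.cong refl nn_integral_sum m) auto
    also have "\<dots> = (\<Sum>p | p permutes {..<m}. \<Sum>a<m.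
        ennreal (c ^ (m - 1)) * (\<integral>\<^sup>+x. ?D x * ?e (x a) (x (p a)) \<partial>?P))"
      by (intro sum.cong refl nn_integral_cmult) auto
    finally show ?thesis .
  qed
  also have "\<dots> \<le> (\<Sum>p | p permutes {..<m}. \<Sum>a<m. ennreal (c ^ (m - 1)) * ennreal (?b * \<epsilon>))"
  proof (intro sum_mono mult_left_mono entry)
    fix p a assume "p \<in> {p. p permutes {..<m}}" "a \<in> {..<m}"
    then show "a < m" "p a < m" using permutes_in_image[of p "{..<m}" a] by auto
  qed simp
  also have "\<dots> = ennreal (fact m * (m * (c ^ (m - 1) * (?b * \<epsilon>))))"
    using c \<epsilon> by (simp add: card_permutations ennreal_mult ennreal_of_nat_eq_real_of_nat)
  finally show ?thesis using c \<epsilon> by (subst (asm) ennreal_le_iff) auto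
qed

text \<open>The integrand is constant on products of cells, so the integral is a sum over tuples of
  cells weighted by their measures. The weights enter the matrix as square roots on both sides, and
  tuples that repeat a cell vanish.\<close>

lemma minor_integral_step:
  fixes m :: nat and S :: "'i \<Rightarrow> 'i \<Rightarrow> complex"
  assumes J: "finite J" and D: "D \<in> bounded_borel"
    and cell: "\<And>x. x \<in> D \<Longrightarrow> cell x \<in> J" "\<And>i. i \<in> J \<Longrightarrow> {x\<in>D. cell x = i} \<in> sets borel"
  defines "r \<equiv> \<lambda>i. complex_of_real (sqrt (measure M {x\<in>D. cell x = i}))"
  shows "minor_integral M (\<lambda>x y. S (cell x) (cell y)) D m =
    fact m * (\<Sum>\<beta> | \<beta> \<subseteq> J \<and> card \<beta> = m. Re (kernel_det (\<lambda>i j. S i j * (r i * r j)) \<beta>))"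
proof -
  let ?P = "\<Pi>\<^sub>M i\<in>{..<m}. M"
  let ?Q = "\<lambda>i. {x\<in>D. cell x = i}"
  let ?F = "\<lambda>i. Re (kernel_det (\<lambda>a b. S (i a) (i b)) {..<m})"
  let ?J = "{..<m} \<rightarrow>\<^sub>E J"
  have Q: "?Q i \<in> sets M" "emeasure M (?Q i) < \<infinity>" if "i \<in> J" for i
  proof -
    show "?Q i \<in> sets M" using cell(2)[OF that] sets_M by simp
    have "?Q i \<in> bounded_borel" by (rule bounded_borel_subset[OF D cell(2)[OF that]]) auto
    then show "emeasure M (?Q i) < \<infinity>" by (rule emeasure_bounded)
  qed
  have fJ: "finite ?J" using J by (intro finite_PiE) auto
  have int: "integrable ?P (\<lambda>x. \<Prod>a<m. indicator (?Q (i a)) (x a) :: real)"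
    "(\<integral>x. (\<Prod>a<m. indicator (?Q (i a)) (x a)) \<partial>?P) = (\<Prod>a<m. measure M (?Q (i a)))"
    if "i \<in> ?J" for i
  proof -
    have 1: "integrable M (indicator (?Q (i a)) :: 'a \<Rightarrow> real)" if a: "a \<in> {..<m}" for a
      using Q[of "i a"] \<open>i \<in> ?J\<close> a by (intro integrable_real_indicator) auto
    show "integrable ?P (\<lambda>x. \<Prod>a<m. indicator (?Q (i a)) (x a) :: real)"
      by (rule product_integrable_prod[OF finite_lessThan 1])
    have "(\<integral>x. (\<Prod>a<m. indicator (?Q (i a)) (x a) :: real) \<partial>?P) = (\<Prod>a<m. \<integral>x. indicator (?Q (i a)) x \<partial>M)"
      by (rule product_integral_prod[where f = "\<lambda>a. indicator (?Q (i a))", OF finite_lessThan 1])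
    also have "\<dots> = (\<Prod>a<m. measure M (?Q (i a)))"
      by simp
    finally show "(\<integral>x. (\<Prod>a<m. indicator (?Q (i a)) (x a)) \<partial>?P) = (\<Prod>a<m. measure M (?Q (i a)))" .
  qed
  have "minor_integral M (\<lambda>x y. S (cell x) (cell y)) D m =
    (\<integral>x. (\<Sum>i\<in>?J. ?F i * (\<Prod>a<m. indicator (?Q (i a)) (x a))) \<partial>?P)"
    unfolding minor_integral_def
  proof (rule Bochner_Integration.integral_cong[OF refl])
    fix x :: "nat \<Rightarrow> 'a"
    show "(\<Prod>i<m. indicator D (x i)) * Re (kernel_det (\<lambda>a b. S (cell (x a)) (cell (x b))) {..<m}) =
      (\<Sum>i\<in>?J. ?F i * (\<Prod>a<m. indicator (?Q (i a)) (x a)))"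
    proof (cases "\<forall>a<m. x a \<in> D")
      case True
      \<comment> \<open>The only tuple of cells whose product contains \<open>x\<close>; all other
        terms of the sum are 0.\<close>
      let ?i = "restrict (\<lambda>a. cell (x a)) {..<m}"
      have iJ: "?i \<in> ?J" using True cell(1) by auto
      have "(\<Sum>i\<in>?J. ?F i * (\<Prod>a<m. indicator (?Q (i a)) (x a))) =
          (\<Sum>i\<in>{?i}. ?F i * (\<Prod>a<m. indicator (?Q (i a)) (x a)))"
      proof (rule sum.mono_neutral_right[OF fJ])
        show "{?i} \<subseteq> ?J" using iJ by simp
        show "\<forall>i\<in>?J - {?i}. ?F i * (\<Prod>a<m. indicator (?Q (i a)) (x a)) = 0"
        proof
          fix i assume i: "i \<in> ?J - {?i}"
          have "\<exists>a<m. i a \<noteq> cell (x a)"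
          proof (rule ccontr)
            assume "\<not> (\<exists>a<m. i a \<noteq> cell (x a))"
            then have "i = ?i" using i by (intro extensionalityI[of i "{..<m}"]) (auto simp: PiE_def)
            then show False using i by simp
          qed
          then have "(\<Prod>a<m. indicator (?Q (i a)) (x a)) = (0::real)"
            by (intro prod_zero) (use True in \<open>force simp: indicator_def\<close>)+
          then show "?F i * (\<Prod>a<m. indicator (?Q (i a)) (x a)) = 0" by simp
        qed
      qed
      also have "\<dots> = ?F ?i" using True by simp
      also have "kernel_det (\<lambda>a b. S (?i a) (?i b)) {..<m} =
          kernel_det (\<lambda>a b. S (cell (x a)) (cell (x b))) {..<m}"
        by (rule kernel_det_cong) auto
      finally show ?thesis using True by simp
    next
      case False
      then obtain a where a: "a < m" "x a \<notin> D" by auto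
      then have 1: "(\<Prod>i<m. indicator D (x i)) = (0::real)" by (auto intro!: prod_zero bexI[of _ a])
      have 2: "(\<Prod>a<m. indicator (?Q (i a)) (x a)) = (0::real)" for i
        using a by (auto intro!: prod_zero bexI[of _ a])
      show ?thesis unfolding 1 2 by simp
    qed
  qed
  also have "\<dots> = (\<Sum>i\<in>?J. ?F i * (\<Prod>a<m. measure M (?Q (i a))))"
    using int by (subst Bochner_Integration.integral_sum) auto
  also have "\<dots> = (\<Sum>i\<in>?J. Re (kernel_det (\<lambda>a b. S (i a) (i b) * (r (i a) * r (i b))) {..<m}))"
  proof (rule sum.cong[OF refl])
    fix i
    have "(\<Prod>a<m. r (i a))\<^sup>2 = complex_of_real (\<Prod>a<m. measure M (?Q (i a)))"
      by (simp add: r_def prod_power_distrib of_real_power[symmetric] del: of_real_power)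
    then show "?F i * (\<Prod>a<m. measure M (?Q (i a))) =
      Re (kernel_det (\<lambda>a b. S (i a) (i b) * (r (i a) * r (i b))) {..<m})"
      by (simp only: kernel_det_scale[OF finite_lessThan]) (simp add: mult.commute del: of_real_prod)
  qed
  also have "\<dots> = Re (\<Sum>i\<in>?J. kernel_det (\<lambda>a b. S (i a) (i b) * (r (i a) * r (i b))) {..<m})"
    by simp
  also have "\<dots> = Re (fact m * (\<Sum>\<beta> | \<beta> \<subseteq> J \<and> card \<beta> = m. kernel_det (\<lambda>i j. S i j * (r i * r j)) \<beta>))"
    using sum_kernel_det_tuples[OF J, where k = "\<lambda>i j. S i j * (r i * r j)"] by simp
  also have "\<dots> = fact m * (\<Sum>\<beta> | \<beta> \<subseteq> J \<and> card \<beta> = m. Re (kernel_det (\<lambda>i j. S i j * (r i * r j)) \<beta>))"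
  proof -
    have "(fact m :: complex) = of_real (fact m)" by simp
    then show ?thesis by (simp only: Re_complex_of_real Re_sum) (simp del: of_real_fact)
  qed
  finally show ?thesis .
qed

text \<open>The series stops at \<open>card J\<close>, as there are no larger subsets. Summed over
  all cardinalities, the principal minors form the expansion of the determinant of the identity
  minus the weighted matrix.\<close>

lemma fredholm_series_step:
  fixes S :: "'i \<Rightarrow> 'i \<Rightarrow> complex"
  assumes J: "finite J" and D: "D \<in> bounded_borel"
    and cell: "\<And>x. x \<in> D \<Longrightarrow> cell x \<in> J" "\<And>i. i \<in> J \<Longrightarrow> {x\<in>D. cell x = i} \<in> sets borel"
  defines "r \<equiv> \<lambda>i. complex_of_real (sqrt (measure M {x\<in>D. cell x = i}))"
  shows "(\<Sum>m. (-1) ^ m / fact m * minor_integral M (\<lambda>x y. S (cell x) (cell y)) D m) =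
    Re (kernel_det (\<lambda>i j. of_bool (i = j) - S i j * (r i * r j)) J)"
proof -
  let ?M = "\<lambda>i j. S i j * (r i * r j)"
  have "(\<Sum>m. (-1) ^ m / fact m * minor_integral M (\<lambda>x y. S (cell x) (cell y)) D m) =
    (\<Sum>m. (-1) ^ m * (\<Sum>\<beta> | \<beta> \<subseteq> J \<and> card \<beta> = m. Re (kernel_det ?M \<beta>)))"
    unfolding r_def by (subst minor_integral_step[OF J D cell]) auto
  also have "\<dots> = (\<Sum>m\<le>card J. (-1) ^ m * (\<Sum>\<beta> | \<beta> \<subseteq> J \<and> card \<beta> = m. Re (kernel_det ?M \<beta>)))"
  proof (rule suminf_finite)
    fix m assume "m \<notin> {..card J}"
    then have "{\<beta>. \<beta> \<subseteq> J \<and> card \<beta> = m} = {}" using card_mono[OF J] by auto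
    then show "(-1) ^ m * (\<Sum>\<beta> | \<beta> \<subseteq> J \<and> card \<beta> = m. Re (kernel_det ?M \<beta>)) = 0"
      by (simp only: sum.empty mult_zero_right)
  qed simp
  also have "\<dots> = (\<Sum>m\<le>card J. \<Sum>\<beta>\<in>{\<beta>\<in>Pow J. card \<beta> = m}. (-1) ^ card \<beta> * Re (kernel_det ?M \<beta>))"
    unfolding sum_distrib_left by (intro sum.cong) auto
  also have "\<dots> = (\<Sum>\<beta>\<in>Pow J. (-1) ^ card \<beta> * Re (kernel_det ?M \<beta>))"
    by (rule sum.group) (use J in \<open>auto intro: card_mono\<close>)
  also have "\<dots> = Re (\<Sum>\<beta>\<in>Pow J. (-1) ^ card \<beta> * kernel_det ?M \<beta>)"
  proof -
    have "(-1) ^ n * Re z = Re ((-1) ^ n * z)" for n :: nat and z by (cases "even n") auto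
    then show ?thesis by (simp only: Re_sum)
  qed
  also have "\<dots> = Re (kernel_det (\<lambda>i j. of_bool (i = j) - ?M i j) J)"
    by (simp add: kernel_det_id_minus[OF J])
  finally show ?thesis .
qed

end

section \<open>Discretization\<close>

text \<open>An atom of the finite algebra generated by \<G>, encoded by the members that contain the
  point. A larger family refines the partition, and the coarse label is the fine one intersected
  with the smaller family.\<close>

definition cell :: "'a set set \<Rightarrow> 'a \<Rightarrow> 'a set set" where
  "cell \<G> x = {G \<in> \<G>. x \<in> G}"

lemma cell_in_Pow: "cell \<G> x \<in> Pow \<G>"
  by (auto simp: cell_def)

lemma cell_subfamily: "\<H> \<subseteq> \<G> \<Longrightarrow> cell \<G> x \<inter> \<H> = cell \<H> x"
  by (auto simp: cell_def)

lemma measurable_cell: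
  assumes "finite \<G>" "\<G> \<subseteq> sets N" "space N = UNIV"
  shows "cell \<G> \<in> measurable N (count_space (Pow \<G>))"
proof (subst measurable_count_space_eq2)
  show "finite (Pow \<G>)" using assms by simp
  show "cell \<G> \<in> space N \<rightarrow> Pow \<G> \<and> (\<forall>i\<in>Pow \<G>. cell \<G> -` {i} \<inter> space N \<in> sets N)"
  proof (intro conjI ballI)
    show "cell \<G> \<in> space N \<rightarrow> Pow \<G>" by (rule funcsetI) (rule cell_in_Pow)
    fix i assume i: "i \<in> Pow \<G>"
    have "{x\<in>space N. \<forall>G\<in>\<G>. x \<in> G \<longleftrightarrow> G \<in> i} \<in> sets N"
    proof (rule sets.sets_Collect_finite_All[OF _ assms(1)])
      fix G assume "G \<in> \<G>"
      then have [measurable]: "G \<in> sets N" using assms by blast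
      show "{x\<in>space N. x \<in> G \<longleftrightarrow> G \<in> i} \<in> sets N" by measurable
    qed
    also have "{x\<in>space N. \<forall>G\<in>\<G>. x \<in> G \<longleftrightarrow> G \<in> i} = cell \<G> -` {i} \<inter> space N"
    proof -
      have "(\<forall>G\<in>\<G>. x \<in> G \<longleftrightarrow> G \<in> i) \<longleftrightarrow> cell \<G> x = i" for x
        unfolding cell_def set_eq_iff using i by blast
      then show ?thesis by blast
    qed
    finally show "cell \<G> -` {i} \<inter> space N \<in> sets N" .
  qed
qed

context diffuse_space
begin

lemma measurable_cell_M:
  "finite \<G> \<Longrightarrow> \<G> \<subseteq> sets borel \<Longrightarrow> cell \<G> \<in> measurable M (count_space (Pow \<G>))"
  by (rule measurable_cell) (simp_all add: sets_M)

lemma measurable_cell_pair: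
  fixes s :: "'a set set \<Rightarrow> 'a set set \<Rightarrow> 'c::topological_space"
  assumes "finite \<G>" "\<G> \<subseteq> sets borel"
  shows "(\<lambda>p. s (cell \<G> (fst p)) (cell \<G> (snd p))) \<in> borel_measurable (M \<Otimes>\<^sub>M M)"
proof -
  have c: "countable (Pow \<G>)" using assms(1) by (simp add: countable_finite)
  note [measurable] = measurable_cell_M[OF assms]
  have "(\<lambda>p. s i (cell \<G> (snd p))) \<in> borel_measurable (M \<Otimes>\<^sub>M M)" for i
    by (rule measurable_compose_countable'[of "Pow \<G>" "\<lambda>j p. s i j", OF _ _ c]) measurable
  then show ?thesis
    by (rule measurable_compose_countable'[of "Pow \<G>" "\<lambda>i p. s i (cell \<G> (snd p))", OF _ _ c]) measurable
qed

text \<open>Approximation in the mean on \<Omega> \<times> \<Omega> by functions of the two labels.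
  As a property of a single \<open>g\<close> it can be proved by induction over measurable sets and
  integrable functions.\<close>

definition cell_approx :: "'a set \<Rightarrow> ('a \<times> 'a \<Rightarrow> complex) \<Rightarrow> bool" where
  "cell_approx \<Omega> g \<longleftrightarrow> (\<forall>\<epsilon>>0. \<exists>\<G> s. finite \<G> \<and> \<G> \<subseteq> sets borel \<and>
     (\<integral>\<^sup>+p. ennreal (norm (g p - s (cell \<G> (fst p)) (cell \<G> (snd p)))) * indicator (\<Omega> \<times> \<Omega>) p \<partial>(M \<Otimes>\<^sub>M M))
       \<le> ennreal \<epsilon>)"

text \<open>Closure under limits in the mean, with \<epsilon> split in half. Countable unions and
  general integrable functions are reached through it.\<close>

lemma cell_approx_close:
  assumes g: "g \<in> borel_measurable (M \<Otimes>\<^sub>M M)" and \<Omega>: "\<Omega> \<in> sets borel"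
    and close: "\<And>\<epsilon>. 0 < \<epsilon> \<Longrightarrow> \<exists>h. h \<in> borel_measurable (M \<Otimes>\<^sub>M M) \<and> cell_approx \<Omega> h \<and>
      (\<integral>\<^sup>+p. ennreal (norm (g p - h p)) * indicator (\<Omega> \<times> \<Omega>) p \<partial>(M \<Otimes>\<^sub>M M)) \<le> ennreal \<epsilon>"
  shows "cell_approx \<Omega> g"
  unfolding cell_approx_def
proof (intro allI impI)
  fix \<epsilon> :: real assume "0 < \<epsilon>"
  then have e: "0 < \<epsilon> / 2" by simp
  obtain h where h [measurable]: "h \<in> borel_measurable (M \<Otimes>\<^sub>M M)" and ah: "cell_approx \<Omega> h"
    and gh: "(\<integral>\<^sup>+p. ennreal (norm (g p - h p)) * indicator (\<Omega> \<times> \<Omega>) p \<partial>(M \<Otimes>\<^sub>M M)) \<le> ennreal (\<epsilon> / 2)"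
    using close[OF e] by blast
  obtain \<G> s where G: "finite \<G>" "\<G> \<subseteq> sets borel" and s:
    "(\<integral>\<^sup>+p. ennreal (norm (h p - s (cell \<G> (fst p)) (cell \<G> (snd p)))) * indicator (\<Omega> \<times> \<Omega>) p \<partial>(M \<Otimes>\<^sub>M M))
       \<le> ennreal (\<epsilon> / 2)"
    using ah e unfolding cell_approx_def by blast
  note [measurable] = measurable_cell_pair[OF G, of s] g
  have [measurable]: "\<Omega> \<in> sets M" using \<Omega> sets_M by simp
  have "(\<integral>\<^sup>+p. ennreal (norm (g p - s (cell \<G> (fst p)) (cell \<G> (snd p)))) * indicator (\<Omega> \<times> \<Omega>) p \<partial>(M \<Otimes>\<^sub>M M))
    \<le> (\<integral>\<^sup>+p. ennreal (norm (g p - h p)) * indicator (\<Omega> \<times> \<Omega>) p +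
        ennreal (norm (h p - s (cell \<G> (fst p)) (cell \<G> (snd p)))) * indicator (\<Omega> \<times> \<Omega>) p \<partial>(M \<Otimes>\<^sub>M M))"
  proof (rule nn_integral_mono)
    fix p
    have "norm (g p - s (cell \<G> (fst p)) (cell \<G> (snd p))) \<le>
        norm (g p - h p) + norm (h p - s (cell \<G> (fst p)) (cell \<G> (snd p)))"
      using norm_triangle_ineq[of "g p - h p" "h p - s (cell \<G> (fst p)) (cell \<G> (snd p))"] by simp
    then have "ennreal (norm (g p - s (cell \<G> (fst p)) (cell \<G> (snd p)))) \<le>
        ennreal (norm (g p - h p)) + ennreal (norm (h p - s (cell \<G> (fst p)) (cell \<G> (snd p))))"
      by (simp add: ennreal_plus[symmetric] ennreal_leI del: ennreal_plus)
    then show "ennreal (norm (g p - s (cell \<G> (fst p)) (cell \<G> (snd p)))) * indicator (\<Omega> \<times> \<Omega>) p \<le>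
        ennreal (norm (g p - h p)) * indicator (\<Omega> \<times> \<Omega>) p +
        ennreal (norm (h p - s (cell \<G> (fst p)) (cell \<G> (snd p)))) * indicator (\<Omega> \<times> \<Omega>) p"
      by (simp add: indicator_def)
  qed
  also have "\<dots> = (\<integral>\<^sup>+p. ennreal (norm (g p - h p)) * indicator (\<Omega> \<times> \<Omega>) p \<partial>(M \<Otimes>\<^sub>M M)) +
      (\<integral>\<^sup>+p. ennreal (norm (h p - s (cell \<G> (fst p)) (cell \<G> (snd p)))) * indicator (\<Omega> \<times> \<Omega>) p \<partial>(M \<Otimes>\<^sub>M M))"
    by (rule nn_integral_add) measurable
  also have "\<dots> \<le> ennreal (\<epsilon> / 2) + ennreal (\<epsilon> / 2)" by (rule add_mono[OF gh s])
  also have "\<dots> = ennreal \<epsilon>" using e by (simp add: ennreal_plus[symmetric] del: ennreal_plus)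
  finally show "\<exists>\<G> s. finite \<G> \<and> \<G> \<subseteq> sets borel \<and>
     (\<integral>\<^sup>+p. ennreal (norm (g p - s (cell \<G> (fst p)) (cell \<G> (snd p)))) * indicator (\<Omega> \<times> \<Omega>) p \<partial>(M \<Otimes>\<^sub>M M))
       \<le> ennreal \<epsilon>" using G by blast
qed

text \<open>The union of the two families refines both, and each approximant reads its own label off
  the common one by intersection.\<close>

lemma cell_approx_add:
  assumes [measurable]: "g \<in> borel_measurable (M \<Otimes>\<^sub>M M)" "h \<in> borel_measurable (M \<Otimes>\<^sub>M M)"
    and \<Omega>: "\<Omega> \<in> sets borel"
    and ag: "cell_approx \<Omega> g" and ah: "cell_approx \<Omega> h"
  shows "cell_approx \<Omega> (\<lambda>p. g p + h p)"
  unfolding cell_approx_def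
proof (intro allI impI)
  fix \<epsilon> :: real assume "0 < \<epsilon>"
  then have e: "0 < \<epsilon> / 2" by simp
  obtain \<G> s where G: "finite \<G>" "\<G> \<subseteq> sets borel" and s:
    "(\<integral>\<^sup>+p. ennreal (norm (g p - s (cell \<G> (fst p)) (cell \<G> (snd p)))) * indicator (\<Omega> \<times> \<Omega>) p \<partial>(M \<Otimes>\<^sub>M M))
       \<le> ennreal (\<epsilon> / 2)"
    using ag e unfolding cell_approx_def by blast
  obtain \<H> t where H: "finite \<H>" "\<H> \<subseteq> sets borel" and t:
    "(\<integral>\<^sup>+p. ennreal (norm (h p - t (cell \<H> (fst p)) (cell \<H> (snd p)))) * indicator (\<Omega> \<times> \<Omega>) p \<partial>(M \<Otimes>\<^sub>M M))
       \<le> ennreal (\<epsilon> / 2)"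
    using ah e unfolding cell_approx_def by blast
  note [measurable] = measurable_cell_pair[OF G, of s] measurable_cell_pair[OF H, of t]
  have [measurable]: "\<Omega> \<in> sets M" using \<Omega> sets_M by simp
  let ?u = "\<lambda>i j. s (i \<inter> \<G>) (j \<inter> \<G>) + t (i \<inter> \<H>) (j \<inter> \<H>)"
  have "(\<integral>\<^sup>+p. ennreal (norm (g p + h p - ?u (cell (\<G> \<union> \<H>) (fst p)) (cell (\<G> \<union> \<H>) (snd p)))) * indicator (\<Omega> \<times> \<Omega>) p \<partial>(M \<Otimes>\<^sub>M M))
    \<le> (\<integral>\<^sup>+p. ennreal (norm (g p - s (cell \<G> (fst p)) (cell \<G> (snd p)))) * indicator (\<Omega> \<times> \<Omega>) p +
        ennreal (norm (h p - t (cell \<H> (fst p)) (cell \<H> (snd p)))) * indicator (\<Omega> \<times> \<Omega>) p \<partial>(M \<Otimes>\<^sub>M M))"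
    by (intro nn_integral_mono)
      (auto simp: cell_subfamily indicator_def ennreal_plus[symmetric] simp del: ennreal_plus
        intro!: ennreal_leI norm_diff_triangle_ineq)
  also have "\<dots> = (\<integral>\<^sup>+p. ennreal (norm (g p - s (cell \<G> (fst p)) (cell \<G> (snd p)))) * indicator (\<Omega> \<times> \<Omega>) p \<partial>(M \<Otimes>\<^sub>M M)) +
      (\<integral>\<^sup>+p. ennreal (norm (h p - t (cell \<H> (fst p)) (cell \<H> (snd p)))) * indicator (\<Omega> \<times> \<Omega>) p \<partial>(M \<Otimes>\<^sub>M M))"
    by (rule nn_integral_add) measurable
  also have "\<dots> \<le> ennreal (\<epsilon> / 2) + ennreal (\<epsilon> / 2)" by (rule add_mono[OF s t])
  also have "\<dots> = ennreal \<epsilon>" using e by (simp add: ennreal_plus[symmetric] del: ennreal_plus)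
  finally show "\<exists>\<G> s. finite \<G> \<and> \<G> \<subseteq> sets borel \<and>
     (\<integral>\<^sup>+p. ennreal (norm (g p + h p - s (cell \<G> (fst p)) (cell \<G> (snd p)))) * indicator (\<Omega> \<times> \<Omega>) p \<partial>(M \<Otimes>\<^sub>M M))
       \<le> ennreal \<epsilon>" using G H by (intro exI[of _ "\<G> \<union> \<H>"] exI[of _ ?u]) auto
qed

lemma cell_approx_cmult:
  assumes g [measurable]: "g \<in> borel_measurable (M \<Otimes>\<^sub>M M)" and \<Omega>: "\<Omega> \<in> sets borel" and ag: "cell_approx \<Omega> g"
  shows "cell_approx \<Omega> (\<lambda>p. c * g p)"
  unfolding cell_approx_def
proof (intro allI impI)
  fix \<epsilon> :: real assume "0 < \<epsilon>"
  \<comment> \<open>The summand 1 includes the case \<open>c = 0\<close>.\<close>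
  then have e: "0 < \<epsilon> / (norm c + 1)" by (simp add: add_nonneg_pos)
  obtain \<G> s where G: "finite \<G>" "\<G> \<subseteq> sets borel" and s:
    "(\<integral>\<^sup>+p. ennreal (norm (g p - s (cell \<G> (fst p)) (cell \<G> (snd p)))) * indicator (\<Omega> \<times> \<Omega>) p \<partial>(M \<Otimes>\<^sub>M M))
       \<le> ennreal (\<epsilon> / (norm c + 1))"
    using ag e unfolding cell_approx_def by blast
  note [measurable] = measurable_cell_pair[OF G, of s]
  have [measurable]: "\<Omega> \<in> sets M" using \<Omega> sets_M by simp
  have "(\<integral>\<^sup>+p. ennreal (norm (c * g p - c * s (cell \<G> (fst p)) (cell \<G> (snd p)))) * indicator (\<Omega> \<times> \<Omega>) p \<partial>(M \<Otimes>\<^sub>M M))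
    = ennreal (norm c) * (\<integral>\<^sup>+p. ennreal (norm (g p - s (cell \<G> (fst p)) (cell \<G> (snd p)))) * indicator (\<Omega> \<times> \<Omega>) p \<partial>(M \<Otimes>\<^sub>M M))"
    by (subst nn_integral_cmult[symmetric], measurable)
      (simp add: right_diff_distrib[symmetric] norm_mult ennreal_mult mult.assoc)
  also have "\<dots> \<le> ennreal (norm c) * ennreal (\<epsilon> / (norm c + 1))" by (rule mult_left_mono[OF s]) simp
  also have "\<dots> = ennreal (norm c * (\<epsilon> / (norm c + 1)))"
    using e by (intro ennreal_mult[symmetric]) auto
  also have "\<dots> \<le> ennreal \<epsilon>"
  proof (rule ennreal_leI)
    have "0 < norm c + 1" by (simp add: add_nonneg_pos)
    then show "norm c * (\<epsilon> / (norm c + 1)) \<le> \<epsilon>"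
      using \<open>0 < \<epsilon>\<close> by (simp add: field_simps)
  qed
  finally show "\<exists>\<G> s. finite \<G> \<and> \<G> \<subseteq> sets borel \<and>
     (\<integral>\<^sup>+p. ennreal (norm (c * g p - s (cell \<G> (fst p)) (cell \<G> (snd p)))) * indicator (\<Omega> \<times> \<Omega>) p \<partial>(M \<Otimes>\<^sub>M M))
       \<le> ennreal \<epsilon>" using G by (intro exI[of _ \<G>] exI[of _ "\<lambda>i j. c * s i j"]) auto
qed

lemma cell_approx_exact:
  assumes "finite \<G>" "\<G> \<subseteq> sets borel" "\<And>p. g p = s (cell \<G> (fst p)) (cell \<G> (snd p))"
  shows "cell_approx \<Omega> g"
  unfolding cell_approx_def using assms by (intro allI impI exI[of _ \<G>] exI[of _ s]) simp

text \<open>Dynkin argument from rectangles, whose indicators are exact functions of the labels. For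
  a disjoint union the tails decrease to the empty set, and their measure tends to 0 because
  \<Omega> \<times> \<Omega> has finite measure.\<close>

lemma cell_approx_indicator:
  assumes \<Omega>: "\<Omega> \<in> bounded_borel" and A: "A \<in> sets (M \<Otimes>\<^sub>M M)"
  shows "cell_approx \<Omega> (indicator A)"
proof -
  let ?G = "{a \<times> b | a b. a \<in> sets M \<and> b \<in> sets M}"
  have \<Omega>b: "\<Omega> \<in> sets borel" by (rule bounded_borelD[OF \<Omega>])
  have [measurable]: "\<Omega> \<in> sets M" using \<Omega>b sets_M by simp
  have G: "?G \<subseteq> Pow (space M \<times> space M)" by auto
  have sp: "sets (M \<Otimes>\<^sub>M M) = sigma_sets (space M \<times> space M) ?G" by (rule sets_pair_measure)
  have fin: "emeasure (M \<Otimes>\<^sub>M M) (\<Omega> \<times> \<Omega>) < \<infinity>"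
    using emeasure_bounded[OF \<Omega>] by (simp add: emeasure_pair_measure_Times ennreal_mult_less_top)
  have "A \<in> sigma_sets (space M \<times> space M) ?G" using A sp by simp
  with Int_stable_pair_measure_generator[of M M] G show ?thesis
  proof (induction rule: sigma_sets_induct_disjoint)
    case (basic A)
    then obtain a b where ab: "A = a \<times> b" "a \<in> sets borel" "b \<in> sets borel" using sets_M by auto
    have "indicator A p = (if a \<in> cell {a, b} (fst p) \<and> b \<in> cell {a, b} (snd p) then 1 else (0::complex))" for p
      by (cases p) (auto simp: ab(1) cell_def indicator_def)
    then show ?case
      using ab(2,3) by (intro cell_approx_exact[of "{a, b}" _ "\<lambda>i j. if a \<in> i \<and> b \<in> j then 1 else 0"]) auto
  next
    case empty
    then show ?case by (intro cell_approx_exact[of "{}" _ "\<lambda>_ _. 0"]) auto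
  next
    case (compl A)
    have [measurable]: "A \<in> sets (M \<Otimes>\<^sub>M M)" using compl(1) sp by simp
    have "cell_approx \<Omega> (\<lambda>p. 1 + (-1) * indicator A p)"
      using compl(2) \<Omega>b
      by (intro cell_approx_add cell_approx_cmult cell_approx_exact[of "{}" "\<lambda>_. 1" "\<lambda>_ _. 1"]) auto
    also have "(\<lambda>p. 1 + (-1) * indicator A p) = (indicator (space M \<times> space M - A) :: _ \<Rightarrow> complex)"
      by (auto simp: indicator_def)
    finally show ?case .
  next
    case (union A)
    have A [measurable]: "A i \<in> sets (M \<Otimes>\<^sub>M M)" for i using union(2) sp by auto
    let ?S = "\<lambda>n p. \<Sum>i<n. indicator (A i) p :: complex"
    have S: "cell_approx \<Omega> (?S n)" for n
    proof (induction n)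
      case 0
      then show ?case by (intro cell_approx_exact[of "{}" _ "\<lambda>_ _. 0"]) auto
    next
      case (Suc n)
      have "cell_approx \<Omega> (\<lambda>p. ?S n p + indicator (A n) p)"
        using Suc union(3) \<Omega>b by (intro cell_approx_add) auto
      then show ?case by simp
    qed
    show ?case
    proof (rule cell_approx_close[OF _ \<Omega>b])
      fix \<epsilon> :: real assume e: "0 < \<epsilon>"
      let ?R = "\<lambda>n. (\<Union>i\<in>{n..}. A i) \<inter> (\<Omega> \<times> \<Omega>)"
      have Rm: "?R n \<in> sets (M \<Otimes>\<^sub>M M)" for n by measurable
      have "(\<lambda>n. emeasure (M \<Otimes>\<^sub>M M) (?R n)) \<longlonglongrightarrow> emeasure (M \<Otimes>\<^sub>M M) (\<Inter>n. ?R n)"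
      proof (rule Lim_emeasure_decseq)
        show "range ?R \<subseteq> sets (M \<Otimes>\<^sub>M M)" using Rm by auto
        show "decseq ?R" unfolding decseq_def by (intro allI impI Int_mono UN_mono) auto
        show "emeasure (M \<Otimes>\<^sub>M M) (?R n) \<noteq> \<infinity>" for n
          using fin emeasure_mono[of "?R n" "\<Omega> \<times> \<Omega>" "M \<Otimes>\<^sub>M M"] by (auto simp: top_unique)
      qed
      moreover have "(\<Inter>n. ?R n) = {}"
      proof -
        have False if p: "\<And>n. p \<in> ?R n" for p
        proof -
          from p[of 0] obtain i where i: "p \<in> A i" by auto
          from p[of "Suc i"] obtain j where "j \<ge> Suc i" "p \<in> A j" by auto
          moreover from this have "A i \<inter> A j = {}"
            using union(1) by (intro disjoint_family_onD) auto
          ultimately show False using i by blast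
        qed
        then show ?thesis by blast
      qed
      ultimately have "(\<lambda>n. emeasure (M \<Otimes>\<^sub>M M) (?R n)) \<longlonglongrightarrow> 0" by simp
      then have "eventually (\<lambda>n. emeasure (M \<Otimes>\<^sub>M M) (?R n) < ennreal \<epsilon>) sequentially"
        using e by (intro order_tendstoD) auto
      then obtain n where n: "emeasure (M \<Otimes>\<^sub>M M) (?R n) < ennreal \<epsilon>"
        by (auto simp: eventually_sequentially)
      have d: "indicator (\<Union>i. A i) p - ?S n p = (indicator (\<Union>i\<in>{n..}. A i) p :: complex)" for p
      proof -
        have "?S n p = indicator (\<Union>i<n. A i) p"
          using union(1) by (subst indicator_UN_disjoint) (auto simp: disjoint_family_on_def)
        moreover have "(\<Union>i. A i) = (\<Union>i<n. A i) \<union> (\<Union>i\<in>{n..}. A i)"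
        proof -
          have "UNIV = {..<n} \<union> {n..}" by auto
          then show ?thesis by (metis UN_Un)
        qed
        moreover have "(\<Union>i<n. A i) \<inter> (\<Union>i\<in>{n..}. A i) = {}"
        proof -
          have "A i \<inter> A j = {}" if "i < n" "n \<le> j" for i j
            using union(1) that by (intro disjoint_family_onD) auto
          then show ?thesis by blast
        qed
        ultimately show ?thesis by (auto simp: indicator_def)
      qed
      have "(\<integral>\<^sup>+p. ennreal (norm (indicator (\<Union>i. A i) p - ?S n p)) * indicator (\<Omega> \<times> \<Omega>) p \<partial>(M \<Otimes>\<^sub>M M)) =
          (\<integral>\<^sup>+p. indicator (?R n) p \<partial>(M \<Otimes>\<^sub>M M))"
        unfolding d by (intro nn_integral_cong) (auto simp: indicator_def)
      also have "\<dots> = emeasure (M \<Otimes>\<^sub>M M) (?R n)" by (rule nn_integral_indicator[OF Rm])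
      also have "\<dots> \<le> ennreal \<epsilon>" using n by simp
      finally show "\<exists>h. h \<in> borel_measurable (M \<Otimes>\<^sub>M M) \<and> cell_approx \<Omega> h \<and>
          (\<integral>\<^sup>+p. ennreal (norm (indicator (\<Union>i. A i) p - h p)) * indicator (\<Omega> \<times> \<Omega>) p \<partial>(M \<Otimes>\<^sub>M M)) \<le> ennreal \<epsilon>"
        using S by (intro exI[of _ "?S n"] conjI) auto
    qed measurable
  qed
qed

lemma cell_approx_integrable:
  assumes \<Omega>: "\<Omega> \<in> bounded_borel" and g: "integrable (M \<Otimes>\<^sub>M M) g"
  shows "cell_approx \<Omega> g"
  using g
proof (induction rule: integrable_induct)
  case (base A c)
  have "cell_approx \<Omega> (\<lambda>p. c * indicator A p)"
    using cell_approx_indicator[OF \<Omega> base(1)] base(1) bounded_borelD[OF \<Omega>] by (intro cell_approx_cmult) auto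
  also have "(\<lambda>p. c * indicator A p) = (\<lambda>p. indicator A p *\<^sub>R c)" by (auto simp: indicator_def)
  finally show ?case .
next
  case (add f g)
  then show ?case using bounded_borelD[OF \<Omega>] by (intro cell_approx_add) auto
next
  case (lim f s)
  have fm [measurable]: "f \<in> borel_measurable (M \<Otimes>\<^sub>M M)" "\<And>i. s i \<in> borel_measurable (M \<Otimes>\<^sub>M M)"
    using lim by auto
  have [measurable]: "\<Omega> \<in> sets M" using bounded_borelD[OF \<Omega>] sets_M by simp
  have "(\<lambda>i. \<integral>\<^sup>+p. ennreal (norm (f p - s i p)) \<partial>(M \<Otimes>\<^sub>M M)) \<longlonglongrightarrow> 0"
  proof (rule nn_integral_dominated_convergence_norm[where w = "\<lambda>p. 2 * norm (f p)"])
    show "(\<integral>\<^sup>+p. ennreal (2 * norm (f p)) \<partial>(M \<Otimes>\<^sub>M M)) < \<infinity>"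
    proof -
      have "(\<integral>\<^sup>+p. ennreal (norm (2 * norm (f p))) \<partial>(M \<Otimes>\<^sub>M M)) < \<infinity>"
        using integrable_mult_right[OF integrable_norm[OF lim(4)], of 2] unfolding integrable_iff_bounded by blast
      then show ?thesis by simp
    qed
  qed (use lim in auto)
  then have conv: "(\<lambda>i. \<integral>\<^sup>+p. ennreal (norm (f p - s i p)) \<partial>(M \<Otimes>\<^sub>M M)) \<longlonglongrightarrow> 0" .
  show ?case
  proof (rule cell_approx_close[OF fm(1) bounded_borelD[OF \<Omega>]])
    fix \<epsilon> :: real assume "0 < \<epsilon>"
    then have "eventually (\<lambda>i. (\<integral>\<^sup>+p. ennreal (norm (f p - s i p)) \<partial>(M \<Otimes>\<^sub>M M)) < ennreal \<epsilon>) sequentially"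
      using conv by (intro order_tendstoD) auto
    then obtain i where i: "(\<integral>\<^sup>+p. ennreal (norm (f p - s i p)) \<partial>(M \<Otimes>\<^sub>M M)) < ennreal \<epsilon>"
      by (auto simp: eventually_sequentially)
    have "(\<integral>\<^sup>+p. ennreal (norm (f p - s i p)) * indicator (\<Omega> \<times> \<Omega>) p \<partial>(M \<Otimes>\<^sub>M M)) \<le>
      (\<integral>\<^sup>+p. ennreal (norm (f p - s i p)) \<partial>(M \<Otimes>\<^sub>M M))"
      by (intro nn_integral_mono) (auto simp: indicator_def)
    also have "\<dots> \<le> ennreal \<epsilon>" using i by simp
    finally show "\<exists>h. h \<in> borel_measurable (M \<Otimes>\<^sub>M M) \<and> cell_approx \<Omega> h \<and>
        (\<integral>\<^sup>+p. ennreal (norm (f p - h p)) * indicator (\<Omega> \<times> \<Omega>) p \<partial>(M \<Otimes>\<^sub>M M)) \<le> ennreal \<epsilon>"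
      using lim(5) fm(2) by (intro exI[of _ "s i"] conjI)
  qed
qed

text \<open>Points are null, so each has a ball of small measure within \<Omega>. Countably many
  open sets of small measure cover the space, and finitely many of them leave out less than \<delta>
  of \<Omega>. A cell then lies in one of these or in the remainder, also after any
  refinement.\<close>

lemma small_cells:
  assumes \<Omega>: "\<Omega> \<in> bounded_borel" and \<delta>: "0 < \<delta>"
  obtains \<H> where "finite \<H>" "\<H> \<subseteq> sets borel"
    "\<And>\<G> i. \<H> \<subseteq> \<G> \<Longrightarrow> measure M {x\<in>\<Omega>. cell \<G> x = i} \<le> \<delta>"
proof -
  have \<Omega>M [measurable]: "\<Omega> \<in> sets M" using bounded_borelD[OF \<Omega>] sets_M by simp
  have fin: "emeasure M A \<noteq> \<infinity>" if "A \<subseteq> \<Omega>" for A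
    using emeasure_bounded[OF \<Omega>] emeasure_mono[OF that \<Omega>M] by (auto simp: top_unique)
  have mono: "measure M A \<le> measure M B" if "A \<subseteq> B" "B \<subseteq> \<Omega>" "B \<in> sets M" for A B
  proof -
    have "emeasure M A \<le> emeasure M B" using that by (intro emeasure_mono)
    then show ?thesis using fin[OF that(2)] by (simp add: measure_def enn2real_mono less_top)
  qed
  let ?\<F> = "{U::'a set. open U \<and> measure M (U \<inter> \<Omega>) \<le> \<delta>}"
  have ex: "\<exists>U\<in>?\<F>. x \<in> U" for x :: 'a
  proof -
    let ?B = "\<lambda>n. ball x (1 / Suc n) \<inter> \<Omega>"
    have B [measurable]: "ball x r \<in> sets M" for r using sets_M by simp
    have "(\<lambda>n. measure M (?B n)) \<longlonglongrightarrow> measure M (\<Inter>n. ?B n)"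
    proof (rule Lim_measure_decseq)
      show "range ?B \<subseteq> sets M" by auto
      show "decseq ?B"
        unfolding decseq_def by (intro allI impI Int_mono subset_ball frac_le) auto
      show "emeasure M (?B n) \<noteq> \<infinity>" for n by (rule fin) auto
    qed
    moreover have "measure M (\<Inter>n. ?B n) = 0"
    proof -
      have "(\<Inter>n. ?B n) \<subseteq> {x}"
      proof
        fix y assume y: "y \<in> (\<Inter>n. ?B n)"
        show "y \<in> {x}"
        proof (rule ccontr)
          assume "y \<notin> {x}"
          then have "0 < dist x y" by simp
          then obtain n where "1 / Suc n < dist x y" using nat_approx_posE by blast
          then show False using y by (auto dest!: spec[of _ n] simp: not_less[symmetric])
        qed
      qed
      then have "emeasure M (\<Inter>n. ?B n) \<le> emeasure M {x}" using sets_M by (intro emeasure_mono) auto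
      also have "\<dots> = 0" using diffuse_M by (simp add: diffuse_def)
      finally show ?thesis by (simp add: measure_def)
    qed
    ultimately have "eventually (\<lambda>n. measure M (?B n) < \<delta>) sequentially"
      using \<delta> by (intro order_tendstoD) auto
    then obtain n where "measure M (?B n) < \<delta>" by (auto simp: eventually_sequentially)
    then show ?thesis by (intro bexI[of _ "ball x (1 / Suc n)"]) auto
  qed
  then have un: "\<Union>?\<F> = UNIV" by blast
  obtain \<F>' where F: "\<F>' \<subseteq> ?\<F>" "countable \<F>'" "\<Union>\<F>' = \<Union>?\<F>"
    by (rule Lindelof[of ?\<F>]) auto
  have ne: "\<F>' \<noteq> {}" using F un by auto
  let ?U = "from_nat_into \<F>'"
  have U: "open (?U n)" "measure M (?U n \<inter> \<Omega>) \<le> \<delta>" for n using from_nat_into[OF ne, of n] F by auto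
  have Un: "(\<Union>n. ?U n) = UNIV" using F un ne by (simp add: range_from_nat_into)
  let ?R = "\<lambda>n. \<Omega> - (\<Union>i<n. ?U i)"
  have Um [measurable]: "?U n \<in> sets M" for n using U(1) sets_M by simp
  have "(\<lambda>n. measure M (?R n)) \<longlonglongrightarrow> measure M (\<Inter>n. ?R n)"
  proof (rule Lim_measure_decseq)
    show "range ?R \<subseteq> sets M" by auto
    show "decseq ?R" by (force simp: decseq_def)
    show "emeasure M (?R n) \<noteq> \<infinity>" for n by (rule fin) auto
  qed
  moreover have "(\<Inter>n. ?R n) = {}"
  proof -
    have False if p: "\<And>n. x \<in> ?R n" for x
    proof -
      obtain i where "x \<in> ?U i" using Un by blast
      then show False using p[of "Suc i"] by auto
    qed
    then show ?thesis by blast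
  qed
  ultimately have "(\<lambda>n. measure M (?R n)) \<longlonglongrightarrow> 0" by (simp only: measure_empty)
  then have "eventually (\<lambda>n. measure M (?R n) < \<delta>) sequentially"
    using \<delta> by (intro order_tendstoD) auto
  then obtain n where n: "measure M (?R n) < \<delta>" by (auto simp: eventually_sequentially)
  show thesis
  proof
    show "finite (?U ` {..<n})" by simp
    show "?U ` {..<n} \<subseteq> sets borel" using U(1) by auto
    fix \<G> i assume G: "?U ` {..<n} \<subseteq> \<G>"
    show "measure M {x\<in>\<Omega>. cell \<G> x = i} \<le> \<delta>"
    proof (cases "\<exists>j<n. ?U j \<in> i")
      case True
      then obtain j where j: "?U j \<in> i" by blast
      have "measure M {x\<in>\<Omega>. cell \<G> x = i} \<le> measure M (?U j \<inter> \<Omega>)"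
        using j by (intro mono) (auto simp: cell_def)
      then show ?thesis using U(2)[of j] by simp
    next
      case False
      have "measure M {x\<in>\<Omega>. cell \<G> x = i} \<le> measure M (?R n)"
        using False G by (intro mono) (auto simp: cell_def)
      then show ?thesis using n by simp
    qed
  qed
qed

end

section \<open>Block averages and positivity of the step kernel\<close>

text \<open>The mean is as good as any constant up to a factor 2, since its distance from
  \<open>a\<close> is at most the mean distance of \<open>g\<close> from \<open>a\<close>. Block
  averages, whose quadratic form is known, can thus replace the unspecified values of an
  approximation.\<close>

lemma nn_integral_mean_deviation_le:
  fixes g :: "'a \<Rightarrow> complex"
  assumes Q: "Q \<in> sets N" "emeasure N Q < \<infinity>" and g: "set_integrable N Q g"
  shows "(\<integral>\<^sup>+x. ennreal (norm (g x - (LINT y:Q|N. g y) / measure N Q)) * indicator Q x \<partial>N) \<le>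
    2 * (\<integral>\<^sup>+x. ennreal (norm (g x - a)) * indicator Q x \<partial>N)"
proof -
  let ?avg = "(LINT y:Q|N. g y) / measure N Q"
  have c: "set_integrable N Q (\<lambda>_. a)"
    using Q by (simp add: set_integrable_def less_top)
  have ga: "set_integrable N Q (\<lambda>x. g x - a)" by (rule set_integral_diff(1)[OF g c])
  have [measurable]: "(\<lambda>x. indicator Q x *\<^sub>R g x) \<in> borel_measurable N"
    using g unfolding set_integrable_def by auto
  have m: "(\<lambda>x. ennreal (norm (g x - b)) * indicator Q x) \<in> borel_measurable N" for b
  proof -
    have "(\<lambda>x. ennreal (norm (indicator Q x *\<^sub>R g x - b)) * indicator Q x) \<in> borel_measurable N"
      using Q(1) by measurable
    also have "(\<lambda>x. ennreal (norm (indicator Q x *\<^sub>R g x - b)) * indicator Q x) =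
        (\<lambda>x. ennreal (norm (g x - b)) * indicator Q x)"
      by (auto simp: indicator_def)
    finally show ?thesis .
  qed
  have eQ: "emeasure N Q = ennreal (measure N Q)" using Q by (simp add: emeasure_eq_ennreal_measure less_top)
  have I: "(\<integral>\<^sup>+x. ennreal (norm (g x - a)) * indicator Q x \<partial>N) =
      ennreal (LINT x:Q|N. norm (g x - a))"
  proof -
    have "set_integrable N Q (\<lambda>x. norm (g x - a))" by (rule set_integrable_norm[OF ga])
    then have "ennreal (LINT x:Q|N. norm (g x - a)) = (\<integral>\<^sup>+x. ennreal (indicator Q x *\<^sub>R norm (g x - a)) \<partial>N)"
      unfolding set_lebesgue_integral_def set_integrable_def
      by (intro nn_integral_eq_integral[symmetric]) auto
    also have "\<dots> = (\<integral>\<^sup>+x. ennreal (norm (g x - a)) * indicator Q x \<partial>N)"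
      by (intro nn_integral_cong) (auto simp: indicator_def)
    finally show ?thesis by simp
  qed
  have avg: "ennreal (norm (a - ?avg)) * emeasure N Q \<le> (\<integral>\<^sup>+x. ennreal (norm (g x - a)) * indicator Q x \<partial>N)"
  \<comment> \<open>On a null set the mean is a division by 0, but its value is then multiplied by
    measure 0.\<close>
  proof (cases "measure N Q = 0")
    case False
    have "(LINT x:Q|N. g x - a) = (LINT x:Q|N. g x) - measure N Q * a"
      using set_integral_diff(2)[OF g c] Q by (simp add: set_integral_const less_top scaleR_conv_of_real)
    also have "\<dots> = (?avg - a) * measure N Q" using False by (simp add: field_simps)
    finally have "norm (a - ?avg) * measure N Q = norm (LINT x:Q|N. g x - a)"
      by (simp add: norm_mult norm_minus_commute)
    also have "\<dots> \<le> (LINT x:Q|N. norm (g x - a))" by (rule set_integral_norm_bound[OF ga])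
    finally show ?thesis unfolding I eQ by (simp add: ennreal_mult[symmetric] ennreal_leI)
  qed (simp add: eQ)
  have "(\<integral>\<^sup>+x. ennreal (norm (g x - ?avg)) * indicator Q x \<partial>N) \<le>
    (\<integral>\<^sup>+x. ennreal (norm (g x - a)) * indicator Q x + ennreal (norm (a - ?avg)) * indicator Q x \<partial>N)"
  proof (rule nn_integral_mono)
    fix x
    have "norm (g x - ?avg) \<le> norm (g x - a) + norm (a - ?avg)"
      using norm_triangle_ineq[of "g x - a" "a - ?avg"] by simp
    then have "ennreal (norm (g x - ?avg)) \<le> ennreal (norm (g x - a)) + ennreal (norm (a - ?avg))"
      by (simp add: ennreal_plus[symmetric] ennreal_leI del: ennreal_plus)
    then show "ennreal (norm (g x - ?avg)) * indicator Q x \<le>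
        ennreal (norm (g x - a)) * indicator Q x + ennreal (norm (a - ?avg)) * indicator Q x"
      by (simp add: indicator_def)
  qed
  also have "\<dots> = (\<integral>\<^sup>+x. ennreal (norm (g x - a)) * indicator Q x \<partial>N) + ennreal (norm (a - ?avg)) * emeasure N Q"
    using m Q(1) by (subst nn_integral_add) (auto simp: nn_integral_cmult)
  also have "\<dots> \<le> 2 * (\<integral>\<^sup>+x. ennreal (norm (g x - a)) * indicator Q x \<partial>N)"
    using add_left_mono[OF avg] by (simp add: mult_2)
  finally show ?thesis .
qed

text \<open>The step kernel takes the block averages \<open>\<kappa> i j / (l i * l j)\<close> off the diagonal, but upper bounds
  \<open>d i\<close> of the true diagonal on it. If the cells are small this correction is absorbed by the gap
  \<open>1 - q\<close>, so that no convergence of traces has to be established.\<close>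

lemma step_kernel_positive:
  fixes \<kappa> :: "'i \<Rightarrow> 'i \<Rightarrow> complex"
  assumes J: "finite J" and pos: "positive_matrix \<kappa> J"
    and q: "\<And>v. Re (\<Sum>i\<in>J. \<Sum>j\<in>J. cnj (v i) * \<kappa> i j * v j) \<le> q * (\<Sum>i\<in>J. (cmod (v i))\<^sup>2 * l i)"
    and l: "\<And>i. 0 \<le> l i" and d: "\<And>i. i \<in> J \<Longrightarrow> cmod (\<kappa> i i) \<le> d i * (l i)\<^sup>2" "\<And>i. 0 \<le> d i"
    and dl: "\<And>i. i \<in> J \<Longrightarrow> d i * l i \<le> 1 - q" and q0: "0 \<le> q"
  defines "S \<equiv> \<lambda>i j. if i = j then complex_of_real (d i) else \<kappa> i j / complex_of_real (l i * l j)"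
    and "r \<equiv> \<lambda>i. complex_of_real (sqrt (l i))"
  shows "positive_matrix S J" and "positive_matrix (\<lambda>i j. of_bool (i = j) - S i j * (r i * r j)) J"
proof -
  have k: "\<kappa> i i = of_real (Re (\<kappa> i i))" "0 \<le> Re (\<kappa> i i)" "Re (\<kappa> i i) \<le> d i * (l i)\<^sup>2" if "i \<in> J" for i
  proof -
    have "\<kappa> i i \<in> \<real>\<^sub>\<ge>\<^sub>0" by (rule positive_matrix_diag[OF J pos that])
    then show "\<kappa> i i = of_real (Re (\<kappa> i i))" "0 \<le> Re (\<kappa> i i)"
      by (auto simp: complex_nonneg_Reals_iff complex_eq_iff)
    show "Re (\<kappa> i i) \<le> d i * (l i)\<^sup>2" using complex_Re_le_cmod[of "\<kappa> i i"] d(1)[OF that] by simp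
  qed
  have sq: "cnj z * of_real a * z = of_real ((cmod z)\<^sup>2 * a)" for z a
    using complex_norm_square[of z] by (simp add: mult_ac)
  show "positive_matrix S J"
    unfolding positive_matrix_def
  proof
    fix v :: "'i \<Rightarrow> complex"
    \<comment> \<open>Null cells do no harm: division by 0 gives 0 both for \<open>S\<close> off the
      diagonal and for the rescaled coefficients.\<close>
    let ?w = "\<lambda>i. v i / of_real (l i)"
    have "(\<Sum>i\<in>J. \<Sum>j\<in>J. cnj (v i) * S i j * v j) =
      (\<Sum>i\<in>J. \<Sum>j\<in>J. cnj (?w i) * \<kappa> i j * ?w j +
        (if i = j then of_real ((cmod (v i))\<^sup>2 * (d i - Re (\<kappa> i i) / (l i)\<^sup>2)) else 0))"
    proof (intro sum.cong refl)
      fix i j assume i: "i \<in> J"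
      show "cnj (v i) * S i j * v j = cnj (?w i) * \<kappa> i j * ?w j +
        (if i = j then of_real ((cmod (v i))\<^sup>2 * (d i - Re (\<kappa> i i) / (l i)\<^sup>2)) else 0)"
      proof (cases "i = j")
        case True
        have "cnj (?w i) * \<kappa> i i * ?w i = cnj (v i) * of_real (Re (\<kappa> i i) / (l i)\<^sup>2) * v i"
          by (subst k(1)[OF i]) (simp add: power2_eq_square)
        then show ?thesis using True unfolding sq by (simp add: S_def sq right_diff_distrib)
      qed (simp add: S_def)
    qed
    also have "\<dots> = (\<Sum>i\<in>J. \<Sum>j\<in>J. cnj (?w i) * \<kappa> i j * ?w j) +
        (\<Sum>i\<in>J. of_real ((cmod (v i))\<^sup>2 * (d i - Re (\<kappa> i i) / (l i)\<^sup>2)))"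
      using J by (simp add: sum.distrib)
    also have "\<dots> \<in> \<real>\<^sub>\<ge>\<^sub>0"
    proof (rule nonneg_Reals_add_I)
      show "(\<Sum>i\<in>J. \<Sum>j\<in>J. cnj (?w i) * \<kappa> i j * ?w j) \<in> \<real>\<^sub>\<ge>\<^sub>0"
        using pos[unfolded positive_matrix_def, rule_format, of ?w] .
      have "0 \<le> d i - Re (\<kappa> i i) / (l i)\<^sup>2" if "i \<in> J" for i
        using k(3)[OF that] d(2)[of i] by (cases "l i = 0") (auto simp: divide_le_eq)
      then have "0 \<le> (\<Sum>i\<in>J. (cmod (v i))\<^sup>2 * (d i - Re (\<kappa> i i) / (l i)\<^sup>2))"
        by (intro sum_nonneg mult_nonneg_nonneg) auto
      then show "(\<Sum>i\<in>J. complex_of_real ((cmod (v i))\<^sup>2 * (d i - Re (\<kappa> i i) / (l i)\<^sup>2))) \<in> \<real>\<^sub>\<ge>\<^sub>0"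
        unfolding of_real_sum[symmetric] by (simp only: nonneg_Reals_of_real_iff)
    qed
    finally show "(\<Sum>i\<in>J. \<Sum>j\<in>J. cnj (v i) * S i j * v j) \<in> \<real>\<^sub>\<ge>\<^sub>0" .
  qed
  show "positive_matrix (\<lambda>i j. of_bool (i = j) - S i j * (r i * r j)) J"
    unfolding positive_matrix_def
  proof
    fix v :: "'i \<Rightarrow> complex"
    let ?w = "\<lambda>i. v i / of_real (sqrt (l i))"
    let ?K = "\<Sum>i\<in>J. \<Sum>j\<in>J. cnj (?w i) * \<kappa> i j * ?w j"
    \<comment> \<open>\<open>?D\<close> gathers the identity and the altered diagonal, and the form
      in question is \<open>?D - Re ?K\<close>. Here \<open>Re ?K\<close> is at most
      \<open>q\<close> times the sum of squares, while each coefficient in \<open>?D\<close> is at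
      least \<open>q\<close> by \<open>dl\<close>.\<close>
    let ?D = "\<Sum>i\<in>J. (cmod (v i))\<^sup>2 * (1 - d i * l i + Re (\<kappa> i i) / l i)"
    have K: "?K = of_real (Re ?K)"
      using pos[unfolded positive_matrix_def, rule_format, of ?w]
      by (auto simp: complex_nonneg_Reals_iff complex_eq_iff)
    have ss: "complex_of_real (sqrt (l i)) * of_real (sqrt (l i)) = of_real (l i)" for i
      using l[of i] by (simp flip: of_real_mult)
    have "(\<Sum>i\<in>J. \<Sum>j\<in>J. cnj (v i) * (of_bool (i = j) - S i j * (r i * r j)) * v j) =
      (\<Sum>i\<in>J. \<Sum>j\<in>J. - (cnj (?w i) * \<kappa> i j * ?w j) +
        (if i = j then of_real ((cmod (v i))\<^sup>2 * (1 - d i * l i + Re (\<kappa> i i) / l i)) else 0))"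
    proof (intro sum.cong refl)
      fix i j assume i: "i \<in> J"
      show "cnj (v i) * (of_bool (i = j) - S i j * (r i * r j)) * v j = - (cnj (?w i) * \<kappa> i j * ?w j) +
        (if i = j then of_real ((cmod (v i))\<^sup>2 * (1 - d i * l i + Re (\<kappa> i i) / l i)) else 0)"
      proof (cases "i = j")
        case True
        have "cnj (?w i) * \<kappa> i i * ?w i = cnj (v i) * of_real (Re (\<kappa> i i) / l i) * v i"
          by (subst k(1)[OF i]) (simp add: ss)
        moreover have "of_bool (i = i) - S i i * (r i * r i) = of_real (1 - d i * l i)"
          by (simp add: S_def r_def ss)
        ultimately show ?thesis using True unfolding sq by (simp only: sq) (simp add: algebra_simps)
      next
        case False
        have "S i j * (r i * r j) = \<kappa> i j / (of_real (sqrt (l i)) * of_real (sqrt (l j)))"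
          using False ss[of i, symmetric] ss[of j, symmetric]
          by (simp add: S_def r_def)
        then show ?thesis using False by simp
      qed
    qed
    also have "\<dots> = - ?K + (\<Sum>i\<in>J. \<Sum>j\<in>J.
        if i = j then of_real ((cmod (v i))\<^sup>2 * (1 - d i * l i + Re (\<kappa> i i) / l i)) else 0)"
      by (simp only: sum.distrib sum_negf)
    also have "(\<Sum>i\<in>J. \<Sum>j\<in>J.
        if i = j then of_real ((cmod (v i))\<^sup>2 * (1 - d i * l i + Re (\<kappa> i i) / l i)) else 0) = complex_of_real ?D"
      unfolding of_real_sum using J by (intro sum.cong refl) (simp only: sum.delta' if_True)
    also have "- ?K + complex_of_real ?D = of_real (?D - Re ?K)"
      by (simp only: of_real_diff K[symmetric] uminus_add_conv_diff)
    also have "\<dots> \<in> \<real>\<^sub>\<ge>\<^sub>0"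
    proof -
      have "Re ?K \<le> q * (\<Sum>i\<in>J. (cmod (?w i))\<^sup>2 * l i)" by (rule q)
      also have "\<dots> \<le> q * (\<Sum>i\<in>J. (cmod (v i))\<^sup>2)"
      proof (intro mult_left_mono sum_mono q0)
        fix i
        show "(cmod (?w i))\<^sup>2 * l i \<le> (cmod (v i))\<^sup>2"
          using l[of i] by (cases "l i = 0") (auto simp: norm_divide power_divide)
      qed
      also have "\<dots> = (\<Sum>i\<in>J. (cmod (v i))\<^sup>2 * q)" by (simp add: sum_distrib_left mult.commute)
      also have "\<dots> \<le> ?D"
      proof (intro sum_mono mult_left_mono)
        fix i assume i: "i \<in> J"
        have "0 \<le> Re (\<kappa> i i) / l i" using k(2)[OF i] l[of i] by simp
        then show "q \<le> 1 - d i * l i + Re (\<kappa> i i) / l i" using dl[OF i] by simp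
      qed simp
      finally show ?thesis by (simp only: nonneg_Reals_of_real_iff diff_ge_0_iff_ge)
    qed
    finally show "(\<Sum>i\<in>J. \<Sum>j\<in>J. cnj (v i) * (of_bool (i = j) - S i j * (r i * r j)) * v j) \<in> \<real>\<^sub>\<ge>\<^sub>0" .
  qed
qed

section \<open>Bounds for the correlation kernel and the choice of the partition\<close>

context diffuse_space
begin

text \<open>Both facts are read off positive matrices of size 2, which are available for almost
  every pair; the diagonal is seen through the first of the two points.\<close>

lemma AE_kernel_bound:
  assumes k: "(\<lambda>(x, y). k x y) \<in> borel_measurable (M \<Otimes>\<^sub>M M)"
    and pos: "AE \<alpha> in config_measure M. positive_matrix k \<alpha>"
  shows "AE p in M \<Otimes>\<^sub>M M. 2 * cmod (k (fst p) (snd p)) \<le> Re (k (fst p) (fst p)) + Re (k (snd p) (snd p))"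
    and "AE y in M. k y y \<in> \<real>\<^sub>\<ge>\<^sub>0"
proof -
  let ?P = "\<lambda>y z. 2 * cmod (k y z) \<le> Re (k y y) + Re (k z z) \<and> 0 \<le> Re (k y y) \<and> Im (k y y) = 0"
  have "(\<lambda>x. (x, x)) \<in> measurable M (M \<Otimes>\<^sub>M M)" by measurable
  from measurable_compose[OF this k] have [measurable]: "(\<lambda>x. k x x) \<in> borel_measurable M" by simp
  have [measurable]: "(\<lambda>p. k (fst p) (snd p)) \<in> borel_measurable (M \<Otimes>\<^sub>M M)"
    using k by (simp add: case_prod_beta')
  have Pm: "Measurable.pred (M \<Otimes>\<^sub>M M) (\<lambda>(y, z). ?P y z)"
    unfolding case_prod_beta' by measurable
  have "AE x in (\<Pi>\<^sub>M i\<in>{..<2::nat}. M). ?P (x 0) (x 1)"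
    using positive_matrix_tuple[OF pos, of 2]
  proof eventually_elim
    fix x :: "nat \<Rightarrow> 'a" assume p: "positive_matrix (\<lambda>a b. k (x a) (x b)) {..<2}"
    show "?P (x 0) (x 1)"
      using positive_matrix_norm_le[OF finite_lessThan p, of 0 1] positive_matrix_diag[OF finite_lessThan p, of 0]
      by (auto simp: complex_nonneg_Reals_iff)
  qed
  then have AE: "AE y in M. AE z in M. ?P y z"
    by (intro AE_two_coordinates(2)[of "{..<2::nat}" 0 1, OF _ _ _ _ Pm]) auto
  have "AE p in M \<Otimes>\<^sub>M M. ?P (fst p) (snd p)"
  proof (rule pair.AE_pair_measure)
    show "{x \<in> space (M \<Otimes>\<^sub>M M). ?P (fst x) (snd x)} \<in> sets (M \<Otimes>\<^sub>M M)" by measurable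
  qed (use AE in simp)
  then show "AE p in M \<Otimes>\<^sub>M M. 2 * cmod (k (fst p) (snd p)) \<le> Re (k (fst p) (fst p)) + Re (k (snd p) (snd p))"
    by eventually_elim simp
  show "AE y in M. k y y \<in> \<real>\<^sub>\<ge>\<^sub>0"
  \<comment> \<open>A property of \<open>y\<close> alone follows from its validity for almost every
    \<open>z\<close> unless the measure is null; that case is trivial and is split off.\<close>
  proof (cases "AE z in M. False")
    case False
    have "k y y \<in> \<real>\<^sub>\<ge>\<^sub>0" if "AE z in M. ?P y z" for y
    proof (rule ccontr)
      assume n: "k y y \<notin> \<real>\<^sub>\<ge>\<^sub>0"
      from that have "AE z in M. False" by eventually_elim (use n in \<open>auto simp: complex_nonneg_Reals_iff\<close>)
      then show False using False by simp
    qed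
    then show ?thesis using AE by (auto elim: eventually_mono)
  qed (auto elim: eventually_mono)
qed

text \<open>A diagonal bound dominates the kernel almost everywhere on the rectangle. Keeping
  \<open>c\<close> free allows the supremum over a single cell to be inserted later.\<close>

lemma set_integrable_kernel:
  assumes k: "(\<lambda>(x, y). k x y) \<in> borel_measurable (M \<Otimes>\<^sub>M M)"
    and pos: "AE \<alpha> in config_measure M. positive_matrix k \<alpha>"
    and P: "P \<in> bounded_borel" "Q \<in> bounded_borel" and c: "\<forall>x\<in>P \<union> Q. Re (k x x) \<le> c"
  shows "set_integrable (M \<Otimes>\<^sub>M M) (P \<times> Q) (\<lambda>p. k (fst p) (snd p))"
    and "cmod (LINT p:P \<times> Q|M \<Otimes>\<^sub>M M. k (fst p) (snd p)) \<le> c * (measure M P * measure M Q)"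
proof -
  let ?N = "M \<Otimes>\<^sub>M M" and ?k = "\<lambda>p. k (fst p) (snd p)"
  have PM [measurable]: "P \<in> sets M" "Q \<in> sets M" using P[THEN bounded_borelD] sets_M by simp_all
  have km [measurable]: "?k \<in> borel_measurable ?N" using k by (simp add: case_prod_beta')
  have e: "emeasure ?N (P \<times> Q) = ennreal (measure M P * measure M Q)"
    using P[THEN emeasure_bounded]
    by (simp add: emeasure_pair_measure_Times emeasure_eq_ennreal_measure less_top ennreal_mult)
  have ci: "integrable ?N (\<lambda>p. c * indicator (P \<times> Q) p)"
    using e by (intro integrable_mult_right integrable_real_indicator) auto
  have b: "AE p in ?N. norm (indicator (P \<times> Q) p *\<^sub>R ?k p) \<le> c * indicator (P \<times> Q) p"
    using AE_kernel_bound(1)[OF k pos]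
  proof eventually_elim
    fix p assume "2 * cmod (k (fst p) (snd p)) \<le> Re (k (fst p) (fst p)) + Re (k (snd p) (snd p))"
    then show "norm (indicator (P \<times> Q) p *\<^sub>R ?k p) \<le> c * indicator (P \<times> Q) p"
      using bspec[OF c, of "fst p"] bspec[OF c, of "snd p"] by (cases p) (auto simp: indicator_def)
  qed
  show i: "set_integrable ?N (P \<times> Q) ?k"
    unfolding set_integrable_def
    by (rule Bochner_Integration.integrable_bound[OF ci]) (use b in \<open>auto elim: eventually_mono\<close>)
  have "cmod (LINT p:P \<times> Q|?N. ?k p) \<le> (\<integral>p. norm (indicator (P \<times> Q) p *\<^sub>R ?k p) \<partial>?N)"
    unfolding set_lebesgue_integral_def by (rule integral_norm_bound)
  also have "\<dots> \<le> (\<integral>p. c * indicator (P \<times> Q) p \<partial>?N)"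
    using i b ci unfolding set_integrable_def by (intro integral_mono_AE integrable_norm) auto
  also have "\<dots> = c * (measure M P * measure M Q)" using e by (simp add: measure_def)
  finally show "cmod (LINT p:P \<times> Q|?N. ?k p) \<le> c * (measure M P * measure M Q)" .
qed

text \<open>Level sets of the diagonal of height \<eta> are put into the family; finitely many
  exhaust the range from 0 to \<open>c\<close>. Points with equal labels share their level.\<close>

lemma diagonal_levels:
  assumes k: "(\<lambda>(x, y). k x y) \<in> borel_measurable (M \<Otimes>\<^sub>M M)" and \<eta>: "0 < \<eta>"
  obtains \<H> where "finite \<H>" "\<H> \<subseteq> sets borel"
    "\<And>\<G> x y. \<H> \<subseteq> \<G> \<Longrightarrow> cell \<G> x = cell \<G> y \<Longrightarrow> 0 \<le> Re (k x x) \<Longrightarrow> Re (k x x) \<le> c \<Longrightarrow>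
      Re (k y y) \<le> Re (k x x) + \<eta>"
proof
  have "(\<lambda>x. (x, x)) \<in> measurable M (M \<Otimes>\<^sub>M M)" by measurable
  from measurable_compose[OF this k] have [measurable]: "(\<lambda>x. k x x) \<in> borel_measurable M" by simp
  let ?L = "\<lambda>j::nat. {x. j * \<eta> \<le> Re (k x x) \<and> Re (k x x) < (j + 1) * \<eta>}"
  let ?N = "nat \<lceil>c / \<eta>\<rceil>"
  show "finite (?L ` {..?N})" by simp
  have "{x\<in>space M. j * \<eta> \<le> Re (k x x) \<and> Re (k x x) < (j + 1) * \<eta>} \<in> sets M" for j :: nat by measurable
  then have "?L j \<in> sets borel" for j using sets_M by simp
  then show "?L ` {..?N} \<subseteq> sets borel" by (simp only: image_subset_iff) blast
  fix \<G> x y assume G: "?L ` {..?N} \<subseteq> \<G>" and xy: "cell \<G> x = cell \<G> y"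
    and x: "0 \<le> Re (k x x)" "Re (k x x) \<le> c"
  let ?j = "nat \<lfloor>Re (k x x) / \<eta>\<rfloor>"
  have j: "real ?j = of_int \<lfloor>Re (k x x) / \<eta>\<rfloor>" using x \<eta> by simp
  have "Re (k x x) / \<eta> \<le> c / \<eta>" using x \<eta> by (simp add: divide_right_mono)
  then have "?j \<le> ?N" by (intro nat_mono) linarith
  then have "?L ?j \<in> \<G>" using G by blast
  moreover have jx: "?j * \<eta> \<le> Re (k x x)" "Re (k x x) < (real ?j + 1) * \<eta>"
  proof -
    have "real ?j \<le> Re (k x x) / \<eta>" "Re (k x x) / \<eta> < real ?j + 1" unfolding j by linarith+
    then show "?j * \<eta> \<le> Re (k x x)" "Re (k x x) < (real ?j + 1) * \<eta>"
      using \<eta> by (simp_all add: field_simps)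
  qed
  ultimately have "?L ?j \<in> cell \<G> x" unfolding cell_def by blast
  then have "?L ?j \<in> cell \<G> y" using xy by simp
  then have "Re (k y y) < (real ?j + 1) * \<eta>" unfolding cell_def by blast
  then show "Re (k y y) \<le> Re (k x x) + \<eta>" using jx(1) by (simp add: algebra_simps)
qed

end

context diffuse_space
begin

lemma sets_cell:
  fixes \<Omega> :: "'a set"
  assumes \<G>: "finite \<G>" "\<G> \<subseteq> sets borel" and \<Omega>: "\<Omega> \<in> sets borel"
  shows "{x\<in>\<Omega>. cell \<G> x = i} \<in> sets borel"
proof (cases "i \<in> Pow \<G>")
  case True
  then have "cell \<G> -` {i} \<inter> space M \<in> sets M"
    using \<G>(1) by (intro measurable_sets[OF measurable_cell_M[OF \<G>]]) auto
  then have "cell \<G> -` {i} \<inter> \<Omega> \<in> sets borel" using \<Omega> sets_M by auto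
  also have "cell \<G> -` {i} \<inter> \<Omega> = {x\<in>\<Omega>. cell \<G> x = i}" by blast
  finally show ?thesis .
next
  case False
  then have "cell \<G> x \<noteq> i" for x using cell_in_Pow[of \<G> x] by metis
  then have "{x\<in>\<Omega>. cell \<G> x = i} = {}" by simp
  then show ?thesis by (simp only: sets.empty_sets)
qed

lemma nn_integral_blocks:
  fixes k :: "'a \<Rightarrow> 'a \<Rightarrow> complex"
  assumes k: "(\<lambda>(x, y). k x y) \<in> borel_measurable (M \<Otimes>\<^sub>M M)"
    and \<G>: "finite \<G>" "\<G> \<subseteq> sets borel" and \<Omega>: "\<Omega> \<in> sets borel"
  defines "P \<equiv> \<lambda>i. {x\<in>\<Omega>. cell \<G> x = i}"
  shows "(\<integral>\<^sup>+p. ennreal (norm (k (fst p) (snd p) - s (cell \<G> (fst p)) (cell \<G> (snd p)))) * indicator (\<Omega> \<times> \<Omega>) p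
      \<partial>(M \<Otimes>\<^sub>M M)) =
    (\<Sum>i\<in>Pow \<G>. \<Sum>j\<in>Pow \<G>. \<integral>\<^sup>+p. ennreal (norm (k (fst p) (snd p) - s i j)) * indicator (P i \<times> P j) p
      \<partial>(M \<Otimes>\<^sub>M M))"
proof -
  let ?N = "M \<Otimes>\<^sub>M M"
  have km: "(\<lambda>p. k (fst p) (snd p)) \<in> borel_measurable ?N" using k by (simp add: case_prod_beta')
  have "P i \<in> sets M" for i unfolding P_def using sets_cell[OF \<G> \<Omega>] sets_M by simp
  then have [measurable]: "P i \<times> P j \<in> sets ?N" for i j by (intro pair_measureI)
  have [measurable]: "(\<lambda>p. k (fst p) (snd p) - s i j) \<in> borel_measurable ?N" for i j
    by (rule borel_measurable_diff[OF km borel_measurable_const])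
  have m: "(\<lambda>p. ennreal (norm (k (fst p) (snd p) - s i j)) * indicator (P i \<times> P j) p) \<in> borel_measurable ?N" for i j
    by measurable
  have "(\<integral>\<^sup>+p. ennreal (norm (k (fst p) (snd p) - s (cell \<G> (fst p)) (cell \<G> (snd p)))) * indicator (\<Omega> \<times> \<Omega>) p \<partial>?N) =
    (\<integral>\<^sup>+p. (\<Sum>i\<in>Pow \<G>. \<Sum>j\<in>Pow \<G>. ennreal (norm (k (fst p) (snd p) - s i j)) * indicator (P i \<times> P j) p) \<partial>?N)"
  proof (rule nn_integral_cong)
    fix p :: "'a \<times> 'a"
    obtain x y where p: "p = (x, y)" by (cases p)
    have "(\<Sum>i\<in>Pow \<G>. \<Sum>j\<in>Pow \<G>. ennreal (norm (k x y - s i j)) * indicator (P i \<times> P j) (x, y)) =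
      (\<Sum>i\<in>Pow \<G>. \<Sum>j\<in>Pow \<G>. if i = cell \<G> x then (if j = cell \<G> y then
        ennreal (norm (k x y - s (cell \<G> x) (cell \<G> y))) * indicator (\<Omega> \<times> \<Omega>) (x, y) else 0) else 0)"
      by (intro sum.cong refl) (auto simp: P_def indicator_def)
    also have "\<dots> = (\<Sum>i\<in>Pow \<G>. if i = cell \<G> x then
        ennreal (norm (k x y - s (cell \<G> x) (cell \<G> y))) * indicator (\<Omega> \<times> \<Omega>) (x, y) else 0)"
    proof (intro sum.cong refl)
      fix i
      show "(\<Sum>j\<in>Pow \<G>. if i = cell \<G> x then (if j = cell \<G> y then
        ennreal (norm (k x y - s (cell \<G> x) (cell \<G> y))) * indicator (\<Omega> \<times> \<Omega>) (x, y) else 0) else 0) =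
        (if i = cell \<G> x then ennreal (norm (k x y - s (cell \<G> x) (cell \<G> y))) * indicator (\<Omega> \<times> \<Omega>) (x, y) else 0)"
        using \<G>(1) cell_in_Pow[of \<G> y] by (cases "i = cell \<G> x") simp_all
    qed
    also have "\<dots> = ennreal (norm (k x y - s (cell \<G> x) (cell \<G> y))) * indicator (\<Omega> \<times> \<Omega>) (x, y)"
      using \<G>(1) cell_in_Pow[of \<G> x] by simp
    finally show "ennreal (norm (k (fst p) (snd p) - s (cell \<G> (fst p)) (cell \<G> (snd p)))) * indicator (\<Omega> \<times> \<Omega>) p =
      (\<Sum>i\<in>Pow \<G>. \<Sum>j\<in>Pow \<G>. ennreal (norm (k (fst p) (snd p) - s i j)) * indicator (P i \<times> P j) p)"
      by (simp add: p)
  qed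
  also have "\<dots> = (\<Sum>i\<in>Pow \<G>. \<integral>\<^sup>+p. (\<Sum>j\<in>Pow \<G>. ennreal (norm (k (fst p) (snd p) - s i j)) * indicator (P i \<times> P j) p) \<partial>?N)"
    by (rule nn_integral_sum) (intro borel_measurable_sum m)
  also have "\<dots> = (\<Sum>i\<in>Pow \<G>. \<Sum>j\<in>Pow \<G>. \<integral>\<^sup>+p. ennreal (norm (k (fst p) (snd p) - s i j)) * indicator (P i \<times> P j) p \<partial>?N)"
    by (intro sum.cong refl nn_integral_sum m)
  finally show ?thesis .
qed

text \<open>The hypothesis \<open>form\<close> says that the quadratic form on step functions lies
  between 0 and \<open>q\<close> times the square norm. The family collects four demands: small
  cells, a nearly constant diagonal on each cell, an approximation of the kernel in the mean, and
  \<open>A\<close> and \<open>B\<close> as unions of cells.\<close>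

lemma discretization:
  fixes q c \<epsilon> :: real
  assumes k: "(\<lambda>(x, y). k x y) \<in> borel_measurable (M \<Otimes>\<^sub>M M)"
    and pos: "AE \<alpha> in config_measure M. positive_matrix k \<alpha>"
    and AB: "A \<in> bounded_borel" "B \<in> bounded_borel"
    and c: "\<forall>x\<in>A \<union> B. Re (k x x) \<le> c" "0 < c" and q: "0 \<le> q" "q < 1"
    and form: "\<And>(J :: 'a set set set) P. finite J \<Longrightarrow> (\<And>i. i \<in> J \<Longrightarrow> P i \<in> sets borel) \<Longrightarrow>
      (\<And>i. i \<in> J \<Longrightarrow> P i \<subseteq> A \<union> B) \<Longrightarrow> disjoint_family_on P J \<Longrightarrow>
      positive_matrix (\<lambda>i j. LINT p:P i \<times> P j|M \<Otimes>\<^sub>M M. k (fst p) (snd p)) J \<and>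
      (\<forall>v. Re (\<Sum>i\<in>J. \<Sum>j\<in>J. cnj (v i) * (LINT p:P i \<times> P j|M \<Otimes>\<^sub>M M. k (fst p) (snd p)) * v j) \<le>
        q * (\<Sum>i\<in>J. (cmod (v i))\<^sup>2 * measure M (P i)))"
    and \<epsilon>: "0 < \<epsilon>"
  obtains \<G> S where "finite \<G>" "\<G> \<subseteq> sets borel" "A \<in> \<G>" "B \<in> \<G>" "positive_matrix S (Pow \<G>)"
    "\<And>i. Re (S i i) \<le> c"
    "positive_matrix (\<lambda>i j. of_bool (i = j) - S i j * (complex_of_real (sqrt (measure M {x\<in>A \<union> B. cell \<G> x = i})) *
       complex_of_real (sqrt (measure M {x\<in>A \<union> B. cell \<G> x = j})))) (Pow \<G>)"
    "(\<integral>\<^sup>+y. \<integral>\<^sup>+z. ennreal (norm (k y z - S (cell \<G> y) (cell \<G> z))) * (indicator (A \<union> B) y * indicator (A \<union> B) z)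
       \<partial>M \<partial>M) \<le> ennreal \<epsilon>"
    "(\<integral>\<^sup>+y. ennreal (norm (k y y - S (cell \<G> y) (cell \<G> y))) * indicator (A \<union> B) y \<partial>M) \<le> ennreal \<epsilon>"
proof -
  let ?N = "M \<Otimes>\<^sub>M M" and ?k = "\<lambda>p. k (fst p) (snd p)"
  define \<Omega> where "\<Omega> = A \<union> B"
  have \<Omega>: "\<Omega> \<in> bounded_borel" unfolding \<Omega>_def by (rule bounded_borel_Un[OF AB])
  have \<Omega>b: "\<Omega> \<in> sets borel" by (rule bounded_borelD[OF \<Omega>])
  have \<Omega>M [measurable]: "\<Omega> \<in> sets M" using \<Omega>b sets_M by simp
  have km [measurable]: "?k \<in> borel_measurable ?N" using k by (simp add: case_prod_beta')
  define W where "W = measure M \<Omega>"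
  have W: "0 \<le> W" by (simp add: W_def)
  have eW: "emeasure M \<Omega> = ennreal W"
    using emeasure_bounded[OF \<Omega>] by (simp add: W_def emeasure_eq_ennreal_measure less_top)
  \<comment> \<open>The first bound keeps \<open>d i * l i\<close> within the gap
    \<open>1 - q\<close>; the second limits the error on the diagonal blocks to
    \<open>\<epsilon> / 2\<close>. The summand 1 guards against \<open>W = 0\<close>.\<close>
  define \<delta> where "\<delta> = min ((1 - q) / c) (\<epsilon> / (4 * c * (W + 1)))"
  have \<delta>: "0 < \<delta>" unfolding \<delta>_def using q c(2) \<epsilon> W by simp
  have \<delta>1: "c * \<delta> \<le> 1 - q"
  proof -
    have "\<delta> \<le> (1 - q) / c" by (simp add: \<delta>_def)
    then show ?thesis using c(2) by (simp add: field_simps)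
  qed
  have \<delta>2: "2 * c * \<delta> * W \<le> \<epsilon> / 2"
  proof -
    have "\<delta> \<le> \<epsilon> / (4 * c * (W + 1))" by (simp add: \<delta>_def)
    then have "\<delta> * (4 * c * (W + 1)) \<le> \<epsilon>" using c(2) W by (simp add: pos_le_divide_eq)
    moreover have "2 * (2 * c * \<delta> * W) \<le> \<delta> * (4 * c * (W + 1))" using c(2) \<delta> by (simp add: algebra_simps)
    ultimately show ?thesis by simp
  qed
  \<comment> \<open>The error on the diagonal is uniformly at most \<eta>, so its integral is at
    most \<open>\<eta> * W\<close>.\<close>
  define \<eta> where "\<eta> = \<epsilon> / (W + 1)"
  have \<eta>: "0 < \<eta>" "\<eta> * W \<le> \<epsilon>" unfolding \<eta>_def using W \<epsilon> by (auto simp: field_simps)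
  obtain \<H>\<^sub>1 where H1: "finite \<H>\<^sub>1" "\<H>\<^sub>1 \<subseteq> sets borel"
    "\<And>\<G> i. \<H>\<^sub>1 \<subseteq> \<G> \<Longrightarrow> measure M {x\<in>\<Omega>. cell \<G> x = i} \<le> \<delta>"
    using small_cells[OF \<Omega> \<delta>] by metis
  obtain \<H>\<^sub>2 where H2: "finite \<H>\<^sub>2" "\<H>\<^sub>2 \<subseteq> sets borel"
    "\<And>\<G> x y. \<H>\<^sub>2 \<subseteq> \<G> \<Longrightarrow> cell \<G> x = cell \<G> y \<Longrightarrow> 0 \<le> Re (k x x) \<Longrightarrow> Re (k x x) \<le> c \<Longrightarrow>
      Re (k y y) \<le> Re (k x x) + \<eta>"
    using diagonal_levels[OF k \<eta>(1), of c] by metis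
  have "set_integrable ?N (\<Omega> \<times> \<Omega>) ?k"
    using c by (intro set_integrable_kernel(1)[OF k pos \<Omega> \<Omega>, of c]) (simp add: \<Omega>_def)
  then have "cell_approx \<Omega> (\<lambda>p. indicator (\<Omega> \<times> \<Omega>) p *\<^sub>R ?k p)"
    unfolding set_integrable_def by (rule cell_approx_integrable[OF \<Omega>])
  moreover have "0 < \<epsilon> / 4" using \<epsilon> by simp
  ultimately obtain \<H>\<^sub>3 s where H3: "finite \<H>\<^sub>3" "\<H>\<^sub>3 \<subseteq> sets borel" and s:
    "(\<integral>\<^sup>+p. ennreal (norm (indicator (\<Omega> \<times> \<Omega>) p *\<^sub>R ?k p - s (cell \<H>\<^sub>3 (fst p)) (cell \<H>\<^sub>3 (snd p)))) * indicator (\<Omega> \<times> \<Omega>) p \<partial>?N)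
       \<le> ennreal (\<epsilon> / 4)"
    unfolding cell_approx_def by blast
  define \<G> where "\<G> = \<H>\<^sub>1 \<union> \<H>\<^sub>2 \<union> \<H>\<^sub>3 \<union> {A, B}"
  have \<G>: "finite \<G>" "\<G> \<subseteq> sets borel" "\<H>\<^sub>1 \<subseteq> \<G>" "\<H>\<^sub>2 \<subseteq> \<G>" "\<H>\<^sub>3 \<subseteq> \<G>" "A \<in> \<G>" "B \<in> \<G>"
    using H1 H2 H3 AB[THEN bounded_borelD] by (auto simp: \<G>_def)
  define P where "P i = {x\<in>\<Omega>. cell \<G> x = i}" for i
  have Pb: "P i \<in> sets borel" for i unfolding P_def by (rule sets_cell[OF \<G>(1,2) \<Omega>b])
  have P\<Omega>: "P i \<subseteq> \<Omega>" for i by (auto simp: P_def)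
  have Pbb: "P i \<in> bounded_borel" for i by (rule bounded_borel_subset[OF \<Omega> Pb P\<Omega>])
  have PM [measurable]: "P i \<in> sets M" for i using Pb sets_M by simp
  have disj: "disjoint_family_on P J" for J by (auto simp: disjoint_family_on_def P_def)
  define l where "l i = measure M (P i)" for i
  have el: "emeasure M (P i) = ennreal (l i)" for i
    using emeasure_bounded[OF Pbb[of i]] by (simp add: l_def emeasure_eq_ennreal_measure less_top)
  have l0: "0 \<le> l i" for i by (simp add: l_def)
  have l\<delta>: "l i \<le> \<delta>" for i unfolding l_def P_def by (rule H1(3)[OF \<G>(3)])
  have eN: "emeasure ?N (P i \<times> P j) = ennreal (l i * l j)" for i j
    by (simp add: emeasure_pair_measure_Times el ennreal_mult l0)
  \<comment> \<open>A supremum over all points, not an essential one, so that it bounds the diagonal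
    everywhere on the cell. Nonnegativity is known almost everywhere only, which is why
    \<open>max 0\<close> is taken.\<close>
  define d where "d i = (if P i = {} then 0 else max 0 (SUP x\<in>P i. Re (k x x)))" for i
  have d0: "0 \<le> d i" for i by (simp add: d_def)
  have c': "Re (k x x) \<le> c" if "x \<in> P i" for x i using that c(1) P\<Omega>[of i] by (auto simp: \<Omega>_def)
  have d_ge: "Re (k x x) \<le> d i" if "x \<in> P i" for x i
  proof -
    have "bdd_above ((\<lambda>x. Re (k x x)) ` P i)" using c' by (intro bdd_aboveI2)
    then have "Re (k x x) \<le> (SUP x\<in>P i. Re (k x x))" using that by (intro cSUP_upper)
    moreover have "P i \<noteq> {}" using that by blast
    ultimately show ?thesis by (simp add: d_def)
  qed
  have d_c: "d i \<le> c" for i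
    using c(2) c' by (auto simp: d_def intro!: cSUP_least)
  have d_le: "d i \<le> Re (k x x) + \<eta>" if x: "x \<in> P i" "0 \<le> Re (k x x)" for x i
  proof -
    have "Re (k y y) \<le> Re (k x x) + \<eta>" if "y \<in> P i" for y
      using H2(3)[OF \<G>(4), of x y] x that c'[OF x(1)] by (simp add: P_def)
    then show ?thesis using x \<eta>(1) by (auto simp: d_def intro!: cSUP_least)
  qed
  define \<kappa> where "\<kappa> i j = (LINT p:P i \<times> P j|?N. ?k p)" for i j
  define S where "S i j = (if i = j then complex_of_real (d i) else \<kappa> i j / complex_of_real (l i * l j))" for i j
  have fin: "finite (Pow \<G>)" using \<G>(1) by simp
  have ki: "set_integrable ?N (P i \<times> P j) ?k" for i j
    using c' by (intro set_integrable_kernel(1)[OF k pos Pbb Pbb, of _ _ c]) auto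
  \<comment> \<open>The estimate of the block integral is used with the local bound
    \<open>d i\<close> in place of \<open>c\<close>, so the diagonal of \<open>S\<close> is at least
    the modulus of the block mean.\<close>
  have \<kappa>d: "cmod (\<kappa> i i) \<le> d i * (l i)\<^sup>2" for i
    using set_integrable_kernel(2)[OF k pos Pbb[of i] Pbb[of i], of "d i"] d_ge
    by (simp add: \<kappa>_def l_def power2_eq_square)
  have frm: "positive_matrix \<kappa> (Pow \<G>)"
    "\<And>v. Re (\<Sum>i\<in>Pow \<G>. \<Sum>j\<in>Pow \<G>. cnj (v i) * \<kappa> i j * v j) \<le> q * (\<Sum>i\<in>Pow \<G>. (cmod (v i))\<^sup>2 * l i)"
    using form[OF fin Pb P\<Omega>[unfolded \<Omega>_def] disj] unfolding \<kappa>_def l_def by blast+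
  have dl: "d i * l i \<le> 1 - q" for i
  proof -
    have "d i * l i \<le> c * \<delta>" using d_c l\<delta> l0 c(2) by (intro mult_mono) auto
    then show ?thesis using \<delta>1 by simp
  qed
  have Spos: "positive_matrix S (Pow \<G>)"
    "positive_matrix (\<lambda>i j. of_bool (i = j) - S i j * (complex_of_real (sqrt (l i)) * complex_of_real (sqrt (l j)))) (Pow \<G>)"
    using step_kernel_positive[OF fin frm l0 \<kappa>d d0 dl q(1)] unfolding S_def by blast+
  show thesis
  proof
    show "finite \<G>" "\<G> \<subseteq> sets borel" "A \<in> \<G>" "B \<in> \<G>" by fact+
    show "positive_matrix S (Pow \<G>)" by fact
    show "Re (S i i) \<le> c" for i using d_c by (simp add: S_def)
    show "positive_matrix (\<lambda>i j. of_bool (i = j) - S i j * (complex_of_real (sqrt (measure M {x\<in>A \<union> B. cell \<G> x = i})) *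
       complex_of_real (sqrt (measure M {x\<in>A \<union> B. cell \<G> x = j})))) (Pow \<G>)"
      using Spos(2) unfolding l_def P_def \<Omega>_def .
    let ?s = "\<lambda>i j. s (i \<inter> \<H>\<^sub>3) (j \<inter> \<H>\<^sub>3)"
    let ?b = "\<lambda>t i j. \<integral>\<^sup>+p. ennreal (norm (?k p - t i j)) * indicator (P i \<times> P j) p \<partial>?N"
    have bl: "(\<integral>\<^sup>+p. ennreal (norm (?k p - t (cell \<G> (fst p)) (cell \<G> (snd p)))) * indicator (\<Omega> \<times> \<Omega>) p \<partial>?N) =
        (\<Sum>i\<in>Pow \<G>. \<Sum>j\<in>Pow \<G>. ?b t i j)" for t
      unfolding P_def by (rule nn_integral_blocks[OF k \<G>(1,2) \<Omega>b])
    have Sm: "(\<lambda>p. S (cell \<G> (fst p)) (cell \<G> (snd p))) \<in> borel_measurable ?N"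
      by (rule measurable_cell_pair[OF \<G>(1,2)])
    \<comment> \<open>Off the diagonal the block mean costs a factor 2 against \<open>?s\<close>. On
      a diagonal block \<open>d i\<close> is not the mean, but the error is at most
      \<open>2 * c\<close> on measure \<open>l i * l i\<close>, hence at most
      \<open>2 * c * \<delta> * l i\<close>, and this adds up to
      \<open>2 * c * \<delta> * W\<close>.\<close>
    have block: "?b S i j \<le> 2 * ?b ?s i j + (if i = j then ennreal (2 * c * \<delta>) * emeasure M (P i) else 0)" for i j
    proof (cases "i = j")
      case False
      have m: "measure ?N (P i \<times> P j) = l i * l j" by (simp add: measure_def eN l0)
      have "?b S i j \<le> 2 * ?b ?s i j"
        using nn_integral_mean_deviation_le[of "P i \<times> P j" ?N ?k "?s i j", OF _ _ ki] False
        by (simp add: eN m S_def \<kappa>_def)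
      then show ?thesis using False by simp
    next
      case True
      have "?b S i j \<le> (\<integral>\<^sup>+p. ennreal (2 * c) * indicator (P i \<times> P i) p \<partial>?N)"
      proof (rule nn_integral_mono_AE, use AE_kernel_bound(1)[OF k pos] in eventually_elim)
        fix p assume p: "2 * cmod (?k p) \<le> Re (k (fst p) (fst p)) + Re (k (snd p) (snd p))"
        show "ennreal (norm (?k p - S i j)) * indicator (P i \<times> P j) p \<le> ennreal (2 * c) * indicator (P i \<times> P i) p"
        proof (cases "p \<in> P i \<times> P i")
          case in_P: True
          have "cmod (?k p) \<le> c" using p c'[of "fst p" i] c'[of "snd p" i] in_P by auto
          moreover have "cmod (S i j) \<le> c" using True d_c[of i] d0[of i] by (simp add: S_def)
          ultimately have "norm (?k p - S i j) \<le> 2 * c" using norm_triangle_ineq4[of "?k p" "S i j"] by simp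
          then show ?thesis using in_P True by (simp add: ennreal_leI)
        qed (use True in simp)
      qed
      also have "\<dots> = ennreal (2 * c) * ennreal (l i * l i)" by (simp add: nn_integral_cmult eN)
      also have "\<dots> = ennreal (2 * c * l i) * ennreal (l i)"
        using c(2) l0[of i] by (simp add: ennreal_mult[symmetric] mult_ac)
      also have "\<dots> \<le> ennreal (2 * c * \<delta>) * ennreal (l i)"
        using c(2) l\<delta>[of i] by (intro mult_right_mono ennreal_leI) auto
      also have "\<dots> \<le> 2 * ?b ?s i j + ennreal (2 * c * \<delta>) * emeasure M (P i)" by (simp add: el)
      finally show ?thesis using True by simp
    qed
    have "(\<integral>\<^sup>+y. \<integral>\<^sup>+z. ennreal (norm (k y z - S (cell \<G> y) (cell \<G> z))) * (indicator \<Omega> y * indicator \<Omega> z) \<partial>M \<partial>M) =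
      (\<integral>\<^sup>+y. \<integral>\<^sup>+z. (\<lambda>p. ennreal (norm (?k p - S (cell \<G> (fst p)) (cell \<G> (snd p)))) * indicator (\<Omega> \<times> \<Omega>) p) (y, z) \<partial>M \<partial>M)"
      by (intro nn_integral_cong) (auto simp: indicator_def)
    also have "\<dots> = (\<integral>\<^sup>+p. ennreal (norm (?k p - S (cell \<G> (fst p)) (cell \<G> (snd p)))) * indicator (\<Omega> \<times> \<Omega>) p \<partial>?N)"
      by (rule sigma_finite_measure.nn_integral_fst[OF sigma_finite_M]) (use Sm in measurable)
    also have "\<dots> \<le> (\<Sum>i\<in>Pow \<G>. \<Sum>j\<in>Pow \<G>. 2 * ?b ?s i j +
        (if i = j then ennreal (2 * c * \<delta>) * emeasure M (P i) else 0))"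
      unfolding bl by (intro sum_mono block)
    also have "\<dots> = 2 * (\<Sum>i\<in>Pow \<G>. \<Sum>j\<in>Pow \<G>. ?b ?s i j) + (\<Sum>i\<in>Pow \<G>. ennreal (2 * c * \<delta>) * emeasure M (P i))"
      using fin by (simp add: sum.distrib sum_distrib_left)
    also have "(\<Sum>i\<in>Pow \<G>. ennreal (2 * c * \<delta>) * emeasure M (P i)) = ennreal (2 * c * \<delta>) * ennreal W"
    proof -
      have "(\<Sum>i\<in>Pow \<G>. emeasure M (P i)) = emeasure M (\<Union>i\<in>Pow \<G>. P i)"
        using fin disj PM by (intro sum_emeasure) auto
      also have "(\<Union>i\<in>Pow \<G>. P i) = \<Omega>" using cell_in_Pow[of \<G>] by (auto simp: P_def)
      finally show ?thesis by (simp add: sum_distrib_left[symmetric] eW)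
    qed
    also have "(\<Sum>i\<in>Pow \<G>. \<Sum>j\<in>Pow \<G>. ?b ?s i j) \<le> ennreal (\<epsilon> / 4)"
    proof -
      have "(\<Sum>i\<in>Pow \<G>. \<Sum>j\<in>Pow \<G>. ?b ?s i j) =
        (\<integral>\<^sup>+p. ennreal (norm (?k p - ?s (cell \<G> (fst p)) (cell \<G> (snd p)))) * indicator (\<Omega> \<times> \<Omega>) p \<partial>?N)"
        by (rule bl[symmetric])
      also have "\<dots> = (\<integral>\<^sup>+p. ennreal (norm (indicator (\<Omega> \<times> \<Omega>) p *\<^sub>R ?k p - s (cell \<H>\<^sub>3 (fst p)) (cell \<H>\<^sub>3 (snd p)))) * indicator (\<Omega> \<times> \<Omega>) p \<partial>?N)"
        by (intro nn_integral_cong) (simp add: cell_subfamily[OF \<G>(5)] indicator_def)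
      finally show ?thesis using s by simp
    qed
    also have "2 * ennreal (\<epsilon> / 4) + ennreal (2 * c * \<delta>) * ennreal W \<le> ennreal \<epsilon>"
    proof -
      have "2 * ennreal (\<epsilon> / 4) = ennreal (\<epsilon> / 2)"
        using \<epsilon> by (simp add: mult_2 ennreal_plus[symmetric] del: ennreal_plus)
      then have "2 * ennreal (\<epsilon> / 4) + ennreal (2 * c * \<delta>) * ennreal W = ennreal (\<epsilon> / 2 + 2 * c * \<delta> * W)"
        using \<epsilon> c(2) \<delta> W by (simp add: ennreal_mult)
      also have "\<dots> \<le> ennreal \<epsilon>" using \<delta>2 by (intro ennreal_leI) simp
      finally show ?thesis .
    qed
    finally show "(\<integral>\<^sup>+y. \<integral>\<^sup>+z. ennreal (norm (k y z - S (cell \<G> y) (cell \<G> z))) * (indicator (A \<union> B) y * indicator (A \<union> B) z)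
       \<partial>M \<partial>M) \<le> ennreal \<epsilon>"
      unfolding \<Omega>_def by (simp add: mult_left_mono add_right_mono)
    have "(\<integral>\<^sup>+y. ennreal (norm (k y y - S (cell \<G> y) (cell \<G> y))) * indicator \<Omega> y \<partial>M) \<le>
        (\<integral>\<^sup>+y. ennreal \<eta> * indicator \<Omega> y \<partial>M)"
    proof (rule nn_integral_mono_AE, use AE_kernel_bound(2)[OF k pos] in eventually_elim)
      fix y assume y: "k y y \<in> \<real>\<^sub>\<ge>\<^sub>0"
      show "ennreal (norm (k y y - S (cell \<G> y) (cell \<G> y))) * indicator \<Omega> y \<le> ennreal \<eta> * indicator \<Omega> y"
      proof (cases "y \<in> \<Omega>")
        case True
        then have yP: "y \<in> P (cell \<G> y)" by (simp add: P_def)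
        have "0 \<le> Re (k y y)" "k y y = of_real (Re (k y y))"
          using y by (auto simp: complex_nonneg_Reals_iff complex_eq_iff)
        then have "k y y - S (cell \<G> y) (cell \<G> y) = of_real (Re (k y y) - d (cell \<G> y))" by (simp add: S_def)
        then have "norm (k y y - S (cell \<G> y) (cell \<G> y)) = \<bar>Re (k y y) - d (cell \<G> y)\<bar>"
          by (simp only: norm_of_real)
        also have "\<dots> \<le> \<eta>" using d_ge[OF yP] d_le[OF yP] \<open>0 \<le> Re (k y y)\<close> by simp
        finally show ?thesis using True by (simp add: ennreal_leI)
      qed simp
    qed
    also have "\<dots> = ennreal (\<eta> * W)" using \<eta>(1) W by (simp add: nn_integral_cmult eW ennreal_mult)
    also have "\<dots> \<le> ennreal \<epsilon>" by (rule ennreal_leI[OF \<eta>(2)])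
    finally show "(\<integral>\<^sup>+y. ennreal (norm (k y y - S (cell \<G> y) (cell \<G> y))) * indicator (A \<union> B) y \<partial>M) \<le> ennreal \<epsilon>"
      unfolding \<Omega>_def .
  qed
qed

end

section \<open>Submodularity of void probabilities\<close>

text \<open>The Fredholm determinant of the identity minus the operator with kernel \<open>k\<close>
  on \<open>D\<close>. For the correlation kernel, with diagonal bounded on \<open>D\<close>, it is
  the void probability of \<open>D\<close>.\<close>

definition fredholm_series :: "'a measure \<Rightarrow> ('a \<Rightarrow> 'a \<Rightarrow> complex) \<Rightarrow> 'a set \<Rightarrow> real" where
  "fredholm_series M k D = (\<Sum>m. (-1) ^ m / fact m * minor_integral M k D m)"

context diffuse_space
begin

text \<open>Cells are weighted by their measure in \<Omega> and not in \<open>D\<close>. The two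
  agree on the labels of \<open>D\<close>, so the series for different \<open>D\<close> become
  principal minors of one and the same matrix.\<close>

lemma fredholm_series_cells:
  fixes S :: "'a set set \<Rightarrow> 'a set set \<Rightarrow> complex"
  assumes \<G>: "finite \<G>" "\<G> \<subseteq> sets borel" and D: "D \<in> bounded_borel" "D \<subseteq> \<Omega>"
    and J: "J \<subseteq> Pow \<G>" "\<And>x. x \<in> \<Omega> \<Longrightarrow> x \<in> D \<longleftrightarrow> cell \<G> x \<in> J"
  defines "r \<equiv> \<lambda>i. complex_of_real (sqrt (measure M {x\<in>\<Omega>. cell \<G> x = i}))"
  shows "fredholm_series M (\<lambda>x y. S (cell \<G> x) (cell \<G> y)) D =
    Re (kernel_det (\<lambda>i j. of_bool (i = j) - S i j * (r i * r j)) J)"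
proof -
  have eq: "{x\<in>D. cell \<G> x = i} = {x\<in>\<Omega>. cell \<G> x = i}" if "i \<in> J" for i
    using that J(2) D(2) by blast
  have "fredholm_series M (\<lambda>x y. S (cell \<G> x) (cell \<G> y)) D =
    Re (kernel_det (\<lambda>i j. of_bool (i = j) - S i j *
      (complex_of_real (sqrt (measure M {x\<in>D. cell \<G> x = i})) *
       complex_of_real (sqrt (measure M {x\<in>D. cell \<G> x = j})))) J)"
    unfolding fredholm_series_def
  proof (rule fredholm_series_step[OF _ D(1)])
    show "finite J" using J(1) \<G>(1) finite_subset by blast
    show "cell \<G> x \<in> J" if "x \<in> D" for x using that J(2) D(2) by blast
    show "{x\<in>D. cell \<G> x = i} \<in> sets borel" for i
      by (rule sets_cell[OF \<G> bounded_borelD[OF D(1)]])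
  qed
  also have "\<dots> = Re (kernel_det (\<lambda>i j. of_bool (i = j) - S i j * (r i * r j)) J)"
    by (intro arg_cong[where f = Re] kernel_det_cong) (simp add: eq r_def)
  finally show ?thesis .
qed

text \<open>Each term converges by the entrywise estimate, and an exponential majorant independent
  of \<open>n\<close> allows the limit under the sum.\<close>

lemma fredholm_series_tendsto:
  assumes k: "(\<lambda>(x, y). k x y) \<in> borel_measurable (M \<Otimes>\<^sub>M M)"
    and s: "\<And>n. (\<lambda>(x, y). s n x y) \<in> borel_measurable (M \<Otimes>\<^sub>M M)"
    and D: "D \<in> bounded_borel"
    and kpos: "\<And>m. AE x in (\<Pi>\<^sub>M i\<in>{..<m::nat}. M). positive_matrix (\<lambda>a b. k (x a) (x b)) {..<m}"
    and spos: "\<And>n m x. positive_matrix (\<lambda>a b. s n (x a) (x b)) {..<m::nat}"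
    and kc: "\<forall>x\<in>D. Re (k x x) \<le> c" and sc: "\<And>n. \<forall>x\<in>D. Re (s n x x) \<le> c" and c: "0 < c"
    and e2: "\<And>n. (\<integral>\<^sup>+y. \<integral>\<^sup>+z. ennreal (norm (k y z - s n y z)) * (indicator D y * indicator D z) \<partial>M \<partial>M)
      \<le> ennreal (\<epsilon> n)"
    and e1: "\<And>n. (\<integral>\<^sup>+y. ennreal (norm (k y y - s n y y)) * indicator D y \<partial>M) \<le> ennreal (\<epsilon> n)"
    and \<epsilon>: "\<And>n. 0 \<le> \<epsilon> n" "\<epsilon> \<longlonglongrightarrow> 0"
  shows "(\<lambda>n. fredholm_series M (s n) D) \<longlonglongrightarrow> fredholm_series M k D"
proof -
  have kp: "AE x in (\<Pi>\<^sub>M i\<in>{..<m}. M). (\<forall>i<m. x i \<in> D) \<longrightarrow> positive_matrix (\<lambda>a b. k (x a) (x b)) {..<m}"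
    for m :: nat using kpos[of m] by eventually_elim simp
  have sp: "AE x in (\<Pi>\<^sub>M i\<in>{..<m}. M). (\<forall>i<m. x i \<in> D) \<longrightarrow> positive_matrix (\<lambda>a b. s n (x a) (x b)) {..<m}"
    for n and m :: nat using spos by simp
  have lim: "(\<lambda>n. minor_integral M (s n) D m) \<longlonglongrightarrow> minor_integral M k D m" for m
  proof -
    let ?C = "\<lambda>\<epsilon>. fact m * (m * (c ^ (m - 1) * ((measure M D ^ (m - 1) + measure M D ^ (m - 2)) * \<epsilon>)))"
    have "(\<lambda>n. ?C (\<epsilon> n)) \<longlonglongrightarrow> ?C 0" by (intro tendsto_intros \<epsilon>(2))
    then have C0: "(\<lambda>n. ?C (\<epsilon> n)) \<longlonglongrightarrow> 0" by simp
    have "(\<lambda>n. minor_integral M k D m - minor_integral M (s n) D m) \<longlonglongrightarrow> 0"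
    proof (rule Lim_null_comparison[OF _ C0])
      show "\<forall>\<^sub>F n in sequentially. norm (minor_integral M k D m - minor_integral M (s n) D m) \<le> ?C (\<epsilon> n)"
        using minor_integral_diff[OF k s D kp sp kc sc c e2 e1 \<epsilon>(1)] by simp
    qed
    from tendsto_diff[OF tendsto_const[of "minor_integral M k D m"] this] show ?thesis by simp
  qed
  let ?a = "\<lambda>m n. (-1) ^ m / fact m * minor_integral M (s n) D m"
  have "((\<lambda>n. suminf (\<lambda>m. ?a m n)) \<longlongrightarrow> suminf (\<lambda>m. (-1) ^ m / fact m * minor_integral M k D m)) sequentially"
  proof (rule tannerys_theorem[THEN conjunct2, THEN conjunct2])
    show "((\<lambda>n. ?a m n) \<longlongrightarrow> (-1) ^ m / fact m * minor_integral M k D m) sequentially" for m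
      by (intro tendsto_intros lim)
    show "summable (\<lambda>m. inverse (fact m) * (c * measure M D) ^ m)" by (rule summable_exp)
    have "norm (?a m n) \<le> inverse (fact m) * (c * measure M D) ^ m" for m n
      using minor_integral_bounds(2,3)[OF s D sp sc less_imp_le[OF c], of n m]
      by (simp add: abs_mult divide_inverse mult_left_mono)
    then show "\<forall>\<^sub>F (m, n) in at_top \<times>\<^sub>F sequentially.
        norm (?a m n) \<le> inverse (fact m) * (c * measure M D) ^ m"
      by (intro always_eventually) auto
  qed simp
  then show ?thesis by (simp add: fredholm_series_def)
qed

text \<open>For step kernels the inequality holds exactly, and it survives the limit. All four sets
  lie in \<open>A \<union> B\<close>, so one sequence of step kernels serves them
  simultaneously.\<close>

lemma fredholm_series_submodular:
  fixes q c :: real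
  assumes k: "(\<lambda>(x, y). k x y) \<in> borel_measurable (M \<Otimes>\<^sub>M M)"
    and pos: "AE \<alpha> in config_measure M. positive_matrix k \<alpha>"
    and AB: "A \<in> bounded_borel" "B \<in> bounded_borel"
    and c: "\<forall>x\<in>A \<union> B. Re (k x x) \<le> c" "0 < c" and q: "0 \<le> q" "q < 1"
    and form: "\<And>(J :: 'a set set set) P. finite J \<Longrightarrow> (\<And>i. i \<in> J \<Longrightarrow> P i \<in> sets borel) \<Longrightarrow>
      (\<And>i. i \<in> J \<Longrightarrow> P i \<subseteq> A \<union> B) \<Longrightarrow> disjoint_family_on P J \<Longrightarrow>
      positive_matrix (\<lambda>i j. LINT p:P i \<times> P j|M \<Otimes>\<^sub>M M. k (fst p) (snd p)) J \<and>
      (\<forall>v. Re (\<Sum>i\<in>J. \<Sum>j\<in>J. cnj (v i) * (LINT p:P i \<times> P j|M \<Otimes>\<^sub>M M. k (fst p) (snd p)) * v j) \<le>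
        q * (\<Sum>i\<in>J. (cmod (v i))\<^sup>2 * measure M (P i)))"
  shows "fredholm_series M k (A \<union> B) * fredholm_series M k (A \<inter> B) \<le>
    fredholm_series M k A * fredholm_series M k B"
proof -
  let ?\<Omega> = "A \<union> B"
  let ?r = "\<lambda>\<G> i. complex_of_real (sqrt (measure M {x\<in>?\<Omega>. cell \<G> x = i}))"
  let ?P = "\<lambda>n \<G> S. finite \<G> \<and> \<G> \<subseteq> sets borel \<and> A \<in> \<G> \<and> B \<in> \<G> \<and> positive_matrix S (Pow \<G>) \<and>
    (\<forall>i. Re (S i i) \<le> c) \<and>
    positive_matrix (\<lambda>i j. of_bool (i = j) - S i j * (?r \<G> i * ?r \<G> j)) (Pow \<G>) \<and>
    (\<integral>\<^sup>+y. \<integral>\<^sup>+z. ennreal (norm (k y z - S (cell \<G> y) (cell \<G> z))) * (indicator ?\<Omega> y * indicator ?\<Omega> z)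
       \<partial>M \<partial>M) \<le> ennreal (1 / Suc n) \<and>
    (\<integral>\<^sup>+y. ennreal (norm (k y y - S (cell \<G> y) (cell \<G> y))) * indicator ?\<Omega> y \<partial>M) \<le> ennreal (1 / Suc n)"
  \<comment> \<open>An opaque name for the property, so that \<G> and \<open>S\<close> can be chosen
    for all \<open>n\<close> without its body being unfolded.\<close>
  define Q where "Q n \<G> S \<longleftrightarrow> ?P n \<G> S" for n \<G> S
  have "\<exists>\<G> S. ?P n \<G> S" for n
    by (rule discretization[OF k pos AB c q form, of "1 / Suc n"]) (blast | simp)+
  then have "\<exists>\<G> S. Q n \<G> S" for n by (simp only: Q_def)
  then obtain \<G> S where "Q n (\<G> n) (S n)" for n by metis
  then have GS: "?P n (\<G> n) (S n)" for n unfolding Q_def .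
  have \<G>: "finite (\<G> n)" "\<G> n \<subseteq> sets borel" "A \<in> \<G> n" "B \<in> \<G> n" for n using GS[of n] by auto
  let ?s = "\<lambda>n x y. S n (cell (\<G> n) x) (cell (\<G> n) y)"
  have conv: "(\<lambda>n. fredholm_series M (?s n) D) \<longlonglongrightarrow> fredholm_series M k D"
    if D: "D \<in> bounded_borel" "D \<subseteq> ?\<Omega>" for D
  proof (rule fredholm_series_tendsto[OF k _ D(1) _ _ _ _ c(2)])
    show "(\<lambda>(x, y). ?s n x y) \<in> borel_measurable (M \<Otimes>\<^sub>M M)" for n
      using measurable_cell_pair[OF \<G>(1,2), of "S n" n] by (simp add: case_prod_beta')
    show "AE x in (\<Pi>\<^sub>M i\<in>{..<m}. M). positive_matrix (\<lambda>a b. k (x a) (x b)) {..<m}" for m :: nat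
      by (rule positive_matrix_tuple[OF pos])
    show "positive_matrix (\<lambda>a b. ?s n (x a) (x b)) {..<m}" for n x and m :: nat
    proof (rule positive_matrix_pullback[OF finite_lessThan, where f = "\<lambda>a. cell (\<G> n) (x a)"])
      show "positive_matrix (S n) (Pow (\<G> n))" using GS[of n] by blast
      show "(\<lambda>a. cell (\<G> n) (x a)) ` {..<m} \<subseteq> Pow (\<G> n)" by (rule image_subsetI) (rule cell_in_Pow)
      show "finite (Pow (\<G> n))" using \<G>(1) by simp
    qed
    show "\<forall>x\<in>D. Re (k x x) \<le> c" using c(1) D(2) by blast
    show "\<forall>x\<in>D. Re (?s n x x) \<le> c" for n using GS[of n] by blast
    show "(\<lambda>n. 1 / Suc n) \<longlonglongrightarrow> 0" using LIMSEQ_inverse_real_of_nat by (simp add: divide_inverse)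
    show "0 \<le> 1 / real (Suc n)" for n by simp
    show "(\<integral>\<^sup>+y. \<integral>\<^sup>+z. ennreal (norm (k y z - ?s n y z)) * (indicator D y * indicator D z) \<partial>M \<partial>M)
      \<le> ennreal (1 / real (Suc n))" for n
    proof -
      have "(\<integral>\<^sup>+y. \<integral>\<^sup>+z. ennreal (norm (k y z - ?s n y z)) * (indicator D y * indicator D z) \<partial>M \<partial>M) \<le>
        (\<integral>\<^sup>+y. \<integral>\<^sup>+z. ennreal (norm (k y z - ?s n y z)) * (indicator ?\<Omega> y * indicator ?\<Omega> z) \<partial>M \<partial>M)"
        using D(2) by (intro nn_integral_mono mult_left_mono mult_mono) (auto simp: indicator_def)
      also have "\<dots> \<le> ennreal (1 / real (Suc n))" using GS[of n] by blast
      finally show ?thesis .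
    qed
    show "(\<integral>\<^sup>+y. ennreal (norm (k y y - ?s n y y)) * indicator D y \<partial>M) \<le> ennreal (1 / real (Suc n))" for n
    proof -
      have "(\<integral>\<^sup>+y. ennreal (norm (k y y - ?s n y y)) * indicator D y \<partial>M) \<le>
        (\<integral>\<^sup>+y. ennreal (norm (k y y - ?s n y y)) * indicator ?\<Omega> y \<partial>M)"
        using D(2) by (intro nn_integral_mono mult_left_mono) (auto simp: indicator_def)
      also have "\<dots> \<le> ennreal (1 / real (Suc n))" using GS[of n] by blast
      finally show ?thesis .
    qed
  qed
  have A: "A \<in> bounded_borel" "A \<subseteq> ?\<Omega>" and B: "B \<in> bounded_borel" "B \<subseteq> ?\<Omega>"
    and U: "A \<union> B \<in> bounded_borel" "A \<union> B \<subseteq> ?\<Omega>" using AB bounded_borel_Un by auto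
  have I: "A \<inter> B \<in> bounded_borel" "A \<inter> B \<subseteq> ?\<Omega>"
    using bounded_borel_subset[OF AB(1), of "A \<inter> B"] AB[THEN bounded_borelD] by auto
  have "fredholm_series M (?s n) (A \<union> B) * fredholm_series M (?s n) (A \<inter> B) \<le>
      fredholm_series M (?s n) A * fredholm_series M (?s n) B" for n
  proof -
    \<comment> \<open>A point lies in \<open>A\<close> exactly if \<open>A\<close> belongs to its
      label, so unions and intersections of the regions become those of the index sets.\<close>
    let ?JA = "{i\<in>Pow (\<G> n). A \<in> i}" and ?JB = "{i\<in>Pow (\<G> n). B \<in> i}"
    let ?L = "\<lambda>i j. of_bool (i = j) - S n i j * (?r (\<G> n) i * ?r (\<G> n) j)"
    have cell: "cell (\<G> n) x \<in> ?JA \<longleftrightarrow> x \<in> A" "cell (\<G> n) x \<in> ?JB \<longleftrightarrow> x \<in> B" for x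
      using \<G>(3,4)[of n] by (auto simp: cell_def)
    have fin: "finite (Pow (\<G> n))" using \<G>(1) by simp
    have "fredholm_series M (?s n) A = Re (kernel_det ?L ?JA)"
      by (rule fredholm_series_cells[OF \<G>(1,2) A]) (blast, simp only: cell)
    moreover have "fredholm_series M (?s n) B = Re (kernel_det ?L ?JB)"
      by (rule fredholm_series_cells[OF \<G>(1,2) B]) (blast, simp only: cell)
    moreover have "fredholm_series M (?s n) (A \<union> B) = Re (kernel_det ?L (?JA \<union> ?JB))"
      by (rule fredholm_series_cells[OF \<G>(1,2) U]) (blast, simp only: Un_iff cell)
    moreover have "fredholm_series M (?s n) (A \<inter> B) = Re (kernel_det ?L (?JA \<inter> ?JB))"
      by (rule fredholm_series_cells[OF \<G>(1,2) I]) (blast, simp only: Int_iff cell)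
    moreover have "Re (kernel_det ?L (?JA \<union> ?JB)) * Re (kernel_det ?L (?JA \<inter> ?JB)) \<le>
        Re (kernel_det ?L ?JA) * Re (kernel_det ?L ?JB)"
    proof (rule kernel_det_Un_Int_le)
      show "finite ?JA" "finite ?JB" using fin by auto
      have "positive_matrix ?L (Pow (\<G> n))" using GS[of n] by blast
      then show "positive_matrix ?L (?JA \<union> ?JB)"
        by (rule positive_matrix_subset[OF fin]) auto
    qed
    ultimately show ?thesis by (simp only:)
  qed
  then show ?thesis
    by (intro LIMSEQ_le[OF tendsto_mult[OF conv[OF U] conv[OF I]] tendsto_mult[OF conv[OF A] conv[OF B]]]) auto
qed

end

section \<open>The quadratic form of the operator on step functions\<close>

lemma L2_norm_nonneg: "0 \<le> L2_norm N f"
  by (simp add: L2_norm_def)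

lemma L2_norm_square: "(L2_norm N f)\<^sup>2 = (LINT x|N. (cmod (f x))\<^sup>2)"
  by (simp add: L2_norm_def)

lemma L2_cmult: "f \<in> L2 N \<Longrightarrow> (\<lambda>x. c * f x) \<in> L2 N"
  by (auto simp: L2_def norm_mult power_mult_distrib)

lemma L2_norm_cmult: "L2_norm N (\<lambda>x. c * f x) = cmod c * L2_norm N f"
  by (simp add: L2_norm_def norm_mult power_mult_distrib real_sqrt_mult)

text \<open>The function is rescaled to norm 1. Boundedness of \<open>T\<close> makes the supremum
  meaningful and settles functions of norm 0, which cannot be rescaled.\<close>

lemma op_norm_bound:
  assumes T: "bounded_op N T" and f: "f \<in> L2 N"
  shows "L2_norm N (T f) \<le> op_norm N T * L2_norm N f"
proof -
  obtain C where C: "\<forall>f\<in>L2 N. L2_norm N (T f) \<le> C * L2_norm N f"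
    using T unfolding bounded_op_def by blast
  show ?thesis
  proof (cases "L2_norm N f = 0")
    case True
    then show ?thesis using bspec[OF C f] by simp
  next
    case False
    let ?a = "complex_of_real (1 / L2_norm N f)"
    let ?g = "\<lambda>x. ?a * f x"
    have a: "cmod ?a = 1 / L2_norm N f" using L2_norm_nonneg[of N f] by (simp add: norm_divide)
    have g: "?g \<in> L2 N" by (rule L2_cmult[OF f])
    have ng: "L2_norm N ?g = 1" unfolding L2_norm_cmult a using False by simp
    have bdd: "bdd_above ((\<lambda>f. L2_norm N (T f)) ` {f\<in>L2 N. L2_norm N f \<le> 1})"
    proof (rule bdd_aboveI2)
      fix h assume h: "h \<in> {f\<in>L2 N. L2_norm N f \<le> 1}"
      then have "L2_norm N (T h) \<le> C * L2_norm N h" using C by simp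
      also have "\<dots> \<le> \<bar>C\<bar> * 1" using h L2_norm_nonneg[of N h] by (intro mult_mono) auto
      finally show "L2_norm N (T h) \<le> \<bar>C\<bar>" by simp
    qed
    have "L2_norm N (T ?g) = L2_norm N (\<lambda>x. ?a * T f x)"
    proof -
      have "T ?g \<in> L2 N" "T f \<in> L2 N" using T g f by (auto simp: bounded_op_def)
      then have [measurable]: "T ?g \<in> borel_measurable N" "T f \<in> borel_measurable N" by (auto simp: L2_def)
      have "AE x in N. T ?g x = ?a * T f x" using T f unfolding bounded_op_def by blast
      then have "(LINT x|N. (cmod (T ?g x))\<^sup>2) = (LINT x|N. (cmod (?a * T f x))\<^sup>2)"
      proof (intro integral_cong_AE)
        assume "AE x in N. T ?g x = ?a * T f x"
        then show "AE x in N. (cmod (T ?g x))\<^sup>2 = (cmod (?a * T f x))\<^sup>2"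
          by eventually_elim (simp only:)
      qed measurable
      then show ?thesis by (simp add: L2_norm_def)
    qed
    also have "\<dots> = L2_norm N (T f) / L2_norm N f" unfolding L2_norm_cmult a by simp
    finally have "L2_norm N (T f) / L2_norm N f \<le> op_norm N T"
      unfolding op_norm_def using g ng cSUP_upper[OF _ bdd, of ?g] by simp
    then show ?thesis using False L2_norm_nonneg[of N f] by (simp add: field_simps)
  qed
qed

text \<open>The weighted inequality between geometric and arithmetic mean replaces Cauchy-Schwarz:
  with weight \<open>q\<close> each half contributes at most \<open>q / 2\<close> times the square
  norm. The weight has to be positive, hence an upper bound \<open>q\<close> and not the norm
  itself.\<close>

lemma L2_inner_op_le:
  assumes T: "bounded_op N T" and q: "op_norm N T \<le> q" "0 < q" and f: "f \<in> L2 N"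
  shows "cmod (L2_inner N f (T f)) \<le> q * (L2_norm N f)\<^sup>2"
proof -
  have Tf: "T f \<in> L2 N" using T f by (simp add: bounded_op_def)
  let ?g = "\<lambda>x. (q * (cmod (f x))\<^sup>2 + (cmod (T f x))\<^sup>2 / q) / 2"
  have i: "integrable N (\<lambda>x. (cmod (f x))\<^sup>2)" "integrable N (\<lambda>x. (cmod (T f x))\<^sup>2)"
    using f Tf by (simp_all add: L2_def)
  have pw: "a * b \<le> (q * a\<^sup>2 + b\<^sup>2 / q) / 2" for a b :: real
  proof -
    have "0 \<le> (q * a - b)\<^sup>2 / q" using q by simp
    also have "\<dots> = q * a\<^sup>2 + b\<^sup>2 / q - 2 * (a * b)" using q by (simp add: power2_eq_square field_simps)
    finally show ?thesis by simp
  qed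
  have "cmod (L2_inner N f (T f)) \<le> (LINT x|N. norm (cnj (f x) * T f x))"
    unfolding L2_inner_def by (rule integral_norm_bound)
  also have "\<dots> \<le> (LINT x|N. ?g x)"
  proof (rule integral_mono')
    show "integrable N ?g" using i by simp
    show "norm (cnj (f x) * T f x) \<le> ?g x" for x using pw by (simp add: norm_mult)
    show "0 \<le> ?g x" for x using q by simp
  qed
  also have "\<dots> = (q * (L2_norm N f)\<^sup>2 + (L2_norm N (T f))\<^sup>2 / q) / 2"
    using i by (simp add: L2_norm_square)
  also have "\<dots> \<le> (q * (L2_norm N f)\<^sup>2 + (q * L2_norm N f)\<^sup>2 / q) / 2"
  proof -
    have "L2_norm N (T f) \<le> q * L2_norm N f"
      using op_norm_bound[OF T f] mult_right_mono[OF q(1) L2_norm_nonneg] by (rule order_trans)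
    then have "(L2_norm N (T f))\<^sup>2 \<le> (q * L2_norm N f)\<^sup>2" by (rule power_mono) (rule L2_norm_nonneg)
    then show ?thesis using q(2) by (simp add: divide_right_mono)
  qed
  also have "\<dots> = q * (L2_norm N f)\<^sup>2" using q(2) by (simp add: power2_eq_square)
  finally show ?thesis .
qed

lemma sum_indicator_disjoint:
  fixes v :: "'i \<Rightarrow> 'b::real_algebra_1"
  assumes "finite J" "disjoint_family_on P J" "i \<in> J" "x \<in> P i"
  shows "(\<Sum>j\<in>J. v j * indicator (P j) x) = v i"
proof -
  have "(\<Sum>j\<in>J. v j * indicator (P j) x) = (\<Sum>j\<in>J. if j = i then v i else 0)"
  proof (intro sum.cong refl)
    fix j assume "j \<in> J"
    then show "v j * indicator (P j) x = (if j = i then v i else 0)"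
      using assms by (auto simp: indicator_def disjoint_family_on_def)
  qed
  then show ?thesis using assms by simp
qed

context diffuse_space
begin

text \<open>At each point at most one summand is nonzero, so the square produces no mixed
  terms.\<close>

lemma step_function_L2:
  fixes v :: "'i \<Rightarrow> complex"
  assumes J: "finite J" and P: "\<And>i. i \<in> J \<Longrightarrow> P i \<in> bounded_borel" and disj: "disjoint_family_on P J"
  shows "(\<lambda>x. \<Sum>i\<in>J. v i * indicator (P i) x) \<in> L2 M"
    and "(L2_norm M (\<lambda>x. \<Sum>i\<in>J. v i * indicator (P i) x))\<^sup>2 = (\<Sum>i\<in>J. (cmod (v i))\<^sup>2 * measure M (P i))"
proof -
  have PM: "P i \<in> sets M" if "i \<in> J" for i using P[OF that] bounded_borelD sets_M by simp
  have sq: "(cmod (\<Sum>i\<in>J. v i * indicator (P i) x))\<^sup>2 = (\<Sum>i\<in>J. (cmod (v i))\<^sup>2 * indicator (P i) x)" for x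
  proof (cases "\<exists>i\<in>J. x \<in> P i")
    case True
    then obtain i where i: "i \<in> J" "x \<in> P i" by blast
    show ?thesis by (simp only: sum_indicator_disjoint[OF J disj i])
  next
    case False
    have "(\<Sum>i\<in>J. v i * indicator (P i) x) = 0" by (rule sum.neutral) (use False in auto)
    moreover have "(\<Sum>i\<in>J. (cmod (v i))\<^sup>2 * indicator (P i) x) = 0" by (rule sum.neutral) (use False in auto)
    ultimately show ?thesis by simp
  qed
  have ind: "integrable M (\<lambda>x. (cmod (v i))\<^sup>2 * indicator (P i) x)" if "i \<in> J" for i
    using PM[OF that] emeasure_bounded[OF P[OF that]]
    by (intro integrable_mult_right integrable_real_indicator) auto
  then have int: "integrable M (\<lambda>x. (cmod (\<Sum>i\<in>J. v i * indicator (P i) x))\<^sup>2)"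
    unfolding sq by (intro Bochner_Integration.integrable_sum)
  have "(\<lambda>x. \<Sum>i\<in>J. v i * indicator (P i) x) \<in> borel_measurable M"
    using PM by (intro borel_measurable_sum borel_measurable_times borel_measurable_indicator) auto
  then show "(\<lambda>x. \<Sum>i\<in>J. v i * indicator (P i) x) \<in> L2 M" using int by (simp add: L2_def)
  show "(L2_norm M (\<lambda>x. \<Sum>i\<in>J. v i * indicator (P i) x))\<^sup>2 = (\<Sum>i\<in>J. (cmod (v i))\<^sup>2 * measure M (P i))"
    unfolding L2_norm_square sq
    by (subst Bochner_Integration.integral_sum) (use ind in auto)
qed

text \<open>Away from a null set \<open>T\<close> acts by integration against \<open>k\<close>, and
  integrability of \<open>k\<close> on each rectangle of cells justifies Fubini block by
  block.\<close>

lemma L2_inner_step_function: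
  fixes v :: "'i \<Rightarrow> complex"
  assumes T: "bounded_op M T" and k: "integral_op M T k"
    and J: "finite J" and P: "\<And>i. i \<in> J \<Longrightarrow> P i \<in> bounded_borel" and disj: "disjoint_family_on P J"
    and ki: "\<And>i j. i \<in> J \<Longrightarrow> j \<in> J \<Longrightarrow> set_integrable (M \<Otimes>\<^sub>M M) (P i \<times> P j) (\<lambda>p. k (fst p) (snd p))"
  defines "\<phi> \<equiv> \<lambda>x. \<Sum>i\<in>J. v i * indicator (P i) x"
  shows "L2_inner M \<phi> (T \<phi>) =
    (\<Sum>i\<in>J. \<Sum>j\<in>J. cnj (v i) * (LINT p:P i \<times> P j|M \<Otimes>\<^sub>M M. k (fst p) (snd p)) * v j)"
proof -
  have PM: "P i \<in> sets M" if "i \<in> J" for i using P[OF that] bounded_borelD sets_M by simp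
  have \<phi>: "\<phi> \<in> L2 M" unfolding \<phi>_def by (rule step_function_L2(1)[OF J P disj])
  let ?h = "\<lambda>i j x. LINT y|M. indicator (P i \<times> P j) (x, y) *\<^sub>R k x y"
  have h: "integrable M (?h i j)" "(LINT x|M. ?h i j x) = (LINT p:P i \<times> P j|M \<Otimes>\<^sub>M M. k (fst p) (snd p))"
    if "i \<in> J" "j \<in> J" for i j
    using pair.integrable_fst'[OF ki[OF that, unfolded set_integrable_def]]
      pair.integral_fst'[OF ki[OF that, unfolded set_integrable_def]]
    by (simp_all add: set_lebesgue_integral_def)
  have ind: "(\<lambda>x. indicator (P j) x) \<in> L2 M" if "j \<in> J" for j
    using step_function_L2(1)[of "{j}" P "\<lambda>_. 1"] P[OF that] by (simp add: disjoint_family_on_def)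
  have "AE x in M. \<forall>j\<in>J. integrable M (\<lambda>y. k x y * indicator (P j) y)"
  proof (rule AE_finite_allI[OF J])
    fix j assume "j \<in> J"
    from k[unfolded integral_op_def, THEN conjunct2, rule_format, OF ind[OF this]]
    show "AE x in M. integrable M (\<lambda>y. k x y * indicator (P j) y)" by eventually_elim simp
  qed
  moreover have "AE x in M. T \<phi> x = (LINT y|M. k x y * \<phi> y)"
    using k[unfolded integral_op_def, THEN conjunct2, rule_format, OF \<phi>] by eventually_elim simp
  ultimately have AE: "AE x in M. cnj (\<phi> x) * T \<phi> x = (\<Sum>i\<in>J. \<Sum>j\<in>J. cnj (v i) * v j * ?h i j x)"
  proof eventually_elim
    fix x assume 1: "\<forall>j\<in>J. integrable M (\<lambda>y. k x y * indicator (P j) y)"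
      and 2: "T \<phi> x = (LINT y|M. k x y * \<phi> y)"
    have "(LINT y|M. k x y * \<phi> y) = (LINT y|M. (\<Sum>j\<in>J. v j * (k x y * indicator (P j) y)))"
      by (intro Bochner_Integration.integral_cong) (auto simp: \<phi>_def sum_distrib_left mult_ac)
    also have "\<dots> = (\<Sum>j\<in>J. v j * (LINT y|M. k x y * indicator (P j) y))"
      using 1 by (subst Bochner_Integration.integral_sum) auto
    moreover have "cnj (\<phi> x) = (\<Sum>i\<in>J. cnj (v i) * indicator (P i) x)"
      unfolding \<phi>_def cnj_sum by (intro sum.cong refl) (simp add: indicator_def)
    ultimately have "cnj (\<phi> x) * T \<phi> x =
        (\<Sum>i\<in>J. cnj (v i) * indicator (P i) x) * (\<Sum>j\<in>J. v j * (LINT y|M. k x y * indicator (P j) y))"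
      by (simp only: 2)
    also have "\<dots> = (\<Sum>i\<in>J. \<Sum>j\<in>J. cnj (v i) * v j * ?h i j x)"
      unfolding sum_product
    proof (intro sum.cong refl)
      fix i j
      have "?h i j x = indicator (P i) x * (LINT y|M. k x y * indicator (P j) y)"
        by (subst Bochner_Integration.integral_mult_right_zero[symmetric])
          (auto intro!: Bochner_Integration.integral_cong simp: indicator_def)
      then show "cnj (v i) * indicator (P i) x * (v j * (LINT y|M. k x y * indicator (P j) y)) =
          cnj (v i) * v j * ?h i j x" by simp
    qed
    finally show "cnj (\<phi> x) * T \<phi> x = (\<Sum>i\<in>J. \<Sum>j\<in>J. cnj (v i) * v j * ?h i j x)" .
  qed
  have hm: "?h i j \<in> borel_measurable M" if "i \<in> J" "j \<in> J" for i j using h(1)[OF that] by simp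
  have "T \<phi> \<in> L2 M" using T \<phi> by (simp add: bounded_op_def)
  then have [measurable]: "\<phi> \<in> borel_measurable M" "T \<phi> \<in> borel_measurable M" using \<phi> by (auto simp: L2_def)
  have "L2_inner M \<phi> (T \<phi>) = (LINT x|M. (\<Sum>i\<in>J. \<Sum>j\<in>J. cnj (v i) * v j * ?h i j x))"
    unfolding L2_inner_def
  proof (rule integral_cong_AE[OF _ _ AE])
    have "(\<lambda>x. cnj (\<phi> x)) \<in> borel_measurable M" by (rule borel_measurable_continuous_on[OF continuous_on_cnj[OF continuous_on_id]]) measurable
    then show "(\<lambda>x. cnj (\<phi> x) * T \<phi> x) \<in> borel_measurable M" by measurable
    show "(\<lambda>x. \<Sum>i\<in>J. \<Sum>j\<in>J. cnj (v i) * v j * ?h i j x) \<in> borel_measurable M"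
      by (intro borel_measurable_sum borel_measurable_times borel_measurable_const hm)
  qed
  also have "\<dots> = (\<Sum>i\<in>J. \<Sum>j\<in>J. LINT x|M. cnj (v i) * v j * ?h i j x)"
    using h(1) by (subst Bochner_Integration.integral_sum | intro sum.cong refl Bochner_Integration.integrable_sum integrable_mult_right)+ auto
  also have "\<dots> = (\<Sum>i\<in>J. \<Sum>j\<in>J. cnj (v i) * (LINT p:P i \<times> P j|M \<Otimes>\<^sub>M M. k (fst p) (snd p)) * v j)"
    by (intro sum.cong refl) (simp add: h(2)[symmetric] mult_ac)
  finally show ?thesis .
qed

text \<open>Positivity and the norm bound of \<open>K\<close>, tested on step functions, supply the
  form condition of the discretization. It is used on the truncated sets, where the diagonal is
  bounded and the void probability equals its Fredholm series.\<close>

lemma void_probability_submodular: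
  assumes K: "positive_op M K" "op_norm M K < 1" and k: "correlation_kernel M K k"
    and \<mu>: "determinantal_process M k \<mu>" and AB: "A \<in> bounded_borel" "B \<in> bounded_borel"
  defines "V \<equiv> \<lambda>D. measure \<mu> {\<xi>\<in>space \<mu>. count_in D \<xi> = 0}"
  shows "V (A \<union> B) * V (A \<inter> B) \<le> V A * V B"
proof -
  have pp: "\<forall>f\<in>L2 M. L2_inner M f (K f) \<in> \<real>\<^sub>\<ge>\<^sub>0" using K(1) by (simp add: positive_op_def)
  have b: "bounded_op M K" using K by (simp add: positive_op_def)
  have io: "integral_op M K k" and pos: "AE \<alpha> in config_measure M. positive_matrix k \<alpha>"
    using k by (auto simp: correlation_kernel_def)
  have km: "(\<lambda>(x, y). k x y) \<in> borel_measurable (M \<Otimes>\<^sub>M M)" using io by (simp add: integral_op_def)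
  interpret \<mu>: prob_space \<mu> using \<mu> by (simp add: determinantal_process_def point_process_def)
  have s: "sets \<mu> = sets config_space" using \<mu> by (simp add: determinantal_process_def point_process_def)
  have sp: "space \<mu> = configurations" using sets_eq_imp_space_eq[OF s] by (simp add: space_config_space)
  \<comment> \<open>The midpoint between the norm and 1: still below 1, and positive even for norm
    0, as the weight in the norm estimate requires.\<close>
  define q where "q = (max 0 (op_norm M K) + 1) / 2"
  have q: "0 < q" "q < 1" "op_norm M K \<le> q" using K(2) by (auto simp: q_def max_def)
  \<comment> \<open>The bound \<open>n + 1\<close> is positive already for
    \<open>n = 0\<close>.\<close>
  define T where "T n = {x. Re (k x x) \<le> real n + 1}" for n
  have T: "T n \<in> sets borel" for n
  proof -
    have "(\<lambda>x. (x, x)) \<in> measurable M (M \<Otimes>\<^sub>M M)" by measurable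
    from measurable_compose[OF this km] have [measurable]: "(\<lambda>x. k x x) \<in> borel_measurable M" by simp
    have "{x\<in>space M. Re (k x x) \<le> real n + 1} \<in> sets M" by measurable
    then show ?thesis using sets_M by (simp add: T_def)
  qed
  have DT: "D \<inter> T n \<in> bounded_borel" if "D \<in> bounded_borel" for D n
    using that T bounded_borelD[OF that] by (intro bounded_borel_subset[OF that]) auto
  have c0: "(0::real) < real n + 1" for n by simp
  have V_eq: "V (D \<inter> T n) = fredholm_series M k (D \<inter> T n)" if "D \<in> bounded_borel" for D n
    unfolding V_def fredholm_series_def
    by (rule void_probability[OF km DT[OF that] \<mu> pos _ less_imp_le[OF c0[of n]]]) (simp add: T_def)
  have V_lim: "(\<lambda>n. V (D \<inter> T n)) \<longlonglongrightarrow> V D" if D: "D \<in> bounded_borel" for D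
  proof -
    let ?E = "\<lambda>n. {\<xi>\<in>space \<mu>. count_in (D \<inter> T n) \<xi> = 0}"
    \<comment> \<open>\<open>card\<close> vanishes on infinite sets too; a configuration meets a
      relatively compact set in finitely many points, so count 0 really means empty.\<close>
    have zero: "count_in D' \<xi> = 0 \<longleftrightarrow> \<xi> \<inter> D' = {}" if "\<xi> \<in> space \<mu>" "D' \<in> bounded_borel" for D' \<xi>
      using that by (simp add: count_in_def sp configurations_def)
    have "(\<lambda>n. measure \<mu> (?E n)) \<longlonglongrightarrow> measure \<mu> (\<Inter>n. ?E n)"
    proof (rule \<mu>.finite_Lim_measure_decseq)
      show "range ?E \<subseteq> sets \<mu>"
      proof (rule image_subsetI)
        fix n
        have [measurable]: "count_in (D \<inter> T n) \<in> measurable \<mu> (count_space UNIV)"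
          using measurable_count_in[OF DT[OF D]] by (simp only: measurable_cong_sets[OF s refl])
        show "?E n \<in> sets \<mu>" by measurable
      qed
      show "decseq ?E"
      proof (rule decseq_SucI)
        fix n
        have "T n \<subseteq> T (Suc n)" by (auto simp: T_def)
        then show "?E (Suc n) \<subseteq> ?E n" using zero DT[OF D] by blast
      qed
    qed
    also have "(\<Inter>n. ?E n) = {\<xi>\<in>space \<mu>. count_in D \<xi> = 0}"
    proof -
      have "\<exists>n. x \<in> T n" for x
      proof -
        obtain n :: nat where "Re (k x x) \<le> real n" using real_arch_simple by blast
        then have "x \<in> T n" by (simp add: T_def)
        then show ?thesis ..
      qed
      then have eq: "(\<forall>n. \<xi> \<inter> (D \<inter> T n) = {}) \<longleftrightarrow> \<xi> \<inter> D = {}" for \<xi> by blast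
      show ?thesis
      proof (rule set_eqI)
        fix \<xi>
        show "\<xi> \<in> (\<Inter>n. ?E n) \<longleftrightarrow> \<xi> \<in> {\<xi>\<in>space \<mu>. count_in D \<xi> = 0}"
        proof (cases "\<xi> \<in> space \<mu>")
          case True
          then show ?thesis
            by (simp only: INT_iff mem_Collect_eq zero[OF True D] zero[OF True DT[OF D]] eq ball_UNIV simp_thms)
        qed simp
      qed
    qed
    finally show ?thesis unfolding V_def .
  qed
  have ineq: "V ((A \<union> B) \<inter> T n) * V ((A \<inter> B) \<inter> T n) \<le> V (A \<inter> T n) * V (B \<inter> T n)" for n
  proof -
    let ?A = "A \<inter> T n" and ?B = "B \<inter> T n"
    have bb: "?A \<in> bounded_borel" "?B \<in> bounded_borel" using AB DT by auto
    have c: "\<forall>x\<in>?A \<union> ?B. Re (k x x) \<le> real n + 1" by (auto simp: T_def)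
    have "fredholm_series M k (?A \<union> ?B) * fredholm_series M k (?A \<inter> ?B) \<le>
        fredholm_series M k ?A * fredholm_series M k ?B"
    proof (rule fredholm_series_submodular[OF km pos bb c c0 less_imp_le[OF q(1)] q(2)])
      fix J :: "'a set set set" and P
      assume J: "finite J" and P: "\<And>i. i \<in> J \<Longrightarrow> P i \<in> sets borel" "\<And>i. i \<in> J \<Longrightarrow> P i \<subseteq> ?A \<union> ?B"
        and disj: "disjoint_family_on P J"
      have Pbb: "P i \<in> bounded_borel" if "i \<in> J" for i
        by (rule bounded_borel_subset[OF bounded_borel_Un[OF bb] P[OF that]])
      have ki: "set_integrable (M \<Otimes>\<^sub>M M) (P i \<times> P j) (\<lambda>p. k (fst p) (snd p))" if "i \<in> J" "j \<in> J" for i j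
        using P(2) c that by (intro set_integrable_kernel(1)[OF km pos Pbb Pbb, of _ _ "real n + 1"]) blast+
      let ?\<phi> = "\<lambda>v x. \<Sum>i\<in>J. v i * indicator (P i) x :: complex"
      have inner: "L2_inner M (?\<phi> v) (K (?\<phi> v)) =
        (\<Sum>i\<in>J. \<Sum>j\<in>J. cnj (v i) * (LINT p:P i \<times> P j|M \<Otimes>\<^sub>M M. k (fst p) (snd p)) * v j)" for v
        by (rule L2_inner_step_function[OF b io J _ disj]) (erule Pbb, erule ki)
      have \<phi>: "?\<phi> v \<in> L2 M" "(L2_norm M (?\<phi> v))\<^sup>2 = (\<Sum>i\<in>J. (cmod (v i))\<^sup>2 * measure M (P i))" for v
        by (rule step_function_L2[OF J _ disj], erule Pbb)+
      show "positive_matrix (\<lambda>i j. LINT p:P i \<times> P j|M \<Otimes>\<^sub>M M. k (fst p) (snd p)) J \<and>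
        (\<forall>v. Re (\<Sum>i\<in>J. \<Sum>j\<in>J. cnj (v i) * (LINT p:P i \<times> P j|M \<Otimes>\<^sub>M M. k (fst p) (snd p)) * v j) \<le>
          q * (\<Sum>i\<in>J. (cmod (v i))\<^sup>2 * measure M (P i)))"
        unfolding positive_matrix_def
      proof (intro conjI allI)
        fix v :: "'a set set \<Rightarrow> complex"
        show "(\<Sum>i\<in>J. \<Sum>j\<in>J. cnj (v i) * (LINT p:P i \<times> P j|M \<Otimes>\<^sub>M M. k (fst p) (snd p)) * v j) \<in> \<real>\<^sub>\<ge>\<^sub>0"
          unfolding inner[symmetric] using pp \<phi>(1)[of v] by (rule bspec)
        have "Re (L2_inner M (?\<phi> v) (K (?\<phi> v))) \<le> q * (L2_norm M (?\<phi> v))\<^sup>2"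
          using complex_Re_le_cmod L2_inner_op_le[OF b q(3,1) \<phi>(1)] by (rule order_trans)
        then show "Re (\<Sum>i\<in>J. \<Sum>j\<in>J. cnj (v i) * (LINT p:P i \<times> P j|M \<Otimes>\<^sub>M M. k (fst p) (snd p)) * v j) \<le>
          q * (\<Sum>i\<in>J. (cmod (v i))\<^sup>2 * measure M (P i))"
          unfolding inner \<phi>(2) .
      qed
    qed
    moreover have "?A \<union> ?B = (A \<union> B) \<inter> T n" "?A \<inter> ?B = (A \<inter> B) \<inter> T n" by auto
    moreover have "A \<inter> B \<in> bounded_borel"
      using bounded_borel_subset[OF AB(1), of "A \<inter> B"] AB[THEN bounded_borelD] by auto
    ultimately show ?thesis using AB bounded_borel_Un[OF AB] by (simp add: V_eq)
  qed
  have "A \<inter> B \<in> bounded_borel"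
    using bounded_borel_subset[OF AB(1), of "A \<inter> B"] AB[THEN bounded_borelD] by auto
  then show ?thesis
    using ineq AB bounded_borel_Un[OF AB]
    by (intro LIMSEQ_le[OF tendsto_mult[OF V_lim V_lim] tendsto_mult[OF V_lim V_lim]]) auto
qed

end

theorem corollary3p3:
  fixes lam :: "'a::{metric_space, second_countable_topology} measure"
    and K :: "'a op"
    and k :: "'a \<Rightarrow> 'a \<Rightarrow> complex"
    and \<mu> :: "'a set measure"
  assumes "locally_compact_space (euclidean :: 'a topology)"
    and "locally_finite_measure lam"
    and "diffuse lam"
    and "hermitian_op lam K"
    and "locally_trace_class lam K"
    and "positive_op lam K"
    and "positive_op lam (id_minus K)"
    and "op_norm lam K < 1"
    and "correlation_kernel lam K k"
    and "determinantal_process lam k \<mu>"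
  shows
    "(\<forall>\<Delta>\<in>bounded_borel. \<forall>\<Lambda>\<in>bounded_borel. \<forall>t. \<Lambda> \<subseteq> \<Delta> \<and> interaction_kernel lam K \<Delta> t \<longrightarrow>
        (\<forall>f\<in>borel_measurable (restrict_space config_space (configs_in \<Lambda>)).
           (\<forall>\<alpha>\<in>configs_in \<Lambda>. 0 \<le> f \<alpha>) \<longrightarrow>
           antimono_on {\<xi>\<in>configs_in (\<Delta> - \<Lambda>). Re (kernel_det t \<xi>) > 0}
             (\<lambda>\<xi>. cond_expectation lam t \<Lambda> f \<xi> / cond_void lam t \<Lambda> \<xi>)) \<and>
        mono_on {\<xi>\<in>configs_in (\<Delta> - \<Lambda>). Re (kernel_det t \<xi>) > 0} (cond_void lam t \<Lambda>))
     \<and> (\<forall>\<Lambda>\<in>bounded_borel. \<forall>\<Delta>\<^sub>1\<in>bounded_borel. \<forall>\<Delta>\<^sub>2\<in>bounded_borel. \<Lambda> \<subseteq> \<Delta>\<^sub>1 \<and> \<Delta>\<^sub>1 \<subseteq> \<Delta>\<^sub>2 \<longrightarrow>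
        \<P>(\<xi> in \<mu>. count_in \<Lambda> \<xi> = 0 \<bar> count_in (\<Delta>\<^sub>2 - \<Lambda>) \<xi> = 0)
          \<le> \<P>(\<xi> in \<mu>. count_in \<Lambda> \<xi> = 0 \<bar> count_in (\<Delta>\<^sub>1 - \<Lambda>) \<xi> = 0) \<and>
        \<P>(\<xi> in \<mu>. count_in \<Lambda> \<xi> = 0 \<bar> count_in (\<Delta>\<^sub>1 - \<Lambda>) \<xi> = 0)
          \<le> \<P>(\<xi> in \<mu>. count_in \<Lambda> \<xi> = 0))"
proof -
  interpret diffuse_space lam using assms(1-3) by unfold_locales
  interpret \<mu>: prob_space \<mu> using assms(10) by (simp add: determinantal_process_def point_process_def)
  have s: "sets \<mu> = sets config_space"
    using assms(10) by (simp add: determinantal_process_def point_process_def)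
  have sp: "space \<mu> = configurations" using sets_eq_imp_space_eq[OF s] by (simp add: space_config_space)
  let ?V = "\<lambda>D. measure \<mu> {\<xi>\<in>space \<mu>. count_in D \<xi> = 0}"
  have part1: "antimono_on {\<xi>\<in>configs_in (\<Delta> - \<Lambda>). Re (kernel_det t \<xi>) > 0}
        (\<lambda>\<xi>. cond_expectation lam t \<Lambda> f \<xi> / cond_void lam t \<Lambda> \<xi>)"
    "mono_on {\<xi>\<in>configs_in (\<Delta> - \<Lambda>). Re (kernel_det t \<xi>) > 0} (cond_void lam t \<Lambda>)"
    if "\<Delta> \<in> bounded_borel" "\<Lambda> \<in> bounded_borel" "interaction_kernel lam K \<Delta> t" for \<Delta> \<Lambda> t f
  proof -
    have t: "(\<lambda>(x, y). t x y) \<in> borel_measurable (lam \<Otimes>\<^sub>M lam)"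
      "\<And>\<alpha>. finite \<alpha> \<Longrightarrow> positive_matrix t \<alpha>"
      using that(3) by (simp_all add: interaction_kernel_def integral_op_def)
    note \<Lambda> = bounded_borelD[OF that(2)]
    note tr = interaction_kernel_trace_finite[OF that(3) \<Lambda>]
    show "antimono_on {\<xi>\<in>configs_in (\<Delta> - \<Lambda>). Re (kernel_det t \<xi>) > 0}
        (\<lambda>\<xi>. cond_expectation lam t \<Lambda> f \<xi> / cond_void lam t \<Lambda> \<xi>)"
      by (rule conditional_monotonicity(1)[OF \<Lambda> that(1) t tr])
    show "mono_on {\<xi>\<in>configs_in (\<Delta> - \<Lambda>). Re (kernel_det t \<xi>) > 0} (cond_void lam t \<Lambda>)"
      by (rule conditional_monotonicity(2)[OF \<Lambda> that(1) t tr])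
  qed
  have diff: "\<Delta> - \<Lambda> \<in> bounded_borel" if "\<Delta> \<in> bounded_borel" "\<Lambda> \<in> bounded_borel" for \<Delta> \<Lambda> :: "'a set"
    using that[THEN bounded_borelD] by (intro bounded_borel_subset[OF that(1)]) auto
  \<comment> \<open>Since \<Lambda> \<subseteq> \<Delta>, no point in \<Lambda> and none in \<Delta>
    - \<Lambda> together mean no point in \<Delta>.\<close>
  have cond: "\<P>(\<xi> in \<mu>. count_in \<Lambda> \<xi> = 0 \<bar> count_in (\<Delta> - \<Lambda>) \<xi> = 0) = ?V \<Delta> / ?V (\<Delta> - \<Lambda>)"
    if "\<Lambda> \<in> bounded_borel" "\<Delta> \<in> bounded_borel" "\<Lambda> \<subseteq> \<Delta>" for \<Lambda> \<Delta>
  proof -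
    have "{\<xi>\<in>space \<mu>. count_in \<Lambda> \<xi> = 0 \<and> count_in (\<Delta> - \<Lambda>) \<xi> = 0} = {\<xi>\<in>space \<mu>. count_in \<Delta> \<xi> = 0}"
    proof (intro Collect_cong conj_cong refl)
      fix \<xi> assume "\<xi> \<in> space \<mu>"
      then have "finite (\<xi> \<inter> D)" if "D \<in> bounded_borel" for D using that by (simp add: sp configurations_def)
      then show "count_in \<Lambda> \<xi> = 0 \<and> count_in (\<Delta> - \<Lambda>) \<xi> = 0 \<longleftrightarrow> count_in \<Delta> \<xi> = 0"
        using that diff[OF that(2,1)] by (simp add: count_in_def) blast
    qed
    then show ?thesis by (simp add: cond_prob_def)
  qed
  have antimono: "?V D' \<le> ?V D" if "D \<subseteq> D'" "D \<in> bounded_borel" "D' \<in> bounded_borel" for D D'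
  proof (rule \<mu>.finite_measure_mono)
    have m: "count_in D \<in> measurable \<mu> (count_space UNIV)"
      using measurable_count_in[OF that(2)] by (simp only: measurable_cong_sets[OF s refl])
    show "{\<xi>\<in>space \<mu>. count_in D \<xi> = 0} \<in> sets \<mu>" using m by measurable
    show "{\<xi>\<in>space \<mu>. count_in D' \<xi> = 0} \<subseteq> {\<xi>\<in>space \<mu>. count_in D \<xi> = 0}"
    proof (rule Collect_mono, rule impI)
      fix \<xi> assume x: "\<xi> \<in> space \<mu> \<and> count_in D' \<xi> = 0"
      then have "finite (\<xi> \<inter> D')" using that(3) by (simp add: sp configurations_def)
      then have "\<xi> \<inter> D' = {}" using x by (simp add: count_in_def)
      then have "\<xi> \<inter> D = {}" using that(1) by blast
      then show "\<xi> \<in> space \<mu> \<and> count_in D \<xi> = 0" using x by (simp add: count_in_def)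
    qed
  qed
  have sub: "?V (A \<union> B) * ?V (A \<inter> B) \<le> ?V A * ?V B" if "A \<in> bounded_borel" "B \<in> bounded_borel" for A B
    by (rule void_probability_submodular[OF assms(6,8,9,10) that])
  have part2: "?V \<Delta>\<^sub>2 / ?V (\<Delta>\<^sub>2 - \<Lambda>) \<le> ?V \<Delta>\<^sub>1 / ?V (\<Delta>\<^sub>1 - \<Lambda>)" "?V \<Delta>\<^sub>1 / ?V (\<Delta>\<^sub>1 - \<Lambda>) \<le> ?V \<Lambda>"
    if bb: "\<Lambda> \<in> bounded_borel" "\<Delta>\<^sub>1 \<in> bounded_borel" "\<Delta>\<^sub>2 \<in> bounded_borel" and inc: "\<Lambda> \<subseteq> \<Delta>\<^sub>1" "\<Delta>\<^sub>1 \<subseteq> \<Delta>\<^sub>2"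
    for \<Lambda> \<Delta>\<^sub>1 \<Delta>\<^sub>2
  proof -
    have d: "\<Delta>\<^sub>1 - \<Lambda> \<in> bounded_borel" "\<Delta>\<^sub>2 - \<Lambda> \<in> bounded_borel" using bb diff by auto
    \<comment> \<open>If the smaller denominator \<open>?V (\<Delta>\<^sub>2 - \<Lambda>)\<close> is
      positive, so is the other one. If it is 0, the left quotient is 0 by convention and there is
      nothing to show.\<close>
    have le: "?V (\<Delta>\<^sub>2 - \<Lambda>) \<le> ?V (\<Delta>\<^sub>1 - \<Lambda>)" using inc d by (intro antimono) auto
    \<comment> \<open>Submodularity for \<open>\<Delta>\<^sub>1\<close> and
      \<open>\<Delta>\<^sub>2 - \<Lambda>\<close> produces exactly the four sets in the two
      quotients.\<close>
    have "\<Delta>\<^sub>1 \<union> (\<Delta>\<^sub>2 - \<Lambda>) = \<Delta>\<^sub>2" "\<Delta>\<^sub>1 \<inter> (\<Delta>\<^sub>2 - \<Lambda>) = \<Delta>\<^sub>1 - \<Lambda>" using inc by auto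
    then have "?V \<Delta>\<^sub>2 * ?V (\<Delta>\<^sub>1 - \<Lambda>) \<le> ?V \<Delta>\<^sub>1 * ?V (\<Delta>\<^sub>2 - \<Lambda>)"
      using sub[OF bb(2) d(2)] by simp
    then show "?V \<Delta>\<^sub>2 / ?V (\<Delta>\<^sub>2 - \<Lambda>) \<le> ?V \<Delta>\<^sub>1 / ?V (\<Delta>\<^sub>1 - \<Lambda>)"
      using le measure_nonneg[of \<mu> "{\<xi>\<in>space \<mu>. count_in (\<Delta>\<^sub>2 - \<Lambda>) \<xi> = 0}"]
      by (cases "?V (\<Delta>\<^sub>2 - \<Lambda>) = 0") (auto simp: frac_le_eq divide_simps)
    \<comment> \<open>Here the two sets are disjoint and the empty set has void probability 1, so
      submodularity bounds the joint void probability by the product.\<close>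
    have "\<Lambda> \<union> (\<Delta>\<^sub>1 - \<Lambda>) = \<Delta>\<^sub>1" "\<Lambda> \<inter> (\<Delta>\<^sub>1 - \<Lambda>) = {}" using inc by auto
    moreover have "?V {} = 1" by (simp add: count_in_def \<mu>.prob_space)
    ultimately have "?V \<Delta>\<^sub>1 \<le> ?V \<Lambda> * ?V (\<Delta>\<^sub>1 - \<Lambda>)" using sub[OF bb(1) d(1)] by simp
    then show "?V \<Delta>\<^sub>1 / ?V (\<Delta>\<^sub>1 - \<Lambda>) \<le> ?V \<Lambda>"
      using measure_nonneg[of \<mu> "{\<xi>\<in>space \<mu>. count_in (\<Delta>\<^sub>1 - \<Lambda>) \<xi> = 0}"]
      by (cases "?V (\<Delta>\<^sub>1 - \<Lambda>) = 0") (auto simp: divide_le_eq)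
  qed
  show ?thesis
  proof (intro conjI ballI allI impI)
    fix \<Lambda> \<Delta>\<^sub>1 \<Delta>\<^sub>2 :: "'a set"
    assume bb: "\<Lambda> \<in> bounded_borel" "\<Delta>\<^sub>1 \<in> bounded_borel" "\<Delta>\<^sub>2 \<in> bounded_borel"
      and inc: "\<Lambda> \<subseteq> \<Delta>\<^sub>1 \<and> \<Delta>\<^sub>1 \<subseteq> \<Delta>\<^sub>2"
    then have inc2: "\<Lambda> \<subseteq> \<Delta>\<^sub>2" by blast
    show "\<P>(\<xi> in \<mu>. count_in \<Lambda> \<xi> = 0 \<bar> count_in (\<Delta>\<^sub>2 - \<Lambda>) \<xi> = 0)
          \<le> \<P>(\<xi> in \<mu>. count_in \<Lambda> \<xi> = 0 \<bar> count_in (\<Delta>\<^sub>1 - \<Lambda>) \<xi> = 0)"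
      using part2(1)[OF bb] inc by (simp add: cond bb inc2)
    show "\<P>(\<xi> in \<mu>. count_in \<Lambda> \<xi> = 0 \<bar> count_in (\<Delta>\<^sub>1 - \<Lambda>) \<xi> = 0) \<le> \<P>(\<xi> in \<mu>. count_in \<Lambda> \<xi> = 0)"
      using part2(2)[OF bb] inc by (simp add: cond bb)
  next
    fix \<Delta> \<Lambda> :: "'a set" and t and f :: "'a set \<Rightarrow> real"
    assume H: "\<Delta> \<in> bounded_borel" "\<Lambda> \<in> bounded_borel" "\<Lambda> \<subseteq> \<Delta> \<and> interaction_kernel lam K \<Delta> t"
    then show "antimono_on {\<xi>\<in>configs_in (\<Delta> - \<Lambda>). Re (kernel_det t \<xi>) > 0}
        (\<lambda>\<xi>. cond_expectation lam t \<Lambda> f \<xi> / cond_void lam t \<Lambda> \<xi>)"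
      by (intro part1(1)) simp_all
    show "mono_on {\<xi>\<in>configs_in (\<Delta> - \<Lambda>). Re (kernel_det t \<xi>) > 0} (cond_void lam t \<Lambda>)"
      using H by (intro part1(2)) simp_all
  qed
qed

end
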